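(* Let $\mathcal{Q}$ be a small quantaloid. Then $\mathbf{B}(\mathcal{Q}\text{-}\mathbf{Mat})$ and $\mathcal{Q}\text{-}\mathbf{CCat}$ are dually equivalent quantaloids. Thus one has equivalences of quantaloids $$\mathbf{B}(\mathcal{Q}\text{-}\mathbf{Dist})^{\mathrm{op}}\simeq\mathbf{B}(\mathcal{Q}\text{-}\mathbf{Mat})^{\mathrm{op}}\simeq\mathcal{Q}\text{-}\mathbf{CCat}.$$
   Context: A quantaloid is a category whose hom-sets are complete lattices and whose composition preserves arbitrary joins in each variable. A quantaloid homomorphism is a functor preserving joins of arrows; it is an equivalence of quantaloids if its underlying functor is an equivalence of categories. For arrows $f:X\to Y$, $g:Y\to Z$, $h:X\to Z$ the implications $h\swarrow f:Y\to Z$ and $g\searrow h:X\to Y$ are determined by $g\circ f\leq h\iff g\leq h\swarrow f\iff f\leq g\searrow h$. $\mathcal{C}^{\mathrm{op}}$ is the opposite category with the same order on hom-sets; $\mathcal{C}$ and $\mathcal{D}$ are dually equivalent if $\mathcal{C}^{\mathrm{op}}$ and $\mathcal{D}$ are equivalent as quantaloids. For a quantaloid $\mathcal{C}$, a Chu connection from $f:X_1\to Y_1$ to $g:X_2\to Y_2$ is a pair of arrows $(u:X_1\to X_2,\ v:Y_1\to Y_2)$ with $f\swarrow u=v\searrow g$. Arrows of $\mathcal{C}$ and Chu connections, with componentwise composition, identities $(1_X,1_Y)$, order and joins, form the quantaloid $\mathbf{ChuCon}(\mathcal{C})$. For Chu connections $(u,v),(u',v'):f\to g$ write $(u,v)\sim(u',v')$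 if $f\swarrow u=f\swarrow u'$ (equivalently $v\searrow g=v'\searrow g$). This is a congruence (compatible with composition and joins), and $\mathbf{B}(\mathcal{C}):=\mathbf{ChuCon}(\mathcal{C})/\!\sim$ is the quotient quantaloid (same objects, equivalence classes as arrows, induced compositions and joins). A $\mathcal{Q}$-category $\mathbb{A}$ is a set $\mathbb{A}_0$ with a type map $t:\mathbb{A}_0\to\mathrm{ob}\,\mathcal{Q}$ and hom-arrows $\mathbb{A}(x,y)\in\mathcal{Q}(tx,ty)$ with $1_{tx}\leq\mathbb{A}(x,x)$ and $\mathbb{A}(y,z)\circ\mathbb{A}(x,y)\leq\mathbb{A}(x,z)$. Its underlying preorder is: $x\leq y$ iff $tx=ty$ and $1_{tx}\leq\mathbb{A}(x,y)$; $\mathbb{A}$ is skeletal if this is a partial order. A $\mathcal{Q}$-functor $F:\mathbb{A}\to\mathbb{B}$ is a type-preserving map with $\mathbb{A}(x,y)\leq\mathbb{B}(Fx,Fy)$; $\mathcal{Q}$-functors are ordered pointwise, giving the locally ordered 2-category $\mathcal{Q}\text{-}\mathbf{Cat}$, in which adjunctions are taken. A $\mathcal{Q}$-distributor $\phi$ from $\mathbb{A}$ to $\mathbb{B}$ assigns to each $(x,y)\in\mathbb{A}_0\times\mathbb{B}_0$ an arrow $\phi(x,y)\in\mathcal{Q}(tx,ty)$ with $\mathbb{B}(y,y')\circ\phi(x,y)\circ\mathbb{A}(x',x)\leq\phi(x',y')$. With $(\psi\circ\phi)(x,z)=\bigvee_{y}\psi(y,z)\circ\phi(x,y)$, identities $\mathbb{A}$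 and the pointwise order, these form a quantaloid $\mathcal{Q}\text{-}\mathbf{Dist}$. A $\mathcal{Q}$-typed set is a set $A$ with a map $t:A\to\mathrm{ob}\,\mathcal{Q}$; it is viewed as a discrete $\mathcal{Q}$-category with $A(x,x)=1_{tx}$ and $A(x,y)=\bot_{tx,ty}$ (the bottom arrow) for $x\neq y$. A $\mathcal{Q}$-matrix between $\mathcal{Q}$-typed sets is a $\mathcal{Q}$-distributor between the corresponding discrete $\mathcal{Q}$-categories (i.e. an arbitrary family $\phi(x,y)\in\mathcal{Q}(tx,ty)$). $\mathcal{Q}\text{-}\mathbf{Mat}$ is the full subquantaloid of $\mathcal{Q}\text{-}\mathbf{Dist}$ of $\mathcal{Q}$-typed sets and $\mathcal{Q}$-matrices. For $X\in\mathrm{ob}\,\mathcal{Q}$, $*_X$ is the $\mathcal{Q}$-category with one object, of type $X$, and hom-arrow $1_X$. $\mathcal{P}\mathbb{A}$ has as objects of type $X$ the $\mathcal{Q}$-distributors $\mu$ from $\mathbb{A}$ to $*_X$, with $\mathcal{P}\mathbb{A}(\mu,\mu')=\mu'\swarrow\mu$. $\mathbb{A}$ is complete if the Yoneda embedding $\mathbb{A}\to\mathcal{P}\mathbb{A}$, $x\mapsto\mathbb{A}(-,x)$, has a left adjoint in $\mathcal{Q}\text{-}\mathbf{Cat}$. $\mathcal{Q}\text{-}\mathbf{CCat}$ is the quantaloid of skeletal complete $\mathcal{Q}$-categories and left adjoint $\mathcal{Q}$-functors, with the pointwise order. *)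

theory Defs
  imports "HOL-Algebra.Complete_Lattice" "HOL-Library.FuncSet" "HOL-Library.Equipollence"
begin

section \<open>Quantaloids\<close>

text \<open>
  Hom-sets are indexed by their domain and codomain and need not be disjoint; accordingly
  composition and order carry their objects as arguments: \<open>Cmp C X Y Z g f\<close> is the composite
  of \<open>f : X \<rightarrow> Y\<close> and \<open>g : Y \<rightarrow> Z\<close>.
\<close>

record ('o, 'a) qtld =
  Ob :: "'o set"
  Hom :: "'o \<Rightarrow> 'o \<Rightarrow> 'a set"
  Ide :: "'o \<Rightarrow> 'a"
  Cmp :: "'o \<Rightarrow> 'o \<Rightarrow> 'o \<Rightarrow> 'a \<Rightarrow> 'a \<Rightarrow> 'a"
  Leq :: "'o \<Rightarrow> 'o \<Rightarrow> 'a \<Rightarrow> 'a \<Rightarrow> bool"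

locale category =
  fixes C :: "('o, 'a) qtld"
  assumes Ide_closed: "X \<in> Ob C \<Longrightarrow> Ide C X \<in> Hom C X X"
    and Cmp_closed: "\<lbrakk>X \<in> Ob C; Y \<in> Ob C; Z \<in> Ob C; f \<in> Hom C X Y; g \<in> Hom C Y Z\<rbrakk>
      \<Longrightarrow> Cmp C X Y Z g f \<in> Hom C X Z"
    and Cmp_Ide_right: "\<lbrakk>X \<in> Ob C; Y \<in> Ob C; f \<in> Hom C X Y\<rbrakk> \<Longrightarrow> Cmp C X X Y f (Ide C X) = f"
    and Cmp_Ide_left: "\<lbrakk>X \<in> Ob C; Y \<in> Ob C; f \<in> Hom C X Y\<rbrakk> \<Longrightarrow> Cmp C X Y Y (Ide C Y) f = f"
    and Cmp_assoc: "\<lbrakk>W \<in> Ob C; X \<in> Ob C; Y \<in> Ob C; Z \<in> Ob C;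
        f \<in> Hom C W X; g \<in> Hom C X Y; h \<in> Hom C Y Z\<rbrakk>
      \<Longrightarrow> Cmp C W X Z (Cmp C X Y Z h g) f = Cmp C W Y Z h (Cmp C W X Y g f)"

definition hom_lat :: "('o, 'a) qtld \<Rightarrow> 'o \<Rightarrow> 'o \<Rightarrow> 'a gorder" where
  "hom_lat C X Y = \<lparr>carrier = Hom C X Y, eq = (=), le = Leq C X Y\<rparr>"

locale quantaloid = category C for C :: "('o, 'a) qtld" +
  assumes hom_complete: "\<lbrakk>X \<in> Ob C; Y \<in> Ob C\<rbrakk> \<Longrightarrow> complete_lattice (hom_lat C X Y)"
    and Cmp_sup_right: "\<lbrakk>X \<in> Ob C; Y \<in> Ob C; Z \<in> Ob C; g \<in> Hom C Y Z\<rbrakk>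
      \<Longrightarrow> sup_pres (hom_lat C X Y) (hom_lat C X Z) (\<lambda>f. Cmp C X Y Z g f)"
    and Cmp_sup_left: "\<lbrakk>X \<in> Ob C; Y \<in> Ob C; Z \<in> Ob C; f \<in> Hom C X Y\<rbrakk>
      \<Longrightarrow> sup_pres (hom_lat C Y Z) (hom_lat C X Z) (\<lambda>g. Cmp C X Y Z g f)"

text \<open>
  For \<open>f : X \<rightarrow> Y\<close>, \<open>g : Y \<rightarrow> Z\<close> and \<open>h : X \<rightarrow> Z\<close>, \<open>lres C X Y Z h f\<close> is
  \<open>h \<swarrow> f : Y \<rightarrow> Z\<close> and \<open>rres C X Y Z g h\<close> is \<open>g \<searrow> h : X \<rightarrow> Y\<close>.
\<close>

definition lres :: "('o, 'a) qtld \<Rightarrow> 'o \<Rightarrow> 'o \<Rightarrow> 'o \<Rightarrow> 'a \<Rightarrow> 'a \<Rightarrow> 'a" where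
  "lres C X Y Z h f = (THE k. k \<in> Hom C Y Z \<and>
     (\<forall>g\<in>Hom C Y Z. Leq C X Z (Cmp C X Y Z g f) h \<longleftrightarrow> Leq C Y Z g k))"

definition rres :: "('o, 'a) qtld \<Rightarrow> 'o \<Rightarrow> 'o \<Rightarrow> 'o \<Rightarrow> 'a \<Rightarrow> 'a \<Rightarrow> 'a" where
  "rres C X Y Z g h = (THE k. k \<in> Hom C X Y \<and>
     (\<forall>f\<in>Hom C X Y. Leq C X Z (Cmp C X Y Z g f) h \<longleftrightarrow> Leq C X Y f k))"

definition opposite :: "('o, 'a) qtld \<Rightarrow> ('o, 'a) qtld" where
  "opposite C = \<lparr>Ob = Ob C, Hom = (\<lambda>X Y. Hom C Y X), Ide = Ide C,
     Cmp = (\<lambda>X Y Z g f. Cmp C Z Y X f g), Leq = (\<lambda>X Y. Leq C Y X)\<rparr>"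

definition full_sub :: "('o, 'a) qtld \<Rightarrow> 'o set \<Rightarrow> ('o, 'a) qtld" where
  "full_sub C S = C\<lparr>Ob := Ob C \<inter> S\<rparr>"


section \<open>Equivalence of quantaloids\<close>

locale cat_functor = C: category C + D: category D
  for C :: "('o, 'a) qtld" and D :: "('p, 'b) qtld" +
  fixes Fo :: "'o \<Rightarrow> 'p" and Fa :: "'o \<Rightarrow> 'o \<Rightarrow> 'a \<Rightarrow> 'b"
  assumes Fo_closed: "X \<in> Ob C \<Longrightarrow> Fo X \<in> Ob D"
    and Fa_closed: "\<lbrakk>X \<in> Ob C; Y \<in> Ob C; f \<in> Hom C X Y\<rbrakk> \<Longrightarrow> Fa X Y f \<in> Hom D (Fo X) (Fo Y)"
    and Fa_Ide: "X \<in> Ob C \<Longrightarrow> Fa X X (Ide C X) = Ide D (Fo X)"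
    and Fa_Cmp: "\<lbrakk>X \<in> Ob C; Y \<in> Ob C; Z \<in> Ob C; f \<in> Hom C X Y; g \<in> Hom C Y Z\<rbrakk>
      \<Longrightarrow> Fa X Z (Cmp C X Y Z g f) = Cmp D (Fo X) (Fo Y) (Fo Z) (Fa Y Z g) (Fa X Y f)"

definition iso_arrow :: "('o, 'a) qtld \<Rightarrow> 'o \<Rightarrow> 'o \<Rightarrow> 'a \<Rightarrow> bool" where
  "iso_arrow C X Y f \<longleftrightarrow> f \<in> Hom C X Y \<and>
     (\<exists>g\<in>Hom C Y X. Cmp C X Y X g f = Ide C X \<and> Cmp C Y X Y f g = Ide C Y)"

definition natural_iso ::
  "('o, 'a) qtld \<Rightarrow> ('p, 'b) qtld \<Rightarrow> ('o \<Rightarrow> 'p) \<Rightarrow> ('o \<Rightarrow> 'o \<Rightarrow> 'a \<Rightarrow> 'b)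
    \<Rightarrow> ('o \<Rightarrow> 'p) \<Rightarrow> ('o \<Rightarrow> 'o \<Rightarrow> 'a \<Rightarrow> 'b) \<Rightarrow> ('o \<Rightarrow> 'b) \<Rightarrow> bool" where
  "natural_iso C D Fo Fa Go Ga \<eta> \<longleftrightarrow>
     (\<forall>X\<in>Ob C. iso_arrow D (Fo X) (Go X) (\<eta> X)) \<and>
     (\<forall>X\<in>Ob C. \<forall>Y\<in>Ob C. \<forall>f\<in>Hom C X Y.
        Cmp D (Fo X) (Fo Y) (Go Y) (\<eta> Y) (Fa X Y f) = Cmp D (Fo X) (Go X) (Go Y) (Ga X Y f) (\<eta> X))"

definition category_equivalence ::
  "('o, 'a) qtld \<Rightarrow> ('p, 'b) qtld \<Rightarrow> ('o \<Rightarrow> 'p) \<Rightarrow> ('o \<Rightarrow> 'o \<Rightarrow> 'a \<Rightarrow> 'b) \<Rightarrow> bool" where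
  "category_equivalence C D Fo Fa \<longleftrightarrow> cat_functor C D Fo Fa \<and>
     (\<exists>Go Ga \<eta> \<epsilon>. cat_functor D C Go Ga \<and>
        natural_iso C C (\<lambda>X. X) (\<lambda>X Y f. f)
          (\<lambda>X. Go (Fo X)) (\<lambda>X Y f. Ga (Fo X) (Fo Y) (Fa X Y f)) \<eta> \<and>
        natural_iso D D (\<lambda>X. Fo (Go X)) (\<lambda>X Y f. Fa (Go X) (Go Y) (Ga X Y f))
          (\<lambda>X. X) (\<lambda>X Y f. f) \<epsilon>)"

locale quantaloid_hom = cat_functor C D Fo Fa + C: quantaloid C + D: quantaloid D
  for C :: "('o, 'a) qtld" and D :: "('p, 'b) qtld"
    and Fo :: "'o \<Rightarrow> 'p" and Fa :: "'o \<Rightarrow> 'o \<Rightarrow> 'a \<Rightarrow> 'b" +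
  assumes Fa_sup: "\<lbrakk>X \<in> Ob C; Y \<in> Ob C\<rbrakk>
      \<Longrightarrow> sup_pres (hom_lat C X Y) (hom_lat D (Fo X) (Fo Y)) (Fa X Y)"

definition equivalent_quantaloids :: "('o, 'a) qtld \<Rightarrow> ('p, 'b) qtld \<Rightarrow> bool" where
  "equivalent_quantaloids C D \<longleftrightarrow> quantaloid C \<and> quantaloid D \<and>
     (\<exists>Fo Fa. quantaloid_hom C D Fo Fa \<and> category_equivalence C D Fo Fa)"

definition dually_equivalent :: "('o, 'a) qtld \<Rightarrow> ('p, 'b) qtld \<Rightarrow> bool" where
  "dually_equivalent C D \<longleftrightarrow> equivalent_quantaloids (opposite C) D"


section \<open>Chu connections and their quotient\<close>

text \<open>An object \<open>(X, Y, f)\<close> is an arrow \<open>f : X \<rightarrow> Y\<close> of \<open>C\<close>.\<close>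

fun chu_connections ::
  "('o, 'a) qtld \<Rightarrow> 'o \<times> 'o \<times> 'a \<Rightarrow> 'o \<times> 'o \<times> 'a \<Rightarrow> ('a \<times> 'a) set" where
  "chu_connections C (X1, Y1, f) (X2, Y2, g) =
     {(u, v). u \<in> Hom C X1 X2 \<and> v \<in> Hom C Y1 Y2 \<and>
        lres C X1 X2 Y1 f u = rres C X2 Y1 Y2 v g}"

definition ChuCon :: "('o, 'a) qtld \<Rightarrow> ('o \<times> 'o \<times> 'a, 'a \<times> 'a) qtld" where
  "ChuCon C = \<lparr>
     Ob = {(X, Y, f). X \<in> Ob C \<and> Y \<in> Ob C \<and> f \<in> Hom C X Y},
     Hom = chu_connections C,
     Ide = (\<lambda>(X, Y, f). (Ide C X, Ide C Y)),
     Cmp = (\<lambda>(X1, Y1, f1) (X2, Y2, f2) (X3, Y3, f3) (u', v') (u, v).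
       (Cmp C X1 X2 X3 u' u, Cmp C Y1 Y2 Y3 v' v)),
     Leq = (\<lambda>(X1, Y1, f1) (X2, Y2, f2) (u, v) (u', v'). Leq C X1 X2 u u' \<and> Leq C Y1 Y2 v v')\<rparr>"

fun chu_equiv ::
  "('o, 'a) qtld \<Rightarrow> 'o \<times> 'o \<times> 'a \<Rightarrow> 'o \<times> 'o \<times> 'a \<Rightarrow> (('a \<times> 'a) \<times> ('a \<times> 'a)) set" where
  "chu_equiv C (X1, Y1, f) (X2, Y2, g) =
     {((u, v), (u', v')).
        (u, v) \<in> chu_connections C (X1, Y1, f) (X2, Y2, g) \<and>
        (u', v') \<in> chu_connections C (X1, Y1, f) (X2, Y2, g) \<and>
        lres C X1 X2 Y1 f u = lres C X1 X2 Y1 f u'}"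

text \<open>
  Quotient of a quantaloid by a congruence.  The order is the one induced by the joins of
  classes: \<open>P \<le> R\<close> iff \<open>P \<squnion> R = R\<close>, where the join of two classes is the class of the join of
  representatives.
\<close>

definition quotient_qtld ::
  "('o, 'a) qtld \<Rightarrow> ('o \<Rightarrow> 'o \<Rightarrow> ('a \<times> 'a) set) \<Rightarrow> ('o, 'a set) qtld" where
  "quotient_qtld C \<theta> = \<lparr>
     Ob = Ob C,
     Hom = (\<lambda>X Y. Hom C X Y // \<theta> X Y),
     Ide = (\<lambda>X. \<theta> X X `` {Ide C X}),
     Cmp = (\<lambda>X Y Z R P. \<Union>r\<in>R. \<Union>p\<in>P. \<theta> X Z `` {Cmp C X Y Z r p}),
     Leq = (\<lambda>X Y P R. \<exists>p\<in>P. \<exists>r\<in>R. p \<squnion>\<^bsub>hom_lat C X Y\<^esub> r \<in> R)\<rparr>"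

definition BChu :: "('o, 'a) qtld \<Rightarrow> ('o \<times> 'o \<times> 'a, ('a \<times> 'a) set) qtld" where
  "BChu C = quotient_qtld (ChuCon C) (chu_equiv C)"


section \<open>Categories, distributors and matrices over a quantaloid\<close>

text \<open>
  All structure maps are extensional (\<open>PiE\<close>), so that equality of categories, distributors and
  functors is not affected by values outside the underlying sets.
\<close>

record ('x, 'o, 'a) qcat =
  qob :: "'x set"
  qtype :: "'x \<Rightarrow> 'o"
  qhom :: "'x \<Rightarrow> 'x \<Rightarrow> 'a"

locale qcategory =
  fixes Q :: "('o, 'a) qtld" and A :: "('x, 'o, 'a) qcat"
  assumes qtype_closed: "qtype A \<in> qob A \<rightarrow>\<^sub>E Ob Q"
    and qhom_closed: "qhom A \<in> (\<Pi>\<^sub>E x\<in>qob A. \<Pi>\<^sub>E y\<in>qob A. Hom Q (qtype A x) (qtype A y))"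
    and qhom_refl: "x \<in> qob A \<Longrightarrow> Leq Q (qtype A x) (qtype A x) (Ide Q (qtype A x)) (qhom A x x)"
    and qhom_trans: "\<lbrakk>x \<in> qob A; y \<in> qob A; z \<in> qob A\<rbrakk> \<Longrightarrow>
      Leq Q (qtype A x) (qtype A z)
        (Cmp Q (qtype A x) (qtype A y) (qtype A z) (qhom A y z) (qhom A x y)) (qhom A x z)"

definition qle :: "('o, 'a) qtld \<Rightarrow> ('x, 'o, 'a) qcat \<Rightarrow> 'x \<Rightarrow> 'x \<Rightarrow> bool" where
  "qle Q A x y \<longleftrightarrow> qtype A x = qtype A y \<and>
     Leq Q (qtype A x) (qtype A x) (Ide Q (qtype A x)) (qhom A x y)"

definition skeletal :: "('o, 'a) qtld \<Rightarrow> ('x, 'o, 'a) qcat \<Rightarrow> bool" where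
  "skeletal Q A \<longleftrightarrow> (\<forall>x\<in>qob A. \<forall>y\<in>qob A. qle Q A x y \<longrightarrow> qle Q A y x \<longrightarrow> x = y)"

definition qfunctor ::
  "('o, 'a) qtld \<Rightarrow> ('x, 'o, 'a) qcat \<Rightarrow> ('y, 'o, 'a) qcat \<Rightarrow> ('x \<Rightarrow> 'y) \<Rightarrow> bool" where
  "qfunctor Q A B F \<longleftrightarrow> F \<in> qob A \<rightarrow>\<^sub>E qob B \<and>
     (\<forall>x\<in>qob A. qtype B (F x) = qtype A x) \<and>
     (\<forall>x\<in>qob A. \<forall>y\<in>qob A. Leq Q (qtype A x) (qtype A y) (qhom A x y) (qhom B (F x) (F y)))"

definition qfun_le ::
  "('o, 'a) qtld \<Rightarrow> ('x, 'o, 'a) qcat \<Rightarrow> ('y, 'o, 'a) qcat \<Rightarrow> ('x \<Rightarrow> 'y) \<Rightarrow> ('x \<Rightarrow> 'y) \<Rightarrow> bool" where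
  "qfun_le Q A B F G \<longleftrightarrow> (\<forall>x\<in>qob A. qle Q B (F x) (G x))"

text \<open>\<open>F : A \<rightarrow> B\<close> is left adjoint to \<open>G : B \<rightarrow> A\<close>.\<close>

definition qadjoint ::
  "('o, 'a) qtld \<Rightarrow> ('x, 'o, 'a) qcat \<Rightarrow> ('y, 'o, 'a) qcat \<Rightarrow> ('x \<Rightarrow> 'y) \<Rightarrow> ('y \<Rightarrow> 'x) \<Rightarrow> bool" where
  "qadjoint Q A B F G \<longleftrightarrow> qfunctor Q A B F \<and> qfunctor Q B A G \<and>
     qfun_le Q A A (\<lambda>x\<in>qob A. x) (compose (qob A) G F) \<and>
     qfun_le Q B B (compose (qob B) F G) (\<lambda>y\<in>qob B. y)"

definition qdist ::
  "('o, 'a) qtld \<Rightarrow> ('x, 'o, 'a) qcat \<Rightarrow> ('y, 'o, 'a) qcat \<Rightarrow> ('x \<Rightarrow> 'y \<Rightarrow> 'a) set" where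
  "qdist Q A B = {\<phi> \<in> (\<Pi>\<^sub>E x\<in>qob A. \<Pi>\<^sub>E y\<in>qob B. Hom Q (qtype A x) (qtype B y)).
     \<forall>x\<in>qob A. \<forall>x'\<in>qob A. \<forall>y\<in>qob B. \<forall>y'\<in>qob B.
       Leq Q (qtype A x') (qtype B y')
         (Cmp Q (qtype A x') (qtype B y) (qtype B y') (qhom B y y')
            (Cmp Q (qtype A x') (qtype A x) (qtype B y) (\<phi> x y) (qhom A x' x)))
         (\<phi> x' y')}"

text \<open>
  Universe of sets: a set is small if it has smaller cardinality than the type \<open>'u\<close>, which is
  required to be a strong limit.  Every Grothendieck universe is of this form; regularity and
  uncountability are not required, so that \<open>nat\<close> (with the finite sets as small sets) is an
  instance as well.
\<close>

definition universe :: "'u itself \<Rightarrow> bool" where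
  "universe _ \<longleftrightarrow> infinite (UNIV :: 'u set) \<and>
     (\<forall>S :: 'u set. S \<prec> (UNIV :: 'u set) \<longrightarrow> Pow S \<prec> (UNIV :: 'u set))"

definition small :: "'u itself \<Rightarrow> 'b set \<Rightarrow> bool" where
  "small _ S \<longleftrightarrow> S \<prec> (UNIV :: 'u set)"

definition small_quantaloid :: "'u itself \<Rightarrow> ('o, 'a) qtld \<Rightarrow> bool" where
  "small_quantaloid U Q \<longleftrightarrow> quantaloid Q \<and> small U (Ob Q) \<and>
     small U (\<Union>X\<in>Ob Q. \<Union>Y\<in>Ob Q. Hom Q X Y)"

definition QDist :: "('o, 'a) qtld \<Rightarrow> (('u, 'o, 'a) qcat, 'u \<Rightarrow> 'u \<Rightarrow> 'a) qtld" where
  "QDist Q = \<lparr>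
     Ob = {A. qcategory Q A \<and> small TYPE('u) (qob A)},
     Hom = qdist Q,
     Ide = qhom,
     Cmp = (\<lambda>A B C \<psi> \<phi>. \<lambda>x\<in>qob A. \<lambda>z\<in>qob C.
       \<Squnion>\<^bsub>hom_lat Q (qtype A x) (qtype C z)\<^esub>
         ((\<lambda>y. Cmp Q (qtype A x) (qtype B y) (qtype C z) (\<psi> y z) (\<phi> x y)) ` qob B)),
     Leq = (\<lambda>A B \<phi> \<psi>. \<forall>x\<in>qob A. \<forall>y\<in>qob B. Leq Q (qtype A x) (qtype B y) (\<phi> x y) (\<psi> x y))\<rparr>"

definition discrete :: "('o, 'a) qtld \<Rightarrow> 'x set \<Rightarrow> ('x \<Rightarrow> 'o) \<Rightarrow> ('x, 'o, 'a) qcat" where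
  "discrete Q S t = \<lparr>qob = S, qtype = t,
     qhom = (\<lambda>x\<in>S. \<lambda>y\<in>S. if x = y then Ide Q (t x) else \<bottom>\<^bsub>hom_lat Q (t x) (t y)\<^esub>)\<rparr>"

definition QMat :: "('o, 'a) qtld \<Rightarrow> (('u, 'o, 'a) qcat, 'u \<Rightarrow> 'u \<Rightarrow> 'a) qtld" where
  "QMat Q = full_sub (QDist Q) {discrete Q S t | S t. t \<in> S \<rightarrow>\<^sub>E Ob Q}"


section \<open>Presheaves and complete categories\<close>

text \<open>
  The single object of \<open>star Q X\<close> is an arbitrary fixed element of the universe type, so that
  \<open>star Q X\<close> lives among the objects of \<open>QDist Q\<close>.
\<close>

abbreviation pt :: 'x where "pt \<equiv> undefined"

definition star :: "('o, 'a) qtld \<Rightarrow> 'o \<Rightarrow> ('x, 'o, 'a) qcat" where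
  "star Q X = \<lparr>qob = {pt}, qtype = (\<lambda>x\<in>{pt}. X), qhom = (\<lambda>x\<in>{pt}. \<lambda>y\<in>{pt}. Ide Q X)\<rparr>"

text \<open>
  The object \<open>(X, \<mu>)\<close> is the distributor \<open>\<mu>\<close> from \<open>A\<close> to \<open>star Q X\<close>.  The hom-arrow is the
  implication \<open>\<mu>' \<swarrow> \<mu>\<close> in \<open>QDist Q\<close>, a distributor between one-object categories,
  identified with its only entry.
\<close>

definition presheaves ::
  "('o, 'a) qtld \<Rightarrow> ('u, 'o, 'a) qcat \<Rightarrow> ('o \<times> ('u \<Rightarrow> 'u \<Rightarrow> 'a), 'o, 'a) qcat" where
  "presheaves Q A = (let P = (SIGMA X:Ob Q. qdist Q A (star Q X)) in
     \<lparr>qob = P,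
      qtype = restrict fst P,
      qhom = (\<lambda>(X, \<mu>)\<in>P. \<lambda>(X', \<mu>')\<in>P. lres (QDist Q) A (star Q X) (star Q X') \<mu>' \<mu> pt pt)\<rparr>)"

definition yoneda ::
  "('o, 'a) qtld \<Rightarrow> ('u, 'o, 'a) qcat \<Rightarrow> 'u \<Rightarrow> 'o \<times> ('u \<Rightarrow> 'u \<Rightarrow> 'a)" where
  "yoneda Q A = (\<lambda>x\<in>qob A. (qtype A x, \<lambda>y\<in>qob A. \<lambda>z\<in>{pt}. qhom A y x))"

definition complete_qcat :: "('o, 'a) qtld \<Rightarrow> ('u, 'o, 'a) qcat \<Rightarrow> bool" where
  "complete_qcat Q A \<longleftrightarrow> (\<exists>F. qadjoint Q (presheaves Q A) A F (yoneda Q A))"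

definition QCCat :: "('o, 'a) qtld \<Rightarrow> (('u, 'o, 'a) qcat, 'u \<Rightarrow> 'u) qtld" where
  "QCCat Q = \<lparr>
     Ob = {A. qcategory Q A \<and> small TYPE('u) (qob A) \<and> skeletal Q A \<and> complete_qcat Q A},
     Hom = (\<lambda>A B. {F. \<exists>G. qadjoint Q A B F G}),
     Ide = (\<lambda>A. \<lambda>x\<in>qob A. x),
     Cmp = (\<lambda>A B C G F. compose (qob A) G F),
     Leq = qfun_le Q\<rparr>"

end

theory Submission
  imports Defs
begin

text \<open>
  The class of a Chu connection \<open>(u, v) : f \<rightarrow> g\<close> is determined by the single arrow
  \<open>w = f \<swarrow> u = v \<searrow> g\<close>, called its bond below.  Residuation turns suprema into infima and
  composition into iterated residuation, \<open>f \<swarrow> (u' \<circ> u) = (f \<swarrow> u) \<swarrow> u' = v \<searrow> (g \<swarrow> u')\<close>; so the bond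
  of a composite depends only on the bonds of the factors, the order of classes is the reverse of
  the order of bonds, and \<open>B(C)\<close> is a quantaloid for every quantaloid \<open>C\<close> (\<open>quantaloid_BChu\<close>).

  Both equivalences arise by comparing two fully faithful functors, bijective and order preserving
  and reflecting on homs, with the same target \<open>B(Q-Dist)\<^sup>o\<^sup>p\<close> and with the same isomorphism classes
  in their images (\<open>equivalent_quantaloidsI\<close>).  The ones for \<open>Q-Dist\<close> and \<open>Q-Mat\<close> are the identity and the
  inclusion.  The one for
  \<open>Q-CCat\<close> sends \<open>A\<close> to its identity distributor \<open>1\<^sub>A\<close> and a left adjoint \<open>F : A \<rightarrow> B\<close> to the class
  \<open>1\<^sub>B \<rightarrow> 1\<^sub>A\<close> with bond \<open>B(F-, -)\<close> (\<open>order_embedding_QCCat\<close>).  It is full because, for complete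
  categories, any bond \<open>w = 1\<^sub>B \<swarrow> u = v \<searrow> 1\<^sub>A\<close> is of the form \<open>B(F-, -) = A(-, G-)\<close>:
  \<open>F x\<close> is the supremum of the column \<open>u(-, x)\<close>, and \<open>G y\<close> that of the column \<open>w(-, y)\<close>
  (\<open>adjoint_if_bond\<close>).

  It remains to see that every distributor \<open>\<phi> : A \<rightarrow> B\<close> becomes isomorphic in \<open>B(Q-Dist)\<close> to an
  object of each image.  It is isomorphic to its underlying matrix, because \<open>1\<^sub>A\<close> and \<open>1\<^sub>B\<close> may be
  read as distributors to and from the underlying discrete categories (\<open>iso_underlying_matrix\<close>).
  And it is isomorphic to the identity of its category \<open>K\<close> of concepts, the presheaves \<open>\<mu>\<close> on \<open>A\<close>
  with \<open>\<mu> = (\<phi> \<swarrow> \<mu>) \<searrow> \<phi>\<close>: evaluation gives distributors \<open>a : A \<rightarrow> K\<close> and \<open>b = \<phi> \<swarrow> a : K \<rightarrow> B\<close>, which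
  are representable by the maps sending \<open>x\<close> to the closure of \<open>A(-, x)\<close> and \<open>y\<close> to \<open>\<phi>(-, y)\<close>, and
  the Yoneda lemma evaluates all the residuals that occur (\<open>iso_identity\<close>).  The category \<open>K\<close> is
  skeletal and complete (\<open>complete_K\<close>), and it is small because the universe is closed under power
  sets (\<open>small_presheaves\<close>).
\<close>


section \<open>Quantaloids through universal properties\<close>

lemma hom_lat_simps [simp]:
  "carrier (hom_lat C X Y) = Hom C X Y"
  "gorder.le (hom_lat C X Y) = Leq C X Y"
  "eq (hom_lat C X Y) = (=)"
  by (simp_all add: hom_lat_def)

definition is_supremum :: "('o, 'a) qtld \<Rightarrow> 'o \<Rightarrow> 'o \<Rightarrow> 'a set \<Rightarrow> 'a \<Rightarrow> bool" where
  "is_supremum C X Y S s \<longleftrightarrow> s \<in> Hom C X Y \<and>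
     (\<forall>t\<in>Hom C X Y. Leq C X Y s t \<longleftrightarrow> (\<forall>p\<in>S. Leq C X Y p t))"

locale ordered_homs =
  fixes C :: "('o, 'a) qtld"
  assumes Leq_refl: "\<lbrakk>X \<in> Ob C; Y \<in> Ob C; f \<in> Hom C X Y\<rbrakk> \<Longrightarrow> Leq C X Y f f"
    and Leq_antisym: "\<lbrakk>X \<in> Ob C; Y \<in> Ob C; f \<in> Hom C X Y; g \<in> Hom C X Y;
        Leq C X Y f g; Leq C X Y g f\<rbrakk> \<Longrightarrow> f = g"
    and Leq_trans: "\<lbrakk>X \<in> Ob C; Y \<in> Ob C; f \<in> Hom C X Y; g \<in> Hom C X Y; h \<in> Hom C X Y;
        Leq C X Y f g; Leq C X Y g h\<rbrakk> \<Longrightarrow> Leq C X Y f h"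
begin

lemma partial_order_hom:
  assumes "X \<in> Ob C" "Y \<in> Ob C"
  shows "partial_order (hom_lat C X Y)"
  using assms by unfold_locales (auto intro: Leq_refl Leq_antisym Leq_trans)

lemma is_lub_iff_is_supremum:
  assumes "X \<in> Ob C" "Y \<in> Ob C" "S \<subseteq> Hom C X Y"
  shows "is_lub (hom_lat C X Y) s S \<longleftrightarrow> is_supremum C X Y S s"
proof
  assume "is_lub (hom_lat C X Y) s S"
  then have s: "s \<in> Hom C X Y" "\<And>p. p \<in> S \<Longrightarrow> Leq C X Y p s"
    "\<And>t. t \<in> Hom C X Y \<Longrightarrow> (\<forall>p\<in>S. Leq C X Y p t) \<Longrightarrow> Leq C X Y s t"
    using assms(3) unfolding least_def Upper_def by auto
  have "Leq C X Y p t" if "t \<in> Hom C X Y" "Leq C X Y s t" "p \<in> S" for t p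
    using Leq_trans[OF assms(1,2) _ s(1) that(1) s(2) that(2)] that(3) assms(3) by blast
  then show "is_supremum C X Y S s" using s unfolding is_supremum_def by blast
next
  assume "is_supremum C X Y S s"
  then show "is_lub (hom_lat C X Y) s S"
    using assms(3) Leq_refl[OF assms(1,2)] unfolding is_supremum_def least_def Upper_def
    by (auto simp: subset_iff)
qed

lemma is_supremum_unique:
  assumes "X \<in> Ob C" "Y \<in> Ob C" "is_supremum C X Y S s" "is_supremum C X Y S s'"
  shows "s = s'"
  using assms Leq_refl Leq_antisym unfolding is_supremum_def by metis

lemma sup_eq_if_is_supremum:
  assumes "X \<in> Ob C" "Y \<in> Ob C" "S \<subseteq> Hom C X Y" "is_supremum C X Y S s"
  shows "\<Squnion>\<^bsub>hom_lat C X Y\<^esub> S = s"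
  unfolding sup_def
  using is_lub_iff_is_supremum[OF assms(1-3)] is_supremum_unique[OF assms(1,2)] assms(4)
  by (intro some_equality) simp_all

lemma complete_lattice_hom:
  assumes X: "X \<in> Ob C" and Y: "Y \<in> Ob C"
    and sup: "\<And>S. S \<subseteq> Hom C X Y \<Longrightarrow> \<exists>s. is_supremum C X Y S s"
  shows "complete_lattice (hom_lat C X Y)"
proof -
  interpret partial_order "hom_lat C X Y" by (rule partial_order_hom[OF X Y])
  show ?thesis
  proof (rule complete_latticeI)
    fix A assume "A \<subseteq> carrier (hom_lat C X Y)"
    then show "\<exists>s. is_lub (hom_lat C X Y) s A"
      using sup[of A] is_lub_iff_is_supremum[OF X Y, of A] by auto
  next
    fix A assume A: "A \<subseteq> carrier (hom_lat C X Y)"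
    let ?L = "Lower (hom_lat C X Y) A"
    have L: "?L \<subseteq> Hom C X Y" by (auto simp: Lower_def)
    obtain s where s: "is_supremum C X Y ?L s" using sup[OF L] by blast
    have "greatest (hom_lat C X Y) s ?L"
      using s A L Leq_refl[OF X Y] unfolding is_supremum_def greatest_def Lower_def
      by (auto simp: subset_iff)
    then show "\<exists>i. greatest (hom_lat C X Y) i ?L" ..
  qed
qed

end

text \<open>Suprema are unique, so completeness and preservation of suprema can be checked together on
  one conveniently chosen supremum of each set of parallel arrows.\<close>

lemma quantaloidI:
  assumes "category C" "ordered_homs C"
    and sup: "\<And>X Y S. \<lbrakk>X \<in> Ob C; Y \<in> Ob C; S \<subseteq> Hom C X Y\<rbrakk> \<Longrightarrow>
      \<exists>s. is_supremum C X Y S s \<and>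
        (\<forall>Z\<in>Ob C. \<forall>g\<in>Hom C Y Z. is_supremum C X Z (Cmp C X Y Z g ` S) (Cmp C X Y Z g s)) \<and>
        (\<forall>W\<in>Ob C. \<forall>g\<in>Hom C W X.
           is_supremum C W Y ((\<lambda>f. Cmp C W X Y f g) ` S) (Cmp C W X Y s g))"
  shows "quantaloid C"
proof -
  interpret category C by fact
  interpret ordered_homs C by fact
  have cl: "complete_lattice (hom_lat C X Y)" if "X \<in> Ob C" "Y \<in> Ob C" for X Y
    using complete_lattice_hom[OF that] sup[OF that] by blast
  show ?thesis
  proof (intro quantaloid.intro quantaloid_axioms.intro \<open>category C\<close>)
    fix X Y assume "X \<in> Ob C" "Y \<in> Ob C"
    then show "complete_lattice (hom_lat C X Y)" by (rule cl)
  next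
    fix X Y Z g assume o: "X \<in> Ob C" "Y \<in> Ob C" "Z \<in> Ob C" and g: "g \<in> Hom C Y Z"
    show "sup_pres (hom_lat C X Y) (hom_lat C X Z) (Cmp C X Y Z g)"
      unfolding sup_pres_def
    proof (intro conjI allI impI cl o)
      fix A assume "A \<subseteq> carrier (hom_lat C X Y)"
      then have A: "A \<subseteq> Hom C X Y" by simp
      obtain s where s: "is_supremum C X Y A s"
        "is_supremum C X Z (Cmp C X Y Z g ` A) (Cmp C X Y Z g s)"
        using sup[OF o(1,2) A] o g by blast
      have "Cmp C X Y Z g ` A \<subseteq> Hom C X Z" using A o g Cmp_closed by blast
      then show "Cmp C X Y Z g (\<Squnion>\<^bsub>hom_lat C X Y\<^esub> A) = \<Squnion>\<^bsub>hom_lat C X Z\<^esub> (Cmp C X Y Z g ` A)"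
        using s A o sup_eq_if_is_supremum by metis
    qed
  next
    fix X Y Z f assume o: "X \<in> Ob C" "Y \<in> Ob C" "Z \<in> Ob C" and f: "f \<in> Hom C X Y"
    show "sup_pres (hom_lat C Y Z) (hom_lat C X Z) (\<lambda>g. Cmp C X Y Z g f)"
      unfolding sup_pres_def
    proof (intro conjI allI impI cl o)
      fix A assume "A \<subseteq> carrier (hom_lat C Y Z)"
      then have A: "A \<subseteq> Hom C Y Z" by simp
      obtain s where s: "is_supremum C Y Z A s"
        "is_supremum C X Z ((\<lambda>g. Cmp C X Y Z g f) ` A) (Cmp C X Y Z s f)"
        using sup[OF o(2,3) A] o f by blast
      have "(\<lambda>g. Cmp C X Y Z g f) ` A \<subseteq> Hom C X Z" using A o f Cmp_closed by blast
      then show "Cmp C X Y Z (\<Squnion>\<^bsub>hom_lat C Y Z\<^esub> A) f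
          = \<Squnion>\<^bsub>hom_lat C X Z\<^esub> ((\<lambda>g. Cmp C X Y Z g f) ` A)"
        using s A o sup_eq_if_is_supremum by metis
    qed
  qed
qed

context quantaloid
begin

lemma ordered_homs: "ordered_homs C"
proof
  fix X Y f assume o: "X \<in> Ob C" "Y \<in> Ob C" and f: "f \<in> Hom C X Y"
  interpret complete_lattice "hom_lat C X Y" by (rule hom_complete[OF o])
  show "Leq C X Y f f" using le_refl f by simp
next
  fix X Y f g assume o: "X \<in> Ob C" "Y \<in> Ob C" and f: "f \<in> Hom C X Y" "g \<in> Hom C X Y"
    "Leq C X Y f g" "Leq C X Y g f"
  interpret complete_lattice "hom_lat C X Y" by (rule hom_complete[OF o])
  show "f = g" using le_antisym f by simp
next
  fix X Y f g h assume o: "X \<in> Ob C" "Y \<in> Ob C" and f: "f \<in> Hom C X Y" "g \<in> Hom C X Y"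
    "h \<in> Hom C X Y" "Leq C X Y f g" "Leq C X Y g h"
  interpret complete_lattice "hom_lat C X Y" by (rule hom_complete[OF o])
  show "Leq C X Y f h" using le_trans[of f g h] f by simp
qed

sublocale ordered_homs C by (rule ordered_homs)

lemma is_supremum_sup:
  assumes "X \<in> Ob C" "Y \<in> Ob C" "S \<subseteq> Hom C X Y"
  shows "is_supremum C X Y S (\<Squnion>\<^bsub>hom_lat C X Y\<^esub> S)"
proof -
  interpret complete_lattice "hom_lat C X Y" by (rule hom_complete[OF assms(1,2)])
  show ?thesis using sup_lub[of S] is_lub_iff_is_supremum[OF assms] assms by simp
qed

lemma sup_closed:
  assumes "X \<in> Ob C" "Y \<in> Ob C" "S \<subseteq> Hom C X Y"
  shows "\<Squnion>\<^bsub>hom_lat C X Y\<^esub> S \<in> Hom C X Y"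
  using is_supremum_sup[OF assms] by (simp add: is_supremum_def)

lemma sup_Leq_iff:
  assumes "X \<in> Ob C" "Y \<in> Ob C" "S \<subseteq> Hom C X Y" "t \<in> Hom C X Y"
  shows "Leq C X Y (\<Squnion>\<^bsub>hom_lat C X Y\<^esub> S) t \<longleftrightarrow> (\<forall>p\<in>S. Leq C X Y p t)"
  using is_supremum_sup[OF assms(1-3)] assms(4) by (simp add: is_supremum_def)

lemma Leq_sup:
  assumes "X \<in> Ob C" "Y \<in> Ob C" "S \<subseteq> Hom C X Y" "p \<in> S"
  shows "Leq C X Y p (\<Squnion>\<^bsub>hom_lat C X Y\<^esub> S)"
  using sup_Leq_iff[OF assms(1-3) sup_closed[OF assms(1-3)]] Leq_refl sup_closed assms by metis

lemma Cmp_sup_left_Leq_iff: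
  assumes "X \<in> Ob C" "Y \<in> Ob C" "Z \<in> Ob C" "S \<subseteq> Hom C Y Z" "f \<in> Hom C X Y" "t \<in> Hom C X Z"
  shows "Leq C X Z (Cmp C X Y Z (\<Squnion>\<^bsub>hom_lat C Y Z\<^esub> S) f) t
    \<longleftrightarrow> (\<forall>p\<in>S. Leq C X Z (Cmp C X Y Z p f) t)"
proof -
  have "(\<lambda>g. Cmp C X Y Z g f) ` S \<subseteq> Hom C X Z" using Cmp_closed assms by blast
  then show ?thesis
    using Cmp_sup_left[OF assms(1,2,3,5)] assms by (simp add: sup_pres_def sup_Leq_iff)
qed

lemma Cmp_mono_left:
  assumes o: "X \<in> Ob C" "Y \<in> Ob C" "Z \<in> Ob C" and h: "f \<in> Hom C X Y" "g \<in> Hom C Y Z" "g' \<in> Hom C Y Z"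
    and le: "Leq C Y Z g g'"
  shows "Leq C X Z (Cmp C X Y Z g f) (Cmp C X Y Z g' f)"
proof -
  have "is_supremum C Y Z {g, g'} g'"
    unfolding is_supremum_def using o h le by (auto intro: Leq_trans[of Y Z g g'])
  then have "\<Squnion>\<^bsub>hom_lat C Y Z\<^esub> {g, g'} = g'" using sup_eq_if_is_supremum o h by simp
  then show ?thesis
    using Cmp_sup_left_Leq_iff[OF o, of "{g, g'}" f "Cmp C X Y Z g' f"] o h Cmp_closed Leq_refl
    by simp
qed

lemma Leq_eqI:
  assumes "X \<in> Ob C" "Y \<in> Ob C" "f \<in> Hom C X Y" "g \<in> Hom C X Y"
    and "\<And>h. h \<in> Hom C X Y \<Longrightarrow> Leq C X Y h f \<longleftrightarrow> Leq C X Y h g"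
  shows "f = g"
  using assms Leq_refl Leq_antisym by metis

text \<open>Since composition preserves suprema, the arrows that satisfy a family of residuation
  inequalities are closed under suprema, and their supremum is the residual.  Families are needed
  because an entry of a residual of distributors is a residual of a whole column or row.\<close>

lemma left_residual_exists:
  assumes o: "Y \<in> Ob C" "Z \<in> Ob C" "\<And>i. i \<in> I \<Longrightarrow> X i \<in> Ob C"
    and p: "\<And>i. i \<in> I \<Longrightarrow> p i \<in> Hom C (X i) Y" and h: "\<And>i. i \<in> I \<Longrightarrow> h i \<in> Hom C (X i) Z"
  shows "\<exists>k\<in>Hom C Y Z. \<forall>f\<in>Hom C Y Z.
    Leq C Y Z f k \<longleftrightarrow> (\<forall>i\<in>I. Leq C (X i) Z (Cmp C (X i) Y Z f (p i)) (h i))"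
proof -
  let ?S = "{f \<in> Hom C Y Z. \<forall>i\<in>I. Leq C (X i) Z (Cmp C (X i) Y Z f (p i)) (h i)}"
  let ?k = "\<Squnion>\<^bsub>hom_lat C Y Z\<^esub> ?S"
  have S: "?S \<subseteq> Hom C Y Z" by blast
  have k: "?k \<in> Hom C Y Z" by (rule sup_closed[OF o(1,2) S])
  have kS: "Leq C (X i) Z (Cmp C (X i) Y Z ?k (p i)) (h i)" if "i \<in> I" for i
    using that o p h by (subst Cmp_sup_left_Leq_iff) auto
  have "Leq C Y Z f ?k \<longleftrightarrow> f \<in> ?S" if f: "f \<in> Hom C Y Z" for f
  proof
    assume "Leq C Y Z f ?k"
    then have "Leq C (X i) Z (Cmp C (X i) Y Z f (p i)) (h i)" if "i \<in> I" for i
      using Leq_trans[OF _ _ _ _ _ Cmp_mono_left kS[OF that]] that o p h f k Cmp_closed by blast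
    then show "f \<in> ?S" using f by blast
  qed (rule Leq_sup[OF o(1,2) S])
  then show ?thesis using k by blast
qed

lemma lres_eqI:
  assumes "Y \<in> Ob C" "Z \<in> Ob C" "k \<in> Hom C Y Z"
    and "\<And>g. g \<in> Hom C Y Z \<Longrightarrow> Leq C Y Z g k \<longleftrightarrow> Leq C X Z (Cmp C X Y Z g f) h"
  shows "lres C X Y Z h f = k"
  unfolding lres_def
proof (rule the_equality)
  fix k' assume "k' \<in> Hom C Y Z \<and> (\<forall>f'\<in>Hom C Y Z. Leq C X Z (Cmp C X Y Z f' f) h \<longleftrightarrow> Leq C Y Z f' k')"
  then show "k' = k" using assms by (intro Leq_eqI[of Y Z]) auto
qed (use assms in simp)

lemma lres_closed_and_Leq_iff:
  assumes "X \<in> Ob C" "Y \<in> Ob C" "Z \<in> Ob C" "f \<in> Hom C X Y" "h \<in> Hom C X Z"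
  shows "lres C X Y Z h f \<in> Hom C Y Z \<and> (\<forall>g\<in>Hom C Y Z.
    Leq C Y Z g (lres C X Y Z h f) \<longleftrightarrow> Leq C X Z (Cmp C X Y Z g f) h)"
proof -
  obtain k where k: "k \<in> Hom C Y Z"
    "\<And>g. g \<in> Hom C Y Z \<Longrightarrow> Leq C Y Z g k \<longleftrightarrow> Leq C X Z (Cmp C X Y Z g f) h"
    using left_residual_exists[of Y Z "{()}" "\<lambda>_. X" "\<lambda>_. f" "\<lambda>_. h"] assms by auto
  have "lres C X Y Z h f = k" by (rule lres_eqI) (use assms k in auto)
  then show ?thesis using k by simp
qed

lemmas lres_closed = lres_closed_and_Leq_iff[THEN conjunct1]
lemmas Leq_lres_iff = lres_closed_and_Leq_iff[THEN conjunct2, rule_format]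

lemma lres_Cmp:
  assumes o: "X \<in> Ob C" "Y \<in> Ob C" "Z \<in> Ob C" "W \<in> Ob C"
    and h: "u \<in> Hom C X Y" "u' \<in> Hom C Y Z" "h \<in> Hom C X W"
  shows "lres C X Z W h (Cmp C X Y Z u' u) = lres C Y Z W (lres C X Y W h u) u'"
  by (rule lres_eqI) (use o h in \<open>simp_all add: lres_closed Leq_lres_iff Cmp_closed Cmp_assoc\<close>)

lemma lres_Ide:
  assumes "X \<in> Ob C" "Y \<in> Ob C" "h \<in> Hom C X Y"
  shows "lres C X X Y h (Ide C X) = h"
  by (rule lres_eqI) (use assms in \<open>simp_all add: Cmp_Ide_right\<close>)

end


section \<open>Opposite quantaloids\<close>

lemma opposite_simps [simp]:
  "Ob (opposite C) = Ob C"
  "Hom (opposite C) X Y = Hom C Y X"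
  "Ide (opposite C) = Ide C"
  "Cmp (opposite C) X Y Z g f = Cmp C Z Y X f g"
  "Leq (opposite C) X Y = Leq C Y X"
  by (simp_all add: opposite_def)

lemma hom_lat_opposite: "hom_lat (opposite C) X Y = hom_lat C Y X"
  by (simp add: hom_lat_def)

lemma category_opposite:
  assumes "category C"
  shows "category (opposite C)"
proof -
  interpret category C by fact
  show ?thesis
    by unfold_locales (simp_all add: Ide_closed Cmp_closed Cmp_Ide_left Cmp_Ide_right Cmp_assoc)
qed

lemma quantaloid_opposite:
  assumes "quantaloid C"
  shows "quantaloid (opposite C)"
proof -
  interpret quantaloid C by fact
  show ?thesis
    by (intro quantaloid.intro quantaloid_axioms.intro category_opposite category_axioms)
      (simp_all add: hom_lat_opposite hom_complete Cmp_sup_left Cmp_sup_right)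
qed

text \<open>Everything about composition on the other side follows by duality.\<close>

context quantaloid
begin

interpretation dual: quantaloid "opposite C"
  by (rule quantaloid_opposite) (rule quantaloid_axioms)

lemma Cmp_sup_right_Leq_iff:
  assumes "X \<in> Ob C" "Y \<in> Ob C" "Z \<in> Ob C" "S \<subseteq> Hom C X Y" "g \<in> Hom C Y Z" "t \<in> Hom C X Z"
  shows "Leq C X Z (Cmp C X Y Z g (\<Squnion>\<^bsub>hom_lat C X Y\<^esub> S)) t
    \<longleftrightarrow> (\<forall>p\<in>S. Leq C X Z (Cmp C X Y Z g p) t)"
  using dual.Cmp_sup_left_Leq_iff[of Z Y X S g t] assms by (simp add: hom_lat_opposite)

lemma Cmp_mono_right:
  assumes "X \<in> Ob C" "Y \<in> Ob C" "Z \<in> Ob C" "f \<in> Hom C X Y" "f' \<in> Hom C X Y" "g \<in> Hom C Y Z"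
    and "Leq C X Y f f'"
  shows "Leq C X Z (Cmp C X Y Z g f) (Cmp C X Y Z g f')"
  using dual.Cmp_mono_left[of Z Y X g f f'] assms by simp

lemma right_residual_exists:
  assumes "X \<in> Ob C" "Y \<in> Ob C" "\<And>i. i \<in> I \<Longrightarrow> Z i \<in> Ob C"
    and "\<And>i. i \<in> I \<Longrightarrow> p i \<in> Hom C Y (Z i)" and "\<And>i. i \<in> I \<Longrightarrow> h i \<in> Hom C X (Z i)"
  shows "\<exists>k\<in>Hom C X Y. \<forall>f\<in>Hom C X Y.
    Leq C X Y f k \<longleftrightarrow> (\<forall>i\<in>I. Leq C X (Z i) (Cmp C X Y (Z i) (p i) f) (h i))"
  using dual.left_residual_exists[of Y X I Z p h] assms by simp

lemma rres_eq_lres_opposite: "rres C X Y Z g h = lres (opposite C) Z Y X h g"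
  by (simp add: rres_def lres_def)

lemma rres_eqI:
  assumes "X \<in> Ob C" "Y \<in> Ob C" "k \<in> Hom C X Y"
    and "\<And>f. f \<in> Hom C X Y \<Longrightarrow> Leq C X Y f k \<longleftrightarrow> Leq C X Z (Cmp C X Y Z g f) h"
  shows "rres C X Y Z g h = k"
  unfolding rres_eq_lres_opposite by (rule dual.lres_eqI) (use assms in simp_all)

lemma rres_closed_and_Leq_iff:
  assumes "X \<in> Ob C" "Y \<in> Ob C" "Z \<in> Ob C" "g \<in> Hom C Y Z" "h \<in> Hom C X Z"
  shows "rres C X Y Z g h \<in> Hom C X Y \<and> (\<forall>f\<in>Hom C X Y.
    Leq C X Y f (rres C X Y Z g h) \<longleftrightarrow> Leq C X Z (Cmp C X Y Z g f) h)"
  using dual.lres_closed_and_Leq_iff[of Z Y X g h] assms by (simp add: rres_eq_lres_opposite)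

lemmas rres_closed = rres_closed_and_Leq_iff[THEN conjunct1]
lemmas Leq_rres_iff = rres_closed_and_Leq_iff[THEN conjunct2, rule_format]

lemma rres_Cmp:
  assumes "X \<in> Ob C" "Y \<in> Ob C" "Z \<in> Ob C" "W \<in> Ob C"
    and "v \<in> Hom C Y Z" "v' \<in> Hom C Z W" "h \<in> Hom C X W"
  shows "rres C X Y W (Cmp C Y Z W v' v) h = rres C X Y Z v (rres C X Z W v' h)"
  using dual.lres_Cmp[of W Z Y X v' v h] assms by (simp add: rres_eq_lres_opposite)

lemma rres_Ide:
  assumes "X \<in> Ob C" "Y \<in> Ob C" "h \<in> Hom C X Y"
  shows "rres C X Y Y (Ide C Y) h = h"
  using dual.lres_Ide[of Y X h] assms by (simp add: rres_eq_lres_opposite)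

text \<open>Both sides represent the arrows \<open>k\<close> with \<open>v \<circ> k \<circ> u \<le> h\<close>.  This is what makes the composite of
  two Chu connections a Chu connection.\<close>

lemma lres_rres_commute:
  assumes o: "X \<in> Ob C" "Y \<in> Ob C" "Z \<in> Ob C" "W \<in> Ob C"
    and h: "u \<in> Hom C X Y" "v \<in> Hom C Z W" "h \<in> Hom C X W"
  shows "lres C X Y Z (rres C X Z W v h) u = rres C Y Z W v (lres C X Y W h u)"
  by (rule lres_eqI)
    (use o h in \<open>simp_all add: lres_closed rres_closed Leq_lres_iff Leq_rres_iff Cmp_closed Cmp_assoc\<close>)

end


section \<open>Equivalences from fully faithful functors\<close>

text \<open>Fully faithful functors that are order isomorphisms on homs.  They preserve and reflect suprema
  automatically.\<close>

locale order_embedding = cat_functor C D Fo Fa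
  for C :: "('o, 'a) qtld" and D :: "('p, 'b) qtld"
    and Fo :: "'o \<Rightarrow> 'p" and Fa :: "'o \<Rightarrow> 'o \<Rightarrow> 'a \<Rightarrow> 'b" +
  assumes Fa_bij: "\<lbrakk>X \<in> Ob C; Y \<in> Ob C\<rbrakk> \<Longrightarrow> bij_betw (Fa X Y) (Hom C X Y) (Hom D (Fo X) (Fo Y))"
    and Leq_Fa_iff: "\<lbrakk>X \<in> Ob C; Y \<in> Ob C; f \<in> Hom C X Y; g \<in> Hom C X Y\<rbrakk>
      \<Longrightarrow> Leq D (Fo X) (Fo Y) (Fa X Y f) (Fa X Y g) \<longleftrightarrow> Leq C X Y f g"
begin

lemma Fa_eq_iff:
  assumes "X \<in> Ob C" "Y \<in> Ob C" "f \<in> Hom C X Y" "g \<in> Hom C X Y"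
  shows "Fa X Y f = Fa X Y g \<longleftrightarrow> f = g"
  using inj_on_eq_iff[OF bij_betw_imp_inj_on[OF Fa_bij[OF assms(1,2)]] assms(3,4)] .

lemma Fa_surj:
  assumes "X \<in> Ob C" "Y \<in> Ob C" "h \<in> Hom D (Fo X) (Fo Y)"
  obtains f where "f \<in> Hom C X Y" "Fa X Y f = h"
  using bij_betw_imp_surj_on[OF Fa_bij[OF assms(1,2)]] assms(3) that by (metis imageE)

definition Fa_inv :: "'o \<Rightarrow> 'o \<Rightarrow> 'b \<Rightarrow> 'a" where
  "Fa_inv X Y = inv_into (Hom C X Y) (Fa X Y)"

lemma Fa_inv:
  assumes "X \<in> Ob C" "Y \<in> Ob C" "h \<in> Hom D (Fo X) (Fo Y)"
  shows "Fa_inv X Y h \<in> Hom C X Y" "Fa X Y (Fa_inv X Y h) = h"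
  using assms bij_betw_imp_surj_on[OF Fa_bij[OF assms(1,2)]]
  by (simp_all add: Fa_inv_def inv_into_into f_inv_into_f)

lemma is_supremum_Fa_iff:
  assumes X: "X \<in> Ob C" "Y \<in> Ob C" and S: "S \<subseteq> Hom C X Y" and s: "s \<in> Hom C X Y"
  shows "is_supremum D (Fo X) (Fo Y) (Fa X Y ` S) (Fa X Y s) \<longleftrightarrow> is_supremum C X Y S s"
proof -
  have "Hom D (Fo X) (Fo Y) = Fa X Y ` Hom C X Y"
    using bij_betw_imp_surj_on[OF Fa_bij[OF X]] by simp
  then show ?thesis
    using S s by (auto simp: is_supremum_def Leq_Fa_iff[OF X] subset_iff)
qed

text \<open>Every hom of \<open>C\<close> is isomorphic as an ordered set to a hom of \<open>D\<close>, compatibly with composition,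
  so that suprema and their preservation are inherited from \<open>D\<close>.\<close>

lemma quantaloid_domain:
  assumes "quantaloid D"
  shows "quantaloid C"
proof -
  interpret D: quantaloid D by fact
  show ?thesis
  proof (rule quantaloidI)
    show "category C" by (rule C.category_axioms)
    show "ordered_homs C"
    proof
      fix X Y f assume "X \<in> Ob C" "Y \<in> Ob C" "f \<in> Hom C X Y"
      then show "Leq C X Y f f"
        using D.Leq_refl[of "Fo X" "Fo Y" "Fa X Y f"]
        by (simp add: Leq_Fa_iff Fo_closed Fa_closed)
    next
      fix X Y f g assume "X \<in> Ob C" "Y \<in> Ob C" "f \<in> Hom C X Y" "g \<in> Hom C X Y"
        "Leq C X Y f g" "Leq C X Y g f"
      then show "f = g"
        using D.Leq_antisym[of "Fo X" "Fo Y" "Fa X Y f" "Fa X Y g"]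
        by (simp add: Leq_Fa_iff Fo_closed Fa_closed Fa_eq_iff)
    next
      fix X Y f g h assume "X \<in> Ob C" "Y \<in> Ob C" "f \<in> Hom C X Y" "g \<in> Hom C X Y" "h \<in> Hom C X Y"
        "Leq C X Y f g" "Leq C X Y g h"
      then show "Leq C X Y f h"
        using D.Leq_trans[of "Fo X" "Fo Y" "Fa X Y f" "Fa X Y g" "Fa X Y h"]
        by (simp add: Leq_Fa_iff Fo_closed Fa_closed)
    qed
  next
    fix X Y S assume X: "X \<in> Ob C" "Y \<in> Ob C" and S: "S \<subseteq> Hom C X Y"
    let ?S = "Fa X Y ` S"
    note FX = X[THEN Fo_closed]
    have FS: "?S \<subseteq> Hom D (Fo X) (Fo Y)" using S X Fa_closed by blast
    define t where "t = \<Squnion>\<^bsub>hom_lat D (Fo X) (Fo Y)\<^esub> ?S"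
    obtain s where s: "s \<in> Hom C X Y" "Fa X Y s = t"
      by (rule Fa_surj[OF X D.sup_closed[OF FX FS, folded t_def]])
    show "\<exists>s. is_supremum C X Y S s \<and>
        (\<forall>Z\<in>Ob C. \<forall>g\<in>Hom C Y Z. is_supremum C X Z (Cmp C X Y Z g ` S) (Cmp C X Y Z g s)) \<and>
        (\<forall>W\<in>Ob C. \<forall>g\<in>Hom C W X.
           is_supremum C W Y ((\<lambda>f. Cmp C W X Y f g) ` S) (Cmp C W X Y s g))"
    proof (intro exI conjI ballI)
      show "is_supremum C X Y S s"
        using D.is_supremum_sup[OF FX FS] s
        by (simp flip: is_supremum_Fa_iff[OF X S s(1)] add: t_def)
    next
      fix Z g assume Z: "Z \<in> Ob C" and g: "g \<in> Hom C Y Z"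
      note FZ = Fo_closed[OF Z] and Fg = Fa_closed[OF X(2) Z g]
      have "Cmp C X Y Z g ` S \<subseteq> Hom C X Z" using C.Cmp_closed X Z g S by blast
      moreover have "Fa X Z ` Cmp C X Y Z g ` S = Cmp D (Fo X) (Fo Y) (Fo Z) (Fa Y Z g) ` ?S"
        using X Z g subsetD[OF S] by (simp add: image_image Fa_Cmp cong: image_cong_simp)
      moreover have "is_supremum D (Fo X) (Fo Z) (Cmp D (Fo X) (Fo Y) (Fo Z) (Fa Y Z g) ` ?S)
          (Cmp D (Fo X) (Fo Y) (Fo Z) (Fa Y Z g) t)"
        using D.Cmp_sup_right_Leq_iff[OF FX FZ FS Fg] D.Cmp_closed FX FZ Fg D.sup_closed[OF FX FS]
        by (simp add: is_supremum_def t_def)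
      ultimately show "is_supremum C X Z (Cmp C X Y Z g ` S) (Cmp C X Y Z g s)"
        using X Z g s C.Cmp_closed by (simp flip: is_supremum_Fa_iff add: Fa_Cmp)
    next
      fix W g assume W: "W \<in> Ob C" and g: "g \<in> Hom C W X"
      note FW = Fo_closed[OF W] and Fg = Fa_closed[OF W X(1) g]
      have "(\<lambda>f. Cmp C W X Y f g) ` S \<subseteq> Hom C W Y" using C.Cmp_closed X W g S by blast
      moreover have "Fa W Y ` (\<lambda>f. Cmp C W X Y f g) ` S
          = (\<lambda>f. Cmp D (Fo W) (Fo X) (Fo Y) f (Fa W X g)) ` ?S"
        using X W g subsetD[OF S] by (simp add: image_image Fa_Cmp cong: image_cong_simp)
      moreover have "is_supremum D (Fo W) (Fo Y) ((\<lambda>f. Cmp D (Fo W) (Fo X) (Fo Y) f (Fa W X g)) ` ?S)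
          (Cmp D (Fo W) (Fo X) (Fo Y) t (Fa W X g))"
        using D.Cmp_sup_left_Leq_iff[OF FW FX FS Fg] D.Cmp_closed FX FW Fg D.sup_closed[OF FX FS]
        by (simp add: is_supremum_def t_def)
      ultimately show "is_supremum C W Y ((\<lambda>f. Cmp C W X Y f g) ` S) (Cmp C W X Y s g)"
        using X W g s C.Cmp_closed by (simp flip: is_supremum_Fa_iff add: Fa_Cmp)
    qed
  qed
qed

lemma quantaloid_hom:
  assumes "quantaloid D"
  shows "quantaloid_hom C D Fo Fa"
proof -
  interpret D: quantaloid D by fact
  interpret C: quantaloid C by (rule quantaloid_domain) fact
  show ?thesis
  proof (intro quantaloid_hom.intro quantaloid_hom_axioms.intro)
    fix X Y assume X: "X \<in> Ob C" "Y \<in> Ob C"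
    note FX = X[THEN Fo_closed]
    show "sup_pres (hom_lat C X Y) (hom_lat D (Fo X) (Fo Y)) (Fa X Y)"
      unfolding sup_pres_def
    proof (intro conjI allI impI C.hom_complete D.hom_complete X FX)
      fix S assume "S \<subseteq> carrier (hom_lat C X Y)"
      then have S: "S \<subseteq> Hom C X Y" by simp
      have "Fa X Y ` S \<subseteq> Hom D (Fo X) (Fo Y)" using S X Fa_closed by blast
      then show "Fa X Y (\<Squnion>\<^bsub>hom_lat C X Y\<^esub> S) = \<Squnion>\<^bsub>hom_lat D (Fo X) (Fo Y)\<^esub> (Fa X Y ` S)"
        using D.sup_eq_if_is_supremum[OF FX] C.is_supremum_sup[OF X S]
          is_supremum_Fa_iff[OF X S C.sup_closed[OF X S]] by simp
    qed
  qed (rule cat_functor_axioms C.quantaloid_axioms D.quantaloid_axioms)+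
qed

lemma iso_arrow_Fa_inv:
  assumes X: "X \<in> Ob C" "Y \<in> Ob C" and a: "iso_arrow D (Fo X) (Fo Y) a"
  shows "iso_arrow C X Y (Fa_inv X Y a)"
proof -
  note FX = X[THEN Fo_closed]
  obtain b where a: "a \<in> Hom D (Fo X) (Fo Y)" and b: "b \<in> Hom D (Fo Y) (Fo X)"
    and ba: "Cmp D (Fo X) (Fo Y) (Fo X) b a = Ide D (Fo X)"
    and ab: "Cmp D (Fo Y) (Fo X) (Fo Y) a b = Ide D (Fo Y)"
    using a unfolding iso_arrow_def by blast
  note f = Fa_inv[OF X a] and g = Fa_inv[OF X(2,1) b]
  let ?f = "Fa_inv X Y a" and ?g = "Fa_inv Y X b"
  have "Fa X X (Cmp C X Y X ?g ?f) = Fa X X (Ide C X)"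
    using X f g ba by (simp add: Fa_Cmp Fa_Ide)
  moreover have "Fa Y Y (Cmp C Y X Y ?f ?g) = Fa Y Y (Ide C Y)"
    using X f g ab by (simp add: Fa_Cmp Fa_Ide)
  ultimately show ?thesis
    unfolding iso_arrow_def using X f g by (auto simp: Fa_eq_iff C.Cmp_closed C.Ide_closed)
qed

end


lemma (in category) Cmp_cancel_left:
  assumes "W \<in> Ob C" "X \<in> Ob C" "Y \<in> Ob C" "x \<in> Hom C W X" "f \<in> Hom C X Y" "g \<in> Hom C Y X"
    and "Cmp C X Y X g f = Ide C X"
  shows "Cmp C W Y X g (Cmp C W X Y f x) = x"
  using Cmp_assoc[of W X Y X x f g] assms by (simp add: Cmp_Ide_left)

text \<open>Conjugation with the isomorphisms \<open>\<alpha> X : Fo X \<rightarrow> Go (Ho X)\<close> turns an arrow between objects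
  \<open>Fo X\<close> into one between objects \<open>Go (Ho X)\<close>; as both functors are fully faithful, this makes the
  object map \<open>Ho\<close> a functor.\<close>

locale comparison =
  F: order_embedding C E Fo Fa + G: order_embedding D E Go Ga
  for C :: "('o, 'a) qtld" and D :: "('p, 'b) qtld" and E :: "('q, 'c) qtld"
    and Fo Fa Go Ga +
  fixes Ho :: "'o \<Rightarrow> 'p" and \<alpha> \<alpha>' :: "'o \<Rightarrow> 'c"
  assumes E: "quantaloid E"
    and Ho_closed: "X \<in> Ob C \<Longrightarrow> Ho X \<in> Ob D"
    and \<alpha>_closed: "X \<in> Ob C \<Longrightarrow> \<alpha> X \<in> Hom E (Fo X) (Go (Ho X))"
    and \<alpha>'_closed: "X \<in> Ob C \<Longrightarrow> \<alpha>' X \<in> Hom E (Go (Ho X)) (Fo X)"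
    and \<alpha>'_\<alpha>: "X \<in> Ob C \<Longrightarrow> Cmp E (Fo X) (Go (Ho X)) (Fo X) (\<alpha>' X) (\<alpha> X) = Ide E (Fo X)"
    and \<alpha>_\<alpha>': "X \<in> Ob C \<Longrightarrow> Cmp E (Go (Ho X)) (Fo X) (Go (Ho X)) (\<alpha> X) (\<alpha>' X) = Ide E (Go (Ho X))"
begin

sublocale E: quantaloid E by (rule E)

definition conjugate :: "'o \<Rightarrow> 'o \<Rightarrow> 'c \<Rightarrow> 'c" where
  "conjugate X Y h = Cmp E (Go (Ho X)) (Fo X) (Go (Ho Y))
     (Cmp E (Fo X) (Fo Y) (Go (Ho Y)) (\<alpha> Y) h) (\<alpha>' X)"

definition unconjugate :: "'o \<Rightarrow> 'o \<Rightarrow> 'c \<Rightarrow> 'c" where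
  "unconjugate X Y k = Cmp E (Fo X) (Go (Ho X)) (Fo Y)
     (Cmp E (Go (Ho X)) (Go (Ho Y)) (Fo Y) (\<alpha>' Y) k) (\<alpha> X)"

lemmas typing = F.Fo_closed G.Fo_closed Ho_closed \<alpha>_closed \<alpha>'_closed F.Fa_closed G.Fa_closed
  F.D.Cmp_closed F.D.Ide_closed

lemma conjugate_closed:
  "\<lbrakk>X \<in> Ob C; Y \<in> Ob C; h \<in> Hom E (Fo X) (Fo Y)\<rbrakk> \<Longrightarrow> conjugate X Y h \<in> Hom E (Go (Ho X)) (Go (Ho Y))"
  by (simp add: conjugate_def typing)

lemma unconjugate_closed:
  "\<lbrakk>X \<in> Ob C; Y \<in> Ob C; k \<in> Hom E (Go (Ho X)) (Go (Ho Y))\<rbrakk> \<Longrightarrow> unconjugate X Y k \<in> Hom E (Fo X) (Fo Y)"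
  by (simp add: unconjugate_def typing)

lemmas cancel = \<alpha>'_\<alpha> \<alpha>_\<alpha>' F.D.Cmp_cancel_left[OF _ _ _ _ _ _ \<alpha>'_\<alpha>] F.D.Cmp_cancel_left[OF _ _ _ _ _ _ \<alpha>_\<alpha>']
  F.D.Cmp_assoc F.D.Cmp_Ide_right F.D.Cmp_Ide_left

lemma unconjugate_conjugate:
  "\<lbrakk>X \<in> Ob C; Y \<in> Ob C; h \<in> Hom E (Fo X) (Fo Y)\<rbrakk> \<Longrightarrow> unconjugate X Y (conjugate X Y h) = h"
  by (simp add: conjugate_def unconjugate_def typing cancel)

lemma conjugate_unconjugate:
  "\<lbrakk>X \<in> Ob C; Y \<in> Ob C; k \<in> Hom E (Go (Ho X)) (Go (Ho Y))\<rbrakk> \<Longrightarrow> conjugate X Y (unconjugate X Y k) = k"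
  by (simp add: conjugate_def unconjugate_def typing cancel)

lemma conjugate_mono:
  "\<lbrakk>X \<in> Ob C; Y \<in> Ob C; h \<in> Hom E (Fo X) (Fo Y); h' \<in> Hom E (Fo X) (Fo Y);
    Leq E (Fo X) (Fo Y) h h'\<rbrakk> \<Longrightarrow> Leq E (Go (Ho X)) (Go (Ho Y)) (conjugate X Y h) (conjugate X Y h')"
  by (simp add: conjugate_def typing E.Cmp_mono_left E.Cmp_mono_right)

lemma unconjugate_mono:
  "\<lbrakk>X \<in> Ob C; Y \<in> Ob C; h \<in> Hom E (Go (Ho X)) (Go (Ho Y)); h' \<in> Hom E (Go (Ho X)) (Go (Ho Y));
    Leq E (Go (Ho X)) (Go (Ho Y)) h h'\<rbrakk> \<Longrightarrow> Leq E (Fo X) (Fo Y) (unconjugate X Y h) (unconjugate X Y h')"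
  by (simp add: unconjugate_def typing E.Cmp_mono_left E.Cmp_mono_right)

lemma Leq_conjugate_iff:
  assumes "X \<in> Ob C" "Y \<in> Ob C" "h \<in> Hom E (Fo X) (Fo Y)" "h' \<in> Hom E (Fo X) (Fo Y)"
  shows "Leq E (Go (Ho X)) (Go (Ho Y)) (conjugate X Y h) (conjugate X Y h') \<longleftrightarrow> Leq E (Fo X) (Fo Y) h h'"
  using conjugate_mono[OF assms] unconjugate_mono[of X Y "conjugate X Y h" "conjugate X Y h'"] assms
  by (auto simp: unconjugate_conjugate conjugate_closed)

definition Ha :: "'o \<Rightarrow> 'o \<Rightarrow> 'a \<Rightarrow> 'b" where
  "Ha X Y f = G.Fa_inv (Ho X) (Ho Y) (conjugate X Y (Fa X Y f))"

lemma Ha_closed: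
  "\<lbrakk>X \<in> Ob C; Y \<in> Ob C; f \<in> Hom C X Y\<rbrakk> \<Longrightarrow> Ha X Y f \<in> Hom D (Ho X) (Ho Y)"
  by (simp add: Ha_def G.Fa_inv conjugate_closed typing)

lemma Ga_Ha:
  "\<lbrakk>X \<in> Ob C; Y \<in> Ob C; f \<in> Hom C X Y\<rbrakk> \<Longrightarrow> Ga (Ho X) (Ho Y) (Ha X Y f) = conjugate X Y (Fa X Y f)"
  by (simp add: Ha_def G.Fa_inv conjugate_closed typing)

lemma order_embedding_Ha: "order_embedding C D Ho Ha"
proof
  fix X assume X: "X \<in> Ob C"
  then show "Ho X \<in> Ob D" by (rule Ho_closed)
  have "Ga (Ho X) (Ho X) (Ha X X (Ide C X)) = Ga (Ho X) (Ho X) (Ide D (Ho X))"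
    using X by (simp add: Ga_Ha F.C.Ide_closed F.Fa_Ide G.Fa_Ide conjugate_def typing cancel)
  then show "Ha X X (Ide C X) = Ide D (Ho X)"
    using X by (simp add: G.Fa_eq_iff typing Ha_closed F.C.Ide_closed G.C.Ide_closed)
next
  fix X Y f assume "X \<in> Ob C" "Y \<in> Ob C" "f \<in> Hom C X Y"
  then show "Ha X Y f \<in> Hom D (Ho X) (Ho Y)" by (rule Ha_closed)
next
  fix X Y Z f g assume X: "X \<in> Ob C" "Y \<in> Ob C" "Z \<in> Ob C" and f: "f \<in> Hom C X Y" "g \<in> Hom C Y Z"
  let ?gf = "Cmp D (Ho X) (Ho Y) (Ho Z) (Ha Y Z g) (Ha X Y f)"
  have "Ga (Ho X) (Ho Z) (Ha X Z (Cmp C X Y Z g f)) = Ga (Ho X) (Ho Z) ?gf"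
    using X f
    by (simp add: Ga_Ha F.C.Cmp_closed F.Fa_Cmp G.Fa_Cmp Ha_closed conjugate_def typing cancel)
  then show "Ha X Z (Cmp C X Y Z g f) = ?gf"
    using X f by (simp add: G.Fa_eq_iff typing Ha_closed F.C.Cmp_closed G.C.Cmp_closed)
next
  fix X Y assume X: "X \<in> Ob C" "Y \<in> Ob C"
  show "bij_betw (Ha X Y) (Hom C X Y) (Hom D (Ho X) (Ho Y))"
  proof (intro bij_betw_imageI inj_onI)
    fix f g assume f: "f \<in> Hom C X Y" "g \<in> Hom C X Y" and "Ha X Y f = Ha X Y g"
    then have "unconjugate X Y (conjugate X Y (Fa X Y f)) = unconjugate X Y (conjugate X Y (Fa X Y g))"
      using X by (simp flip: Ga_Ha)
    then show "f = g" using X f by (simp add: unconjugate_conjugate typing F.Fa_eq_iff)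
  next
    show "Ha X Y ` Hom C X Y = Hom D (Ho X) (Ho Y)"
    proof (intro equalityI subsetI)
      fix k assume k: "k \<in> Hom D (Ho X) (Ho Y)"
      have "unconjugate X Y (Ga (Ho X) (Ho Y) k) \<in> Hom E (Fo X) (Fo Y)"
        using X k by (simp add: unconjugate_closed typing)
      then obtain f where f: "f \<in> Hom C X Y" "Fa X Y f = unconjugate X Y (Ga (Ho X) (Ho Y) k)"
        by (rule F.Fa_surj[OF X])
      then have "Ga (Ho X) (Ho Y) (Ha X Y f) = Ga (Ho X) (Ho Y) k"
        using X k by (simp add: Ga_Ha conjugate_unconjugate typing)
      then have "Ha X Y f = k" using X k f by (simp add: G.Fa_eq_iff typing Ha_closed)
      then show "k \<in> Ha X Y ` Hom C X Y" using f by blast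
    qed (use X Ha_closed in blast)
  qed
next
  fix X Y f g assume X: "X \<in> Ob C" "Y \<in> Ob C" and f: "f \<in> Hom C X Y" "g \<in> Hom C X Y"
  then show "Leq D (Ho X) (Ho Y) (Ha X Y f) (Ha X Y g) \<longleftrightarrow> Leq C X Y f g"
    by (simp flip: G.Leq_Fa_iff F.Leq_Fa_iff add: Ga_Ha Ha_closed typing Leq_conjugate_iff)
qed

lemma \<alpha>_natural:
  "\<lbrakk>X \<in> Ob C; Y \<in> Ob C; f \<in> Hom C X Y\<rbrakk> \<Longrightarrow>
    Cmp E (Fo X) (Go (Ho X)) (Go (Ho Y)) (Ga (Ho X) (Ho Y) (Ha X Y f)) (\<alpha> X)
    = Cmp E (Fo X) (Fo Y) (Go (Ho Y)) (\<alpha> Y) (Fa X Y f)"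
  by (simp add: Ga_Ha conjugate_def typing cancel)

lemma \<alpha>'_natural:
  "\<lbrakk>X \<in> Ob C; Y \<in> Ob C; f \<in> Hom C X Y\<rbrakk> \<Longrightarrow>
    Cmp E (Go (Ho X)) (Go (Ho Y)) (Fo Y) (\<alpha>' Y) (Ga (Ho X) (Ho Y) (Ha X Y f))
    = Cmp E (Go (Ho X)) (Fo X) (Fo Y) (Fa X Y f) (\<alpha>' X)"
  by (simp add: Ga_Ha conjugate_def typing cancel)

end


lemma comparison_exists:
  assumes "quantaloid E" "order_embedding C E Fo Fa" "order_embedding D E Go Ga"
    and iso: "\<And>X. X \<in> Ob C \<Longrightarrow> \<exists>Y\<in>Ob D. \<exists>a. iso_arrow E (Fo X) (Go Y) a"
  shows "\<exists>Ho \<alpha> \<alpha>'. comparison C D E Fo Fa Go Ga Ho \<alpha> \<alpha>'"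
proof -
  have "\<exists>Y a b. Y \<in> Ob D \<and> a \<in> Hom E (Fo X) (Go Y) \<and> b \<in> Hom E (Go Y) (Fo X) \<and>
      Cmp E (Fo X) (Go Y) (Fo X) b a = Ide E (Fo X) \<and>
      Cmp E (Go Y) (Fo X) (Go Y) a b = Ide E (Go Y)" if "X \<in> Ob C" for X
    using iso[OF that] unfolding iso_arrow_def by blast
  then obtain Ho \<alpha> \<alpha>' where "\<forall>X\<in>Ob C. Ho X \<in> Ob D \<and> \<alpha> X \<in> Hom E (Fo X) (Go (Ho X)) \<and>
      \<alpha>' X \<in> Hom E (Go (Ho X)) (Fo X) \<and>
      Cmp E (Fo X) (Go (Ho X)) (Fo X) (\<alpha>' X) (\<alpha> X) = Ide E (Fo X) \<and>
      Cmp E (Go (Ho X)) (Fo X) (Go (Ho X)) (\<alpha> X) (\<alpha>' X) = Ide E (Go (Ho X))"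
    by metis
  then have "comparison C D E Fo Fa Go Ga Ho \<alpha> \<alpha>'"
    by (intro comparison.intro comparison_axioms.intro assms(1-3)) auto
  then show ?thesis by blast
qed

text \<open>Choosing isomorphisms in both directions gives functors \<open>Ho : C \<rightarrow> D\<close> and \<open>Ko : D \<rightarrow> C\<close>.  The
  component of the unit at \<open>X\<close> is the preimage under the first functor of the composite
  \<open>Fo X \<rightarrow> Go (Ho X) \<rightarrow> Fo (Ko (Ho X))\<close>, and dually for the counit; naturality holds in \<open>E\<close> and is
  reflected by faithfulness.\<close>

theorem equivalent_quantaloidsI:
  assumes E: "quantaloid E" and F: "order_embedding C E Fo Fa" and G: "order_embedding D E Go Ga"
    and FG: "\<And>X. X \<in> Ob C \<Longrightarrow> \<exists>Y\<in>Ob D. \<exists>a. iso_arrow E (Fo X) (Go Y) a"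
    and GF: "\<And>Y. Y \<in> Ob D \<Longrightarrow> \<exists>X\<in>Ob C. \<exists>a. iso_arrow E (Go Y) (Fo X) a"
  shows "equivalent_quantaloids C D"
proof -
  obtain Ho \<alpha> \<alpha>' where "comparison C D E Fo Fa Go Ga Ho \<alpha> \<alpha>'"
    using comparison_exists[OF E F G FG] by blast
  then interpret H: comparison C D E Fo Fa Go Ga Ho \<alpha> \<alpha>' .
  obtain Ko \<beta> \<beta>' where "comparison D C E Go Ga Fo Fa Ko \<beta> \<beta>'"
    using comparison_exists[OF E G F GF] by blast
  then interpret K: comparison D C E Go Ga Fo Fa Ko \<beta> \<beta>' .
  interpret HH: order_embedding C D Ho H.Ha by (rule H.order_embedding_Ha)
  interpret KK: order_embedding D C Ko K.Ha by (rule K.order_embedding_Ha)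
  have D: "quantaloid D" by (rule H.G.quantaloid_domain[OF E])
  have C: "quantaloid C" by (rule H.F.quantaloid_domain[OF E])
  define a where "a X = Cmp E (Fo X) (Go (Ho X)) (Fo (Ko (Ho X))) (\<beta> (Ho X)) (\<alpha> X)" for X
  define b where "b Y = Cmp E (Go (Ho (Ko Y))) (Fo (Ko Y)) (Go Y) (\<beta>' Y) (\<alpha>' (Ko Y))" for Y
  let ?\<eta> = "\<lambda>X. H.F.Fa_inv X (Ko (Ho X)) (a X)"
  let ?\<epsilon> = "\<lambda>Y. H.G.Fa_inv (Ho (Ko Y)) Y (b Y)"
  have a: "a X \<in> Hom E (Fo X) (Fo (Ko (Ho X)))" if "X \<in> Ob C" for X
    using that by (simp add: a_def H.typing K.typing)
  have b: "b Y \<in> Hom E (Go (Ho (Ko Y))) (Go Y)" if "Y \<in> Ob D" for Y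
    using that by (simp add: b_def H.typing K.typing)
  have a_iso: "iso_arrow E (Fo X) (Fo (Ko (Ho X))) (a X)" if "X \<in> Ob C" for X
    unfolding iso_arrow_def
    by (intro conjI bexI[of _ "Cmp E (Fo (Ko (Ho X))) (Go (Ho X)) (Fo X) (\<alpha>' X) (\<beta>' (Ho X))"])
      (use that in \<open>simp_all add: a_def H.typing K.typing H.cancel K.cancel\<close>)
  have b_iso: "iso_arrow E (Go (Ho (Ko Y))) (Go Y) (b Y)" if "Y \<in> Ob D" for Y
    unfolding iso_arrow_def
    by (intro conjI bexI[of _ "Cmp E (Go Y) (Fo (Ko Y)) (Go (Ho (Ko Y))) (\<alpha> (Ko Y)) (\<beta> Y)"])
      (use that in \<open>simp_all add: b_def H.typing K.typing H.cancel K.cancel\<close>)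
  have \<eta>: "natural_iso C C (\<lambda>X. X) (\<lambda>X Y f. f)
      (\<lambda>X. Ko (Ho X)) (\<lambda>X Y f. K.Ha (Ho X) (Ho Y) (H.Ha X Y f)) ?\<eta>"
    unfolding natural_iso_def
  proof (intro conjI ballI)
    fix X assume X: "X \<in> Ob C"
    show "iso_arrow C X (Ko (Ho X)) (?\<eta> X)"
      using X by (simp add: H.F.iso_arrow_Fa_inv a_iso H.typing K.typing)
  next
    fix X Y f assume X: "X \<in> Ob C" "Y \<in> Ob C" and f: "f \<in> Hom C X Y"
    let ?l = "Cmp C X Y (Ko (Ho Y)) (?\<eta> Y) f"
    let ?kh = "K.Ha (Ho X) (Ho Y) (H.Ha X Y f)"
    let ?r = "Cmp C X (Ko (Ho X)) (Ko (Ho Y)) ?kh (?\<eta> X)"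
    note cl = H.F.Fa_inv(1)[OF _ _ a] X f H.typing K.typing H.Ha_closed K.Ha_closed
      H.F.C.Cmp_closed
    have "Fa X (Ko (Ho Y)) ?l = Fa X (Ko (Ho Y)) ?r"
    proof -
      have "Fa X (Ko (Ho Y)) ?r = Cmp E (Fo X) (Fo (Ko (Ho X))) (Fo (Ko (Ho Y)))
          (Fa (Ko (Ho X)) (Ko (Ho Y)) ?kh) (a X)"
        using cl by (simp add: H.F.Fa_Cmp H.F.Fa_inv a)
      also have "\<dots> = Cmp E (Fo X) (Go (Ho X)) (Fo (Ko (Ho Y)))
          (Cmp E (Go (Ho X)) (Go (Ho Y)) (Fo (Ko (Ho Y))) (\<beta> (Ho Y)) (Ga (Ho X) (Ho Y) (H.Ha X Y f))) (\<alpha> X)"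
        using cl by (simp add: a_def H.F.D.Cmp_assoc[symmetric] K.\<alpha>_natural)
      also have "\<dots> = Cmp E (Fo X) (Fo Y) (Fo (Ko (Ho Y))) (a Y) (Fa X Y f)"
        using cl by (simp add: a_def H.F.D.Cmp_assoc H.\<alpha>_natural)
      also have "\<dots> = Fa X (Ko (Ho Y)) ?l"
        using cl by (simp add: H.F.Fa_Cmp H.F.Fa_inv a)
      finally show ?thesis by simp
    qed
    then show "?l = ?r" using cl by (simp add: H.F.Fa_eq_iff)
  qed
  have \<epsilon>: "natural_iso D D (\<lambda>Y. Ho (Ko Y)) (\<lambda>X Y g. H.Ha (Ko X) (Ko Y) (K.Ha X Y g))
      (\<lambda>Y. Y) (\<lambda>X Y g. g) ?\<epsilon>"
    unfolding natural_iso_def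
  proof (intro conjI ballI)
    fix X assume X: "X \<in> Ob D"
    show "iso_arrow D (Ho (Ko X)) X (?\<epsilon> X)"
      using X by (simp add: H.G.iso_arrow_Fa_inv b_iso H.typing K.typing)
  next
    fix X Y g assume X: "X \<in> Ob D" "Y \<in> Ob D" and g: "g \<in> Hom D X Y"
    let ?hk = "H.Ha (Ko X) (Ko Y) (K.Ha X Y g)"
    let ?l = "Cmp D (Ho (Ko X)) (Ho (Ko Y)) Y (?\<epsilon> Y) ?hk"
    let ?r = "Cmp D (Ho (Ko X)) X Y g (?\<epsilon> X)"
    note cl = H.G.Fa_inv(1)[OF _ _ b] X g H.typing K.typing H.Ha_closed K.Ha_closed
      H.G.C.Cmp_closed
    have "Ga (Ho (Ko X)) Y ?l = Ga (Ho (Ko X)) Y ?r"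
    proof -
      have "Ga (Ho (Ko X)) Y ?l = Cmp E (Go (Ho (Ko X))) (Go (Ho (Ko Y))) (Go Y)
          (b Y) (Ga (Ho (Ko X)) (Ho (Ko Y)) ?hk)"
        using cl by (simp add: H.G.Fa_Cmp H.G.Fa_inv b)
      also have "\<dots> = Cmp E (Go (Ho (Ko X))) (Fo (Ko X)) (Go Y)
          (Cmp E (Fo (Ko X)) (Fo (Ko Y)) (Go Y) (\<beta>' Y) (Fa (Ko X) (Ko Y) (K.Ha X Y g))) (\<alpha>' (Ko X))"
        using cl by (simp add: b_def H.F.D.Cmp_assoc H.\<alpha>'_natural)
      also have "\<dots> = Cmp E (Go (Ho (Ko X))) (Go X) (Go Y) (Ga X Y g) (b X)"
        using cl by (simp add: b_def H.F.D.Cmp_assoc[symmetric] K.\<alpha>'_natural)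
      also have "\<dots> = Ga (Ho (Ko X)) Y ?r"
        using cl by (simp add: H.G.Fa_Cmp H.G.Fa_inv b)
      finally show ?thesis .
    qed
    then show "?l = ?r" using cl by (simp add: H.G.Fa_eq_iff)
  qed
  have "category_equivalence C D Ho H.Ha"
    unfolding category_equivalence_def
    by (intro conjI exI[of _ Ko] exI[of _ K.Ha] exI[of _ ?\<eta>] exI[of _ ?\<epsilon>] \<eta> \<epsilon>
        HH.cat_functor_axioms KK.cat_functor_axioms)
  then show ?thesis
    unfolding equivalent_quantaloids_def using C D HH.quantaloid_hom[OF D] by blast
qed


section \<open>The quantaloid of distributors\<close>

context quantaloid
begin

lemma Leq_eqI_upper:
  assumes "X \<in> Ob C" "Y \<in> Ob C" "f \<in> Hom C X Y" "g \<in> Hom C X Y"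
    and "\<And>h. h \<in> Hom C X Y \<Longrightarrow> Leq C X Y f h \<longleftrightarrow> Leq C X Y g h"
  shows "f = g"
  using assms Leq_refl Leq_antisym by metis

lemma Cmp_Leq_if_right_Leq:
  assumes "X \<in> Ob C" "Y \<in> Ob C" "Z \<in> Ob C" "f \<in> Hom C X Y" "f' \<in> Hom C X Y" "g \<in> Hom C Y Z"
    "h \<in> Hom C X Z" "Leq C X Y f f'" "Leq C X Z (Cmp C X Y Z g f') h"
  shows "Leq C X Z (Cmp C X Y Z g f) h"
  using Leq_trans[OF assms(1,3) _ _ assms(7) Cmp_mono_right[OF assms(1-6,8)] assms(9)]
    Cmp_closed assms by blast

lemma Cmp_Leq_if_left_Leq:
  assumes "X \<in> Ob C" "Y \<in> Ob C" "Z \<in> Ob C" "f \<in> Hom C X Y" "g \<in> Hom C Y Z" "g' \<in> Hom C Y Z"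
    "h \<in> Hom C X Z" "Leq C Y Z g g'" "Leq C X Z (Cmp C X Y Z g' f) h"
  shows "Leq C X Z (Cmp C X Y Z g f) h"
  using Leq_trans[OF assms(1,3) _ _ assms(7) Cmp_mono_left[OF assms(1-6,8)] assms(9)]
    Cmp_closed assms by blast

end

locale base_quantaloid = quantaloid Q for Q :: "('o, 'a) qtld"
begin

text \<open>Elements of \<open>Q\<close>-categories stand for their types as sources and targets of arrows of \<open>Q\<close>.\<close>

abbreviation arr :: "('x, 'o, 'a) qcat \<Rightarrow> 'x \<Rightarrow> ('y, 'o, 'a) qcat \<Rightarrow> 'y \<Rightarrow> 'a set" where
  "arr A x B y \<equiv> Hom Q (qtype A x) (qtype B y)"

abbreviation cmp :: "('x, 'o, 'a) qcat \<Rightarrow> 'x \<Rightarrow> ('y, 'o, 'a) qcat \<Rightarrow> 'y \<Rightarrow> ('z, 'o, 'a) qcat \<Rightarrow> 'z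
    \<Rightarrow> 'a \<Rightarrow> 'a \<Rightarrow> 'a" where
  "cmp A x B y D z \<equiv> Cmp Q (qtype A x) (qtype B y) (qtype D z)"

abbreviation leq :: "('x, 'o, 'a) qcat \<Rightarrow> 'x \<Rightarrow> ('y, 'o, 'a) qcat \<Rightarrow> 'y \<Rightarrow> 'a \<Rightarrow> 'a \<Rightarrow> bool" where
  "leq A x B y \<equiv> Leq Q (qtype A x) (qtype B y)"

lemma qtype_Ob: "\<lbrakk>qcategory Q A; x \<in> qob A\<rbrakk> \<Longrightarrow> qtype A x \<in> Ob Q"
  using qcategory.qtype_closed by (fastforce simp: PiE_iff)

lemma qhom_Hom:
  "\<lbrakk>qcategory Q A; x \<in> qob A; y \<in> qob A\<rbrakk> \<Longrightarrow> qhom A x y \<in> arr A x A y"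
  using qcategory.qhom_closed by (fastforce simp: PiE_iff)

lemma qdist_Hom:
  "\<lbrakk>\<phi> \<in> qdist Q A B; x \<in> qob A; y \<in> qob B\<rbrakk> \<Longrightarrow> \<phi> x y \<in> arr A x B y"
  by (simp add: qdist_def PiE_iff)

lemmas dist_typing = qtype_Ob qhom_Hom qdist_Hom Cmp_closed Ide_closed

lemma qdist_lambdaI:
  assumes A: "qcategory Q A" and B: "qcategory Q B"
    and h: "\<And>x y. \<lbrakk>x \<in> qob A; y \<in> qob B\<rbrakk> \<Longrightarrow> h x y \<in> arr A x B y"
    and left: "\<And>x y y'. \<lbrakk>x \<in> qob A; y \<in> qob B; y' \<in> qob B\<rbrakk> \<Longrightarrow>
      leq A x B y'
        (cmp A x B y B y' (qhom B y y') (h x y)) (h x y')"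
    and right: "\<And>x' x y. \<lbrakk>x' \<in> qob A; x \<in> qob A; y \<in> qob B\<rbrakk> \<Longrightarrow>
      leq A x' B y
        (cmp A x' A x B y (h x y) (qhom A x' x)) (h x' y)"
  shows "(\<lambda>x\<in>qob A. \<lambda>y\<in>qob B. h x y) \<in> qdist Q A B"
proof -
  have "leq A x' B y'
         (cmp A x' B y B y' (qhom B y y')
            (cmp A x' A x B y (h x y) (qhom A x' x)))
         (h x' y')" if x: "x \<in> qob A" "x' \<in> qob A" "y \<in> qob B" "y' \<in> qob B" for x x' y y'
    by (rule Cmp_Leq_if_right_Leq[OF _ _ _ _ _ _ _ right[of x' x y] left[of x' y y']])
      (use x A B h in \<open>simp_all add: dist_typing\<close>)
  then show ?thesis using h unfolding qdist_def by simp
qed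

lemma qdist_extensional: "\<phi> \<in> qdist Q A B \<Longrightarrow> \<phi> = (\<lambda>x\<in>qob A. \<lambda>y\<in>qob B. \<phi> x y)"
  by (rule ext, rule ext) (auto simp: qdist_def PiE_iff extensional_def restrict_def)

lemma qdist_eqI:
  assumes "\<phi> \<in> qdist Q A B" "\<psi> \<in> qdist Q A B"
    and "\<And>x y. \<lbrakk>x \<in> qob A; y \<in> qob B\<rbrakk> \<Longrightarrow> \<phi> x y = \<psi> x y"
  shows "\<phi> = \<psi>"
  using assms qdist_extensional[OF assms(1)] qdist_extensional[OF assms(2)]
  by (auto cong: restrict_cong)

lemma qdist_act_left:
  assumes A: "qcategory Q A" and B: "qcategory Q B" and \<phi>: "\<phi> \<in> qdist Q A B"
    and x: "x \<in> qob A" "y \<in> qob B" "y' \<in> qob B"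
  shows "leq A x B y'
    (cmp A x B y B y' (qhom B y y') (\<phi> x y)) (\<phi> x y')"
proof -
  have *: "leq A x B y'
     (cmp A x B y B y' (qhom B y y')
       (cmp A x A x B y (\<phi> x y) (qhom A x x))) (\<phi> x y')"
    using \<phi> x unfolding qdist_def by blast
  have "leq A x B y (\<phi> x y)
      (cmp A x A x B y (\<phi> x y) (qhom A x x))"
    using Cmp_mono_right[OF _ _ _ _ _ _ qcategory.qhom_refl[OF A x(1)],
        of "qtype B y" "\<phi> x y"] A B x \<phi>
    by (simp add: dist_typing Cmp_Ide_right)
  from Cmp_Leq_if_right_Leq[OF _ _ _ _ _ _ _ this *] show ?thesis
    using A B x \<phi> by (simp add: dist_typing)
qed

lemma qdist_act_right:
  assumes A: "qcategory Q A" and B: "qcategory Q B" and \<phi>: "\<phi> \<in> qdist Q A B"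
    and x: "x' \<in> qob A" "x \<in> qob A" "y \<in> qob B"
  shows "leq A x' B y
    (cmp A x' A x B y (\<phi> x y) (qhom A x' x)) (\<phi> x' y)"
proof -
  let ?c = "cmp A x' A x B y (\<phi> x y) (qhom A x' x)"
  have *: "leq A x' B y
     (cmp A x' B y B y (qhom B y y) ?c) (\<phi> x' y)"
    using \<phi> x unfolding qdist_def by blast
  have c: "?c \<in> arr A x' B y" using A B x \<phi> by (simp add: dist_typing)
  have "leq A x' B y
     (cmp A x' B y B y (Ide Q (qtype B y)) ?c) (\<phi> x' y)"
    by (rule Cmp_Leq_if_left_Leq[OF _ _ _ c _ _ _ qcategory.qhom_refl[OF B x(3)] *])
      (use A B x \<phi> in \<open>simp_all add: dist_typing\<close>)
  then show ?thesis using Cmp_Ide_left[OF _ _ c] A B x by (simp add: dist_typing)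
qed

text \<open>The two Yoneda lemmas, in the form in which residuals produce them.\<close>

lemma qdist_yoneda_left:
  assumes A: "qcategory Q A" and B: "qcategory Q B" and \<phi>: "\<phi> \<in> qdist Q A B"
    and x: "a \<in> qob A" "y \<in> qob B" and f: "f \<in> arr A a B y"
  shows "(\<forall>x\<in>qob A. leq A x B y
      (cmp A x A a B y f (qhom A x a)) (\<phi> x y))
    \<longleftrightarrow> leq A a B y f (\<phi> a y)" (is "?L \<longleftrightarrow> ?R")
proof
  assume ?L
  then have *: "leq A a B y
      (cmp A a A a B y f (qhom A a a)) (\<phi> a y)" using x by blast
  have "leq A a B y
      (cmp A a A a B y f (Ide Q (qtype A a))) (\<phi> a y)"
    by (rule Cmp_Leq_if_right_Leq[OF _ _ _ _ _ _ _ qcategory.qhom_refl[OF A x(1)] *])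
      (use A B x \<phi> f in \<open>simp_all add: dist_typing\<close>)
  then show ?R using Cmp_Ide_right[OF _ _ f] A B x by (simp add: dist_typing)
next
  assume R: ?R
  show ?L
  proof
    fix x' assume x': "x' \<in> qob A"
    show "leq A x' B y
      (cmp A x' A a B y f (qhom A x' a)) (\<phi> x' y)"
      by (rule Cmp_Leq_if_left_Leq[OF _ _ _ _ _ _ _ R qdist_act_right[OF A B \<phi> x' x]])
        (use A B x x' \<phi> f in \<open>simp_all add: dist_typing\<close>)
  qed
qed

lemma qdist_yoneda_right:
  assumes A: "qcategory Q A" and B: "qcategory Q B" and \<phi>: "\<phi> \<in> qdist Q A B"
    and x: "x \<in> qob A" "b \<in> qob B" and f: "f \<in> arr A x B b"
  shows "(\<forall>y\<in>qob B. leq A x B y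
      (cmp A x B b B y (qhom B b y) f) (\<phi> x y))
    \<longleftrightarrow> leq A x B b f (\<phi> x b)" (is "?L \<longleftrightarrow> ?R")
proof
  assume ?L
  then have *: "leq A x B b
      (cmp A x B b B b (qhom B b b) f) (\<phi> x b)" using x by blast
  have "leq A x B b
      (cmp A x B b B b (Ide Q (qtype B b)) f) (\<phi> x b)"
    by (rule Cmp_Leq_if_left_Leq[OF _ _ _ _ _ _ _ qcategory.qhom_refl[OF B x(2)] *])
      (use A B x \<phi> f in \<open>simp_all add: dist_typing\<close>)
  then show ?R using Cmp_Ide_left[OF _ _ f] A B x by (simp add: dist_typing)
next
  assume R: ?R
  show ?L
  proof
    fix y assume y: "y \<in> qob B"
    show "leq A x B y
      (cmp A x B b B y (qhom B b y) f) (\<phi> x y)"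
      by (rule Cmp_Leq_if_right_Leq[OF _ _ _ _ _ _ _ R qdist_act_left[OF A B \<phi> x y]])
        (use A B x y \<phi> f in \<open>simp_all add: dist_typing\<close>)
  qed
qed

subsection \<open>Composition\<close>

lemma QDist_simps [simp]:
  "A \<in> Ob (QDist Q :: (('u, 'o, 'a) qcat, 'u \<Rightarrow> 'u \<Rightarrow> 'a) qtld)
    \<longleftrightarrow> qcategory Q A \<and> small TYPE('u) (qob A)"
  "Hom (QDist Q) = qdist Q"
  "Ide (QDist Q) = qhom"
  "Leq (QDist Q) A B \<phi> \<psi> \<longleftrightarrow>
     (\<forall>x\<in>qob A. \<forall>y\<in>qob B. leq A x B y (\<phi> x y) (\<psi> x y))"
  by (simp_all add: QDist_def)

lemma Cmp_QDist_entry: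
  "\<lbrakk>x \<in> qob A; z \<in> qob B'\<rbrakk> \<Longrightarrow> Cmp (QDist Q) A B B' \<psi> \<phi> x z
    = \<Squnion>\<^bsub>hom_lat Q (qtype A x) (qtype B' z)\<^esub>
        ((\<lambda>y. cmp A x B y B' z (\<psi> y z) (\<phi> x y)) ` qob B)"
  by (simp add: QDist_def)

context
  fixes A B D :: "('u, 'o, 'a) qcat" and \<phi> \<psi>
  assumes A: "qcategory Q A" and B: "qcategory Q B" and D: "qcategory Q D"
    and \<phi>: "\<phi> \<in> qdist Q A B" and \<psi>: "\<psi> \<in> qdist Q B D"
begin

abbreviation (input) summands :: "'u \<Rightarrow> 'u \<Rightarrow> 'a set" where
  "summands x z \<equiv>
    (\<lambda>y. cmp A x B y D z (\<psi> y z) (\<phi> x y)) ` qob B"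

lemma summands_closed:
  "\<lbrakk>x \<in> qob A; z \<in> qob D\<rbrakk> \<Longrightarrow> summands x z \<subseteq> arr A x D z"
  using A B D \<phi> \<psi> by (auto simp: dist_typing)

lemma Cmp_entry_Hom:
  "\<lbrakk>x \<in> qob A; z \<in> qob D\<rbrakk> \<Longrightarrow>
    Cmp (QDist Q) A B D \<psi> \<phi> x z \<in> arr A x D z"
  using A D by (simp add: Cmp_QDist_entry sup_closed summands_closed dist_typing)

lemma Cmp_entry_Leq_iff:
  "\<lbrakk>x \<in> qob A; z \<in> qob D; t \<in> arr A x D z\<rbrakk> \<Longrightarrow>
    leq A x D z (Cmp (QDist Q) A B D \<psi> \<phi> x z) t
    \<longleftrightarrow> (\<forall>y\<in>qob B. leq A x D z
          (cmp A x B y D z (\<psi> y z) (\<phi> x y)) t)"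
  using A D by (simp add: Cmp_QDist_entry sup_Leq_iff summands_closed dist_typing)

lemma Cmp_Cmp_entry_Leq_iff:
  "\<lbrakk>x \<in> qob A; z \<in> qob D; W \<in> Ob Q; g \<in> Hom Q (qtype D z) W; t \<in> Hom Q (qtype A x) W\<rbrakk> \<Longrightarrow>
    Leq Q (qtype A x) W (Cmp Q (qtype A x) (qtype D z) W g (Cmp (QDist Q) A B D \<psi> \<phi> x z)) t
    \<longleftrightarrow> (\<forall>y\<in>qob B. Leq Q (qtype A x) W (Cmp Q (qtype A x) (qtype D z) W g
          (cmp A x B y D z (\<psi> y z) (\<phi> x y))) t)"
  using A D by (simp add: Cmp_QDist_entry Cmp_sup_right_Leq_iff summands_closed dist_typing)

lemma Cmp_entry_Cmp_Leq_iff: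
  "\<lbrakk>x \<in> qob A; z \<in> qob D; W \<in> Ob Q; g \<in> Hom Q W (qtype A x); t \<in> Hom Q W (qtype D z)\<rbrakk> \<Longrightarrow>
    Leq Q W (qtype D z) (Cmp Q W (qtype A x) (qtype D z) (Cmp (QDist Q) A B D \<psi> \<phi> x z) g) t
    \<longleftrightarrow> (\<forall>y\<in>qob B. Leq Q W (qtype D z) (Cmp Q W (qtype A x) (qtype D z)
          (cmp A x B y D z (\<psi> y z) (\<phi> x y)) g) t)"
  using A D by (simp add: Cmp_QDist_entry Cmp_sup_left_Leq_iff summands_closed dist_typing)

lemma Leq_Cmp_entry:
  assumes "x \<in> qob A" "y \<in> qob B" "z \<in> qob D"
  shows "leq A x D z
    (cmp A x B y D z (\<psi> y z) (\<phi> x y)) (Cmp (QDist Q) A B D \<psi> \<phi> x z)"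
  using Cmp_entry_Leq_iff[of x z "Cmp (QDist Q) A B D \<psi> \<phi> x z"] assms A D
  by (simp add: Cmp_entry_Hom Leq_refl dist_typing)

text \<open>The actions of \<open>A\<close> and \<open>D\<close> on a composite only involve one of the two factors of each summand.\<close>

lemma Cmp_QDist_closed: "Cmp (QDist Q) A B D \<psi> \<phi> \<in> qdist Q A D"
proof -
  have *: "Cmp (QDist Q) A B D \<psi> \<phi> = (\<lambda>x\<in>qob A. \<lambda>z\<in>qob D. Cmp (QDist Q) A B D \<psi> \<phi> x z)"
    by (intro ext) (auto simp: QDist_def restrict_def)
  show ?thesis
  proof (subst *, rule qdist_lambdaI[OF A D])
    fix x z z' assume x: "x \<in> qob A" and z: "z \<in> qob D" "z' \<in> qob D"
    show "leq A x D z'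
        (cmp A x D z D z' (qhom D z z') (Cmp (QDist Q) A B D \<psi> \<phi> x z))
        (Cmp (QDist Q) A B D \<psi> \<phi> x z')"
    proof (subst Cmp_Cmp_entry_Leq_iff, goal_cases)
      case 6
      show ?case
      proof
        fix y assume y: "y \<in> qob B"
        have "leq A x D z' (cmp A x B y D z'
            (cmp B y D z D z' (qhom D z z') (\<psi> y z)) (\<phi> x y))
          (Cmp (QDist Q) A B D \<psi> \<phi> x z')"
          by (rule Cmp_Leq_if_left_Leq[OF _ _ _ _ _ _ _ qdist_act_left[OF B D \<psi> y z] Leq_Cmp_entry])
            (use A B D \<phi> \<psi> x y z in \<open>simp_all add: dist_typing Cmp_entry_Hom\<close>)
        then show "leq A x D z' (cmp A x D z D z'
            (qhom D z z') (cmp A x B y D z (\<psi> y z) (\<phi> x y)))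
          (Cmp (QDist Q) A B D \<psi> \<phi> x z')"
          using A B D \<phi> \<psi> x y z by (simp add: Cmp_assoc dist_typing)
      qed
    qed (use A D x z in \<open>simp_all add: dist_typing Cmp_entry_Hom\<close>)
  next
    fix x' x z assume x: "x' \<in> qob A" "x \<in> qob A" and z: "z \<in> qob D"
    show "leq A x' D z
        (cmp A x' A x D z (Cmp (QDist Q) A B D \<psi> \<phi> x z) (qhom A x' x))
        (Cmp (QDist Q) A B D \<psi> \<phi> x' z)"
    proof (subst Cmp_entry_Cmp_Leq_iff, goal_cases)
      case 6
      show ?case
      proof
        fix y assume y: "y \<in> qob B"
        have "leq A x' D z (cmp A x' B y D z
            (\<psi> y z) (cmp A x' A x B y (\<phi> x y) (qhom A x' x)))
          (Cmp (QDist Q) A B D \<psi> \<phi> x' z)"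
          by (rule Cmp_Leq_if_right_Leq[OF _ _ _ _ _ _ _ qdist_act_right[OF A B \<phi> x y] Leq_Cmp_entry])
            (use A B D \<phi> \<psi> x y z in \<open>simp_all add: dist_typing Cmp_entry_Hom\<close>)
        then show "leq A x' D z (cmp A x' A x D z
            (cmp A x B y D z (\<psi> y z) (\<phi> x y)) (qhom A x' x))
          (Cmp (QDist Q) A B D \<psi> \<phi> x' z)"
          using A B D \<phi> \<psi> x y z by (simp add: Cmp_assoc dist_typing)
      qed
    qed (use A D x z in \<open>simp_all add: dist_typing Cmp_entry_Hom\<close>)
  qed (rule Cmp_entry_Hom)
qed

end

lemma qhom_qdist:
  assumes A: "qcategory Q A"
  shows "qhom A \<in> qdist Q A A"
proof -
  have "qhom A = (\<lambda>x\<in>qob A. \<lambda>y\<in>qob A. qhom A x y)"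
    using qcategory.qhom_closed[OF A] by (intro ext) (auto simp: PiE_iff extensional_def restrict_def)
  moreover have "(\<lambda>x\<in>qob A. \<lambda>y\<in>qob A. qhom A x y) \<in> qdist Q A A"
    by (rule qdist_lambdaI[OF A A]) (use A qcategory.qhom_trans in \<open>simp_all add: dist_typing\<close>)
  ultimately show ?thesis by simp
qed

lemma Cmp_QDist_Ide_right:
  assumes A: "qcategory Q A" and B: "qcategory Q B" and \<phi>: "\<phi> \<in> qdist Q A B"
  shows "Cmp (QDist Q) A A B \<phi> (qhom A) = \<phi>"
proof (rule qdist_eqI[OF Cmp_QDist_closed[OF A A B qhom_qdist[OF A] \<phi>] \<phi>])
  fix x y assume x: "x \<in> qob A" and y: "y \<in> qob B"
  show "Cmp (QDist Q) A A B \<phi> (qhom A) x y = \<phi> x y"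
  proof (rule Leq_antisym)
    show "leq A x B y (Cmp (QDist Q) A A B \<phi> (qhom A) x y) (\<phi> x y)"
      using A B \<phi> x y qdist_act_right[OF A B \<phi> x _ y]
      by (simp add: Cmp_entry_Leq_iff qhom_qdist dist_typing)
    show "leq A x B y (\<phi> x y) (Cmp (QDist Q) A A B \<phi> (qhom A) x y)"
      using Cmp_Leq_if_right_Leq[OF _ _ _ _ _ _ _ qcategory.qhom_refl[OF A x]
          Leq_Cmp_entry[OF A A B qhom_qdist[OF A] \<phi> x x y]] A B \<phi> x y
      by (simp add: Cmp_Ide_right dist_typing Cmp_entry_Hom qhom_qdist)
  qed (use A B \<phi> x y in \<open>simp_all add: dist_typing Cmp_entry_Hom qhom_qdist\<close>)
qed

lemma Cmp_QDist_Ide_left: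
  assumes A: "qcategory Q A" and B: "qcategory Q B" and \<phi>: "\<phi> \<in> qdist Q A B"
  shows "Cmp (QDist Q) A B B (qhom B) \<phi> = \<phi>"
proof (rule qdist_eqI[OF Cmp_QDist_closed[OF A B B \<phi> qhom_qdist[OF B]] \<phi>])
  fix x y assume x: "x \<in> qob A" and y: "y \<in> qob B"
  show "Cmp (QDist Q) A B B (qhom B) \<phi> x y = \<phi> x y"
  proof (rule Leq_antisym)
    show "leq A x B y (Cmp (QDist Q) A B B (qhom B) \<phi> x y) (\<phi> x y)"
      using A B \<phi> x y qdist_act_left[OF A B \<phi> x _ y]
      by (simp add: Cmp_entry_Leq_iff qhom_qdist dist_typing)
    show "leq A x B y (\<phi> x y) (Cmp (QDist Q) A B B (qhom B) \<phi> x y)"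
      using Cmp_Leq_if_left_Leq[OF _ _ _ _ _ _ _ qcategory.qhom_refl[OF B y]
          Leq_Cmp_entry[OF A B B \<phi> qhom_qdist[OF B] x y y]] A B \<phi> x y
      by (simp add: Cmp_Ide_left dist_typing Cmp_entry_Hom qhom_qdist)
  qed (use A B \<phi> x y in \<open>simp_all add: dist_typing Cmp_entry_Hom qhom_qdist\<close>)
qed

text \<open>Both composites have the same upper bounds, namely the upper bounds of all threefold products
  of entries.\<close>

lemma Cmp_QDist_assoc:
  assumes A: "qcategory Q A" and B: "qcategory Q B" and D: "qcategory Q D" and E: "qcategory Q E"
    and \<phi>: "\<phi> \<in> qdist Q A B" and \<psi>: "\<psi> \<in> qdist Q B D" and \<chi>: "\<chi> \<in> qdist Q D E"
  shows "Cmp (QDist Q) A B E (Cmp (QDist Q) B D E \<chi> \<psi>) \<phi>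
    = Cmp (QDist Q) A D E \<chi> (Cmp (QDist Q) A B D \<psi> \<phi>)" (is "?l = ?r")
proof (rule qdist_eqI)
  note cl = Cmp_QDist_closed[OF A B D \<phi> \<psi>] Cmp_QDist_closed[OF B D E \<psi> \<chi>]
  show l: "?l \<in> qdist Q A E" and r: "?r \<in> qdist Q A E"
    using A B D E \<phi> \<chi> cl Cmp_QDist_closed by blast+
  fix x w assume x: "x \<in> qob A" and w: "w \<in> qob E"
  show "?l x w = ?r x w"
  proof (rule Leq_eqI_upper)
    fix t assume t: "t \<in> arr A x E w"
    have "leq A x E w (?l x w) t \<longleftrightarrow>
      (\<forall>y\<in>qob B. \<forall>z\<in>qob D. leq A x E w (cmp A x B y E w
        (cmp B y D z E w (\<chi> z w) (\<psi> y z)) (\<phi> x y)) t)"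
      using A B D E \<phi> \<psi> \<chi> x w t cl
      by (simp add: Cmp_entry_Leq_iff Cmp_entry_Cmp_Leq_iff dist_typing)
    also have "\<dots> \<longleftrightarrow> (\<forall>z\<in>qob D. \<forall>y\<in>qob B. leq A x E w
      (cmp A x D z E w (\<chi> z w)
        (cmp A x B y D z (\<psi> y z) (\<phi> x y))) t)"
      using A B D E \<phi> \<psi> \<chi> x w by (auto simp: Cmp_assoc dist_typing)
    also have "\<dots> \<longleftrightarrow> leq A x E w (?r x w) t"
      using A B D E \<phi> \<psi> \<chi> x w t cl
      by (simp add: Cmp_entry_Leq_iff Cmp_Cmp_entry_Leq_iff dist_typing)
    finally show "leq A x E w (?l x w) t
      \<longleftrightarrow> leq A x E w (?r x w) t" .
  qed (use A E x w l r in \<open>simp_all add: dist_typing\<close>)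
qed

lemma Cmp_QDist_Leq_iff:
  assumes "qcategory Q A" "qcategory Q B" "qcategory Q D"
    and "\<phi> \<in> qdist Q A B" "\<psi> \<in> qdist Q B D" "\<theta> \<in> qdist Q A D"
  shows "Leq (QDist Q) A D (Cmp (QDist Q) A B D \<psi> \<phi>) \<theta> \<longleftrightarrow>
    (\<forall>x\<in>qob A. \<forall>y\<in>qob B. \<forall>z\<in>qob D. leq A x D z
       (cmp A x B y D z (\<psi> y z) (\<phi> x y)) (\<theta> x z))"
  using assms by (auto simp: Cmp_entry_Leq_iff dist_typing)

subsection \<open>Suprema\<close>

definition pointwise_sup ::
  "('x, 'o, 'a) qcat \<Rightarrow> ('y, 'o, 'a) qcat \<Rightarrow> ('x \<Rightarrow> 'y \<Rightarrow> 'a) set \<Rightarrow> 'x \<Rightarrow> 'y \<Rightarrow> 'a" where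
  "pointwise_sup A B S = (\<lambda>x\<in>qob A. \<lambda>y\<in>qob B.
     \<Squnion>\<^bsub>hom_lat Q (qtype A x) (qtype B y)\<^esub> ((\<lambda>\<phi>. \<phi> x y) ` S))"

lemma pointwise_sup_closed:
  assumes A: "qcategory Q A" and B: "qcategory Q B" and S: "S \<subseteq> qdist Q A B"
  shows "pointwise_sup A B S \<in> qdist Q A B"
proof -
  have cl: "(\<lambda>\<phi>. \<phi> x y) ` S \<subseteq> arr A x B y" if "x \<in> qob A" "y \<in> qob B" for x y
    using that S by (auto simp: qdist_Hom)
  let ?s = "\<lambda>x y. \<Squnion>\<^bsub>hom_lat Q (qtype A x) (qtype B y)\<^esub> ((\<lambda>\<phi>. \<phi> x y) ` S)"
  have le: "leq A x B y (\<phi> x y) (?s x y)"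
    if "x \<in> qob A" "y \<in> qob B" "\<phi> \<in> S" for x y \<phi>
    using that A B Leq_sup[OF _ _ cl[OF that(1,2)]] by (simp add: dist_typing)
  have s: "?s x y \<in> arr A x B y" if "x \<in> qob A" "y \<in> qob B" for x y
    using sup_closed[OF _ _ cl[OF that]] that A B by (simp add: dist_typing)
  show ?thesis
    unfolding pointwise_sup_def
  proof (rule qdist_lambdaI[OF A B s])
    fix x y y' assume x: "x \<in> qob A" and y: "y \<in> qob B" "y' \<in> qob B"
    have "leq A x B y'
        (cmp A x B y B y' (qhom B y y') (\<phi> x y)) (?s x y')"
      if \<phi>: "\<phi> \<in> S" for \<phi>
      by (rule Leq_trans[OF _ _ _ _ _ qdist_act_left[OF A B _ x y] le])
        (use A B x y s \<phi> subsetD[OF S \<phi>] in \<open>simp_all add: dist_typing\<close>)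
    then show "leq A x B y'
        (cmp A x B y B y' (qhom B y y') (?s x y)) (?s x y')"
      using Cmp_sup_right_Leq_iff[OF _ _ _ cl[OF x y(1)]] A B x y s by (simp add: dist_typing)
  next
    fix x' x y assume x: "x' \<in> qob A" "x \<in> qob A" and y: "y \<in> qob B"
    have "leq A x' B y
        (cmp A x' A x B y (\<phi> x y) (qhom A x' x)) (?s x' y)"
      if \<phi>: "\<phi> \<in> S" for \<phi>
      by (rule Leq_trans[OF _ _ _ _ _ qdist_act_right[OF A B _ x y] le])
        (use A B x y s \<phi> subsetD[OF S \<phi>] in \<open>simp_all add: dist_typing\<close>)
    then show "leq A x' B y
        (cmp A x' A x B y (?s x y) (qhom A x' x)) (?s x' y)"
      using Cmp_sup_left_Leq_iff[OF _ _ _ cl[OF x(2) y]] A B x y s by (simp add: dist_typing)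
  qed
qed

lemma pointwise_sup_Leq_iff:
  assumes "qcategory Q A" "qcategory Q B" "S \<subseteq> qdist Q A B" "x \<in> qob A" "y \<in> qob B"
    "t \<in> arr A x B y"
  shows "leq A x B y (pointwise_sup A B S x y) t
    \<longleftrightarrow> (\<forall>\<phi>\<in>S. leq A x B y (\<phi> x y) t)"
proof -
  have "(\<lambda>\<phi>. \<phi> x y) ` S \<subseteq> arr A x B y" using assms by (auto simp: qdist_Hom)
  then show ?thesis using assms by (simp add: pointwise_sup_def sup_Leq_iff dist_typing)
qed

lemma Cmp_pointwise_sup_Leq_iff:
  assumes "qcategory Q A" "qcategory Q B" "S \<subseteq> qdist Q A B" "x \<in> qob A" "y \<in> qob B"
    "Z \<in> Ob Q" "g \<in> Hom Q (qtype B y) Z" "t \<in> Hom Q (qtype A x) Z"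
  shows "Leq Q (qtype A x) Z (Cmp Q (qtype A x) (qtype B y) Z g (pointwise_sup A B S x y)) t
    \<longleftrightarrow> (\<forall>\<phi>\<in>S. Leq Q (qtype A x) Z (Cmp Q (qtype A x) (qtype B y) Z g (\<phi> x y)) t)"
proof -
  have "(\<lambda>\<phi>. \<phi> x y) ` S \<subseteq> arr A x B y" using assms by (auto simp: qdist_Hom)
  then show ?thesis using assms by (simp add: pointwise_sup_def Cmp_sup_right_Leq_iff dist_typing)
qed

lemma pointwise_sup_Cmp_Leq_iff:
  assumes "qcategory Q A" "qcategory Q B" "S \<subseteq> qdist Q A B" "x \<in> qob A" "y \<in> qob B"
    "Z \<in> Ob Q" "g \<in> Hom Q Z (qtype A x)" "t \<in> Hom Q Z (qtype B y)"
  shows "Leq Q Z (qtype B y) (Cmp Q Z (qtype A x) (qtype B y) (pointwise_sup A B S x y) g) t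
    \<longleftrightarrow> (\<forall>\<phi>\<in>S. Leq Q Z (qtype B y) (Cmp Q Z (qtype A x) (qtype B y) (\<phi> x y) g) t)"
proof -
  have "(\<lambda>\<phi>. \<phi> x y) ` S \<subseteq> arr A x B y" using assms by (auto simp: qdist_Hom)
  then show ?thesis using assms by (simp add: pointwise_sup_def Cmp_sup_left_Leq_iff dist_typing)
qed

text \<open>Suprema are computed entrywise, and a composite lies below a distributor as soon as each product
  of entries does; hence preservation of suprema reduces to the same property of \<open>Q\<close>.\<close>

theorem quantaloid_QDist: "quantaloid (QDist Q :: (('u, 'o, 'a) qcat, 'u \<Rightarrow> 'u \<Rightarrow> 'a) qtld)"
    (is "quantaloid ?D")
proof (rule quantaloidI)
  show "category ?D"
    by unfold_locales
      (auto intro: qhom_qdist Cmp_QDist_closed Cmp_QDist_Ide_left Cmp_QDist_Ide_right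
        Cmp_QDist_assoc[symmetric] Cmp_QDist_assoc)
  show "ordered_homs ?D"
  proof
    fix A B :: "('u, 'o, 'a) qcat" and f assume "A \<in> Ob ?D" "B \<in> Ob ?D" "f \<in> Hom ?D A B"
    then show "Leq ?D A B f f" by (simp add: Leq_refl dist_typing)
  next
    fix A B :: "('u, 'o, 'a) qcat" and f g
    assume *: "A \<in> Ob ?D" "B \<in> Ob ?D" "f \<in> Hom ?D A B" "g \<in> Hom ?D A B" "Leq ?D A B f g" "Leq ?D A B g f"
    then have f: "f \<in> qdist Q A B" and g: "g \<in> qdist Q A B" by simp_all
    show "f = g"
    proof (rule qdist_eqI[OF f g])
      fix x y assume x: "x \<in> qob A" "y \<in> qob B"
      show "f x y = g x y"
        by (rule Leq_antisym[of "qtype A x" "qtype B y"]) (use * x in \<open>simp_all add: dist_typing\<close>)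
    qed
  next
    fix A B :: "('u, 'o, 'a) qcat" and f g h
    assume *: "A \<in> Ob ?D" "B \<in> Ob ?D" "f \<in> Hom ?D A B" "g \<in> Hom ?D A B" "h \<in> Hom ?D A B"
      "Leq ?D A B f g" "Leq ?D A B g h"
    have "leq A x B y (f x y) (h x y)" if x: "x \<in> qob A" "y \<in> qob B" for x y
      by (rule Leq_trans[of "qtype A x" "qtype B y" "f x y" "g x y"])
        (use * x in \<open>simp_all add: dist_typing\<close>)
    then show "Leq ?D A B f h" by simp
  qed
next
  fix A B :: "('u, 'o, 'a) qcat" and S
  assume "A \<in> Ob ?D" "B \<in> Ob ?D" "S \<subseteq> Hom ?D A B"
  then have A: "qcategory Q A" and B: "qcategory Q B" and S: "S \<subseteq> qdist Q A B" by simp_all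
  let ?s = "pointwise_sup A B S"
  note s = pointwise_sup_closed[OF A B S]
  show "\<exists>s. is_supremum ?D A B S s \<and>
        (\<forall>Z\<in>Ob ?D. \<forall>g\<in>Hom ?D B Z. is_supremum ?D A Z (Cmp ?D A B Z g ` S) (Cmp ?D A B Z g s)) \<and>
        (\<forall>W\<in>Ob ?D. \<forall>g\<in>Hom ?D W A.
           is_supremum ?D W B ((\<lambda>f. Cmp ?D W A B f g) ` S) (Cmp ?D W A B s g))"
  proof (intro exI conjI ballI)
    show "is_supremum ?D A B S ?s"
      using A B S s by (auto simp: is_supremum_def pointwise_sup_Leq_iff dist_typing)
  next
    fix Z g assume "Z \<in> Ob ?D" "g \<in> Hom ?D B Z"
    then have Z: "qcategory Q Z" and g: "g \<in> qdist Q B Z" by simp_all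
    have "Leq ?D A Z (Cmp ?D A B Z g ?s) t \<longleftrightarrow> (\<forall>p\<in>S. Leq ?D A Z (Cmp ?D A B Z g p) t)"
      if t: "t \<in> qdist Q A Z" for t
      using A B S s Z g t subsetD[OF S]
      by (simp only: Cmp_QDist_Leq_iff cong: ball_cong)
        (auto simp: Cmp_pointwise_sup_Leq_iff dist_typing)
    then show "is_supremum ?D A Z (Cmp ?D A B Z g ` S) (Cmp ?D A B Z g ?s)"
      using A B Z s g by (simp add: is_supremum_def Cmp_QDist_closed del: QDist_simps(4))
  next
    fix W g assume "W \<in> Ob ?D" "g \<in> Hom ?D W A"
    then have W: "qcategory Q W" and g: "g \<in> qdist Q W A" by simp_all
    have "Leq ?D W B (Cmp ?D W A B ?s g) t \<longleftrightarrow> (\<forall>p\<in>S. Leq ?D W B (Cmp ?D W A B p g) t)"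
      if t: "t \<in> qdist Q W B" for t
      using A B S s W g t subsetD[OF S]
      by (simp only: Cmp_QDist_Leq_iff cong: ball_cong)
        (auto simp: pointwise_sup_Cmp_Leq_iff dist_typing)
    then show "is_supremum ?D W B ((\<lambda>f. Cmp ?D W A B f g) ` S) (Cmp ?D W A B ?s g)"
      using A B W s g by (simp add: is_supremum_def Cmp_QDist_closed del: QDist_simps(4))
  qed
qed

subsection \<open>Residuals\<close>

text \<open>The entry of \<open>\<chi> \<swarrow> \<phi>\<close> at \<open>(y, z)\<close> is the infimum over \<open>x\<close> of the residuals \<open>\<chi>(x, z) \<swarrow> \<phi>(x, y)\<close> in
  \<open>Q\<close>: these infima form a distributor, and it has the universal property of the residual.\<close>

lemma lres_QDist_closed_and_Leq_iff:
  fixes A B D :: "('u, 'o, 'a) qcat"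
  assumes ob: "A \<in> Ob (QDist Q)" "B \<in> Ob (QDist Q)" "D \<in> Ob (QDist Q)"
    and \<phi>: "\<phi> \<in> qdist Q A B" and \<chi>: "\<chi> \<in> qdist Q A D"
  shows "lres (QDist Q) A B D \<chi> \<phi> \<in> qdist Q B D \<and>
    (\<forall>y\<in>qob B. \<forall>z\<in>qob D. \<forall>f\<in>arr B y D z.
      leq B y D z f (lres (QDist Q) A B D \<chi> \<phi> y z) \<longleftrightarrow>
      (\<forall>x\<in>qob A. leq A x D z
        (cmp A x B y D z f (\<phi> x y)) (\<chi> x z)))"
proof -
  interpret D: quantaloid "QDist Q :: (('u, 'o, 'a) qcat, 'u \<Rightarrow> 'u \<Rightarrow> 'a) qtld"
    by (rule quantaloid_QDist)
  have A: "qcategory Q A" and B: "qcategory Q B" and D: "qcategory Q D" using ob by simp_all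
  have "\<exists>k. k \<in> arr B y D z \<and> (\<forall>f\<in>arr B y D z.
      leq B y D z f k \<longleftrightarrow> (\<forall>x\<in>qob A. leq A x D z
        (cmp A x B y D z f (\<phi> x y)) (\<chi> x z)))"
    if "y \<in> qob B" "z \<in> qob D" for y z
    using left_residual_exists[of "qtype B y" "qtype D z" "qob A" "qtype A" "\<lambda>x. \<phi> x y" "\<lambda>x. \<chi> x z"]
      that A B D \<phi> \<chi> by (auto simp: dist_typing)
  then obtain k where "\<forall>y\<in>qob B. \<forall>z\<in>qob D. k y z \<in> arr B y D z \<and>
    (\<forall>f\<in>arr B y D z.
      leq B y D z f (k y z) \<longleftrightarrow> (\<forall>x\<in>qob A. leq A x D z
        (cmp A x B y D z f (\<phi> x y)) (\<chi> x z)))"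
    by metis
  then have k_Hom: "k y z \<in> arr B y D z"
    and k: "f \<in> arr B y D z \<Longrightarrow>
      leq B y D z f (k y z) \<longleftrightarrow> (\<forall>x\<in>qob A. leq A x D z
        (cmp A x B y D z f (\<phi> x y)) (\<chi> x z))"
    if "y \<in> qob B" "z \<in> qob D" for y z f
    using that by blast+
  have k_Cmp: "leq A x D z
      (cmp A x B y D z (k y z) (\<phi> x y)) (\<chi> x z)"
    if "x \<in> qob A" "y \<in> qob B" "z \<in> qob D" for x y z
    using k[OF that(2,3) k_Hom[OF that(2,3)]] Leq_refl k_Hom that B D by (simp add: dist_typing)
  let ?K = "\<lambda>y\<in>qob B. \<lambda>z\<in>qob D. k y z"
  have K: "?K \<in> qdist Q B D"
  proof (rule qdist_lambdaI[OF B D k_Hom])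
    fix y z z' assume y: "y \<in> qob B" and z: "z \<in> qob D" "z' \<in> qob D"
    have "leq A x D z' (cmp A x D z D z' (qhom D z z')
        (cmp A x B y D z (k y z) (\<phi> x y))) (\<chi> x z')"
      if x: "x \<in> qob A" for x
      by (rule Cmp_Leq_if_right_Leq[OF _ _ _ _ _ _ _ k_Cmp[OF x y z(1)] qdist_act_left[OF A D \<chi> x z]])
        (use x y z A B D \<phi> \<chi> k_Hom in \<open>simp_all add: dist_typing\<close>)
    then show "leq B y D z'
        (cmp B y D z D z' (qhom D z z') (k y z)) (k y z')"
      using y z A B D \<phi> k_Hom by (simp add: k dist_typing Cmp_assoc)
  next
    fix y' y z assume y: "y' \<in> qob B" "y \<in> qob B" and z: "z \<in> qob D"
    have "leq A x D z (cmp A x B y D z (k y z)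
        (cmp A x B y' B y (qhom B y' y) (\<phi> x y'))) (\<chi> x z)"
      if x: "x \<in> qob A" for x
      by (rule Cmp_Leq_if_right_Leq[OF _ _ _ _ _ _ _ qdist_act_left[OF A B \<phi> x y] k_Cmp[OF x y(2) z]])
        (use x y z A B D \<phi> \<chi> k_Hom in \<open>simp_all add: dist_typing\<close>)
    then show "leq B y' D z
        (cmp B y' B y D z (k y z) (qhom B y' y)) (k y' z)"
      using y z A B D \<phi> k_Hom by (simp add: k dist_typing Cmp_assoc)
  qed
  have "lres (QDist Q) A B D \<chi> \<phi> = ?K"
  proof (rule D.lres_eqI)
    show "B \<in> Ob (QDist Q)" "D \<in> Ob (QDist Q)" "?K \<in> Hom (QDist Q) B D" using ob K by simp_all
    fix g assume "g \<in> Hom (QDist Q) B D"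
    then have g: "g \<in> qdist Q B D" by simp
    show "Leq (QDist Q) B D g ?K \<longleftrightarrow> Leq (QDist Q) A D (Cmp (QDist Q) A B D g \<phi>) \<chi>"
      by (subst Cmp_QDist_Leq_iff[OF A B D \<phi> g \<chi>]) (use g in \<open>auto simp: k dist_typing\<close>)
  qed
  then show ?thesis using K k by auto
qed

lemmas lres_QDist_closed = lres_QDist_closed_and_Leq_iff[THEN conjunct1]
lemmas Leq_lres_QDist_iff = lres_QDist_closed_and_Leq_iff[THEN conjunct2, rule_format]

lemma rres_QDist_closed_and_Leq_iff:
  fixes A B D :: "('u, 'o, 'a) qcat"
  assumes ob: "A \<in> Ob (QDist Q)" "B \<in> Ob (QDist Q)" "D \<in> Ob (QDist Q)"
    and \<psi>: "\<psi> \<in> qdist Q B D" and \<chi>: "\<chi> \<in> qdist Q A D"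
  shows "rres (QDist Q) A B D \<psi> \<chi> \<in> qdist Q A B \<and>
    (\<forall>x\<in>qob A. \<forall>y\<in>qob B. \<forall>f\<in>arr A x B y.
      leq A x B y f (rres (QDist Q) A B D \<psi> \<chi> x y) \<longleftrightarrow>
      (\<forall>z\<in>qob D. leq A x D z
        (cmp A x B y D z (\<psi> y z) f) (\<chi> x z)))"
proof -
  interpret D: quantaloid "QDist Q :: (('u, 'o, 'a) qcat, 'u \<Rightarrow> 'u \<Rightarrow> 'a) qtld"
    by (rule quantaloid_QDist)
  have A: "qcategory Q A" and B: "qcategory Q B" and D: "qcategory Q D" using ob by simp_all
  have "\<exists>k. k \<in> arr A x B y \<and> (\<forall>f\<in>arr A x B y.
      leq A x B y f k \<longleftrightarrow> (\<forall>z\<in>qob D. leq A x D z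
        (cmp A x B y D z (\<psi> y z) f) (\<chi> x z)))"
    if "x \<in> qob A" "y \<in> qob B" for x y
    using right_residual_exists[of "qtype A x" "qtype B y" "qob D" "qtype D" "\<lambda>z. \<psi> y z" "\<lambda>z. \<chi> x z"]
      that A B D \<psi> \<chi> by (auto simp: dist_typing)
  then obtain k where "\<forall>x\<in>qob A. \<forall>y\<in>qob B. k x y \<in> arr A x B y \<and>
    (\<forall>f\<in>arr A x B y.
      leq A x B y f (k x y) \<longleftrightarrow> (\<forall>z\<in>qob D. leq A x D z
        (cmp A x B y D z (\<psi> y z) f) (\<chi> x z)))"
    by metis
  then have k_Hom: "k x y \<in> arr A x B y"
    and k: "f \<in> arr A x B y \<Longrightarrow>
      leq A x B y f (k x y) \<longleftrightarrow> (\<forall>z\<in>qob D. leq A x D z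
        (cmp A x B y D z (\<psi> y z) f) (\<chi> x z))"
    if "x \<in> qob A" "y \<in> qob B" for x y f
    using that by blast+
  have k_Cmp: "leq A x D z
      (cmp A x B y D z (\<psi> y z) (k x y)) (\<chi> x z)"
    if "x \<in> qob A" "y \<in> qob B" "z \<in> qob D" for x y z
    using k[OF that(1,2) k_Hom[OF that(1,2)]] Leq_refl k_Hom that A B by (simp add: dist_typing)
  let ?K = "\<lambda>x\<in>qob A. \<lambda>y\<in>qob B. k x y"
  have K: "?K \<in> qdist Q A B"
  proof (rule qdist_lambdaI[OF A B k_Hom])
    fix x y y' assume x: "x \<in> qob A" and y: "y \<in> qob B" "y' \<in> qob B"
    have "leq A x D z (cmp A x B y D z
        (cmp B y B y' D z (\<psi> y' z) (qhom B y y')) (k x y)) (\<chi> x z)"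
      if z: "z \<in> qob D" for z
      by (rule Cmp_Leq_if_left_Leq[OF _ _ _ _ _ _ _ qdist_act_right[OF B D \<psi> y z] k_Cmp[OF x y(1) z]])
        (use x y z A B D \<psi> \<chi> k_Hom in \<open>simp_all add: dist_typing\<close>)
    then show "leq A x B y'
        (cmp A x B y B y' (qhom B y y') (k x y)) (k x y')"
      using x y A B D \<psi> k_Hom by (simp add: k dist_typing Cmp_assoc)
  next
    fix x' x y assume x: "x' \<in> qob A" "x \<in> qob A" and y: "y \<in> qob B"
    have "leq A x' D z (cmp A x' A x D z
        (cmp A x B y D z (\<psi> y z) (k x y)) (qhom A x' x)) (\<chi> x' z)"
      if z: "z \<in> qob D" for z
      by (rule Cmp_Leq_if_left_Leq[OF _ _ _ _ _ _ _ k_Cmp[OF x(2) y z] qdist_act_right[OF A D \<chi> x z]])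
        (use x y z A B D \<psi> \<chi> k_Hom in \<open>simp_all add: dist_typing\<close>)
    then show "leq A x' B y
        (cmp A x' A x B y (k x y) (qhom A x' x)) (k x' y)"
      using x y A B D \<psi> k_Hom by (simp add: k dist_typing Cmp_assoc)
  qed
  have "rres (QDist Q) A B D \<psi> \<chi> = ?K"
  proof (rule D.rres_eqI)
    show "A \<in> Ob (QDist Q)" "B \<in> Ob (QDist Q)" "?K \<in> Hom (QDist Q) A B" using ob K by simp_all
    fix g assume "g \<in> Hom (QDist Q) A B"
    then have g: "g \<in> qdist Q A B" by simp
    show "Leq (QDist Q) A B g ?K \<longleftrightarrow> Leq (QDist Q) A D (Cmp (QDist Q) A B D \<psi> g) \<chi>"
      by (subst Cmp_QDist_Leq_iff[OF A B D g \<psi> \<chi>]) (use g in \<open>auto simp: k dist_typing\<close>)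
  qed
  then show ?thesis using K k by auto
qed

lemmas rres_QDist_closed = rres_QDist_closed_and_Leq_iff[THEN conjunct1]
lemmas Leq_rres_QDist_iff = rres_QDist_closed_and_Leq_iff[THEN conjunct2, rule_format]

lemma lres_QDist_eqI:
  fixes A B D :: "('u, 'o, 'a) qcat"
  assumes ob: "A \<in> Ob (QDist Q)" "B \<in> Ob (QDist Q)" "D \<in> Ob (QDist Q)"
    and h: "\<phi> \<in> qdist Q A B" "\<chi> \<in> qdist Q A D" "\<kappa> \<in> qdist Q B D"
    and "\<And>y z f. \<lbrakk>y \<in> qob B; z \<in> qob D; f \<in> arr B y D z\<rbrakk> \<Longrightarrow>
      (\<forall>x\<in>qob A. leq A x D z
        (cmp A x B y D z f (\<phi> x y)) (\<chi> x z))
      \<longleftrightarrow> leq B y D z f (\<kappa> y z)"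
  shows "lres (QDist Q) A B D \<chi> \<phi> = \<kappa>"
proof (rule qdist_eqI[OF lres_QDist_closed[OF ob h(1,2)] h(3)])
  fix y z assume "y \<in> qob B" "z \<in> qob D"
  then show "lres (QDist Q) A B D \<chi> \<phi> y z = \<kappa> y z"
    using ob h assms(7) by (intro Leq_eqI[of "qtype B y" "qtype D z"])
      (simp_all add: dist_typing qdist_Hom[OF lres_QDist_closed] Leq_lres_QDist_iff)
qed

lemma rres_QDist_eqI:
  fixes A B D :: "('u, 'o, 'a) qcat"
  assumes ob: "A \<in> Ob (QDist Q)" "B \<in> Ob (QDist Q)" "D \<in> Ob (QDist Q)"
    and h: "\<psi> \<in> qdist Q B D" "\<chi> \<in> qdist Q A D" "\<kappa> \<in> qdist Q A B"
    and "\<And>x y f. \<lbrakk>x \<in> qob A; y \<in> qob B; f \<in> arr A x B y\<rbrakk> \<Longrightarrow>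
      (\<forall>z\<in>qob D. leq A x D z
        (cmp A x B y D z (\<psi> y z) f) (\<chi> x z))
      \<longleftrightarrow> leq A x B y f (\<kappa> x y)"
  shows "rres (QDist Q) A B D \<psi> \<chi> = \<kappa>"
proof (rule qdist_eqI[OF rres_QDist_closed[OF ob h(1,2)] h(3)])
  fix x y assume "x \<in> qob A" "y \<in> qob B"
  then show "rres (QDist Q) A B D \<psi> \<chi> x y = \<kappa> x y"
    using ob h assms(7) by (intro Leq_eqI[of "qtype A x" "qtype B y"])
      (simp_all add: dist_typing qdist_Hom[OF rres_QDist_closed] Leq_rres_QDist_iff)
qed

end


section \<open>The quotient of Chu connections\<close>

text \<open>The Chu connections with bond \<open>w\<close>.  For an arrow \<open>w\<close> that is not a bond this is the empty set
  and not an arrow of the quotient.\<close>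

fun chu_class :: "('o, 'a) qtld \<Rightarrow> 'o \<times> 'o \<times> 'a \<Rightarrow> 'o \<times> 'o \<times> 'a \<Rightarrow> 'a \<Rightarrow> ('a \<times> 'a) set" where
  "chu_class C (X1, Y1, f) (X2, Y2, g) w =
     {(u, v) \<in> chu_connections C (X1, Y1, f) (X2, Y2, g). lres C X1 X2 Y1 f u = w}"

lemma ChuCon_simps [simp]:
  "(X, Y, f) \<in> Ob (ChuCon C) \<longleftrightarrow> X \<in> Ob C \<and> Y \<in> Ob C \<and> f \<in> Hom C X Y"
  "Hom (ChuCon C) = chu_connections C"
  "Ide (ChuCon C) (X, Y, f) = (Ide C X, Ide C Y)"
  "Cmp (ChuCon C) (X1, Y1, f1) (X2, Y2, f2) (X3, Y3, f3) (u', v') (u, v)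
    = (Cmp C X1 X2 X3 u' u, Cmp C Y1 Y2 Y3 v' v)"
  "Leq (ChuCon C) (X1, Y1, f1) (X2, Y2, f2) (u, v) (u', v')
    \<longleftrightarrow> Leq C X1 X2 u u' \<and> Leq C Y1 Y2 v v'"
  by (simp_all add: ChuCon_def)

lemma BChu_simps:
  "Ob (BChu C) = Ob (ChuCon C)"
  "Hom (BChu C) X Y = chu_connections C X Y // chu_equiv C X Y"
  "Ide (BChu C) X = chu_equiv C X X `` {Ide (ChuCon C) X}"
  "Cmp (BChu C) X Y Z R P = (\<Union>r\<in>R. \<Union>p\<in>P. chu_equiv C X Z `` {Cmp (ChuCon C) X Y Z r p})"
  "Leq (BChu C) X Y P R \<longleftrightarrow> (\<exists>p\<in>P. \<exists>r\<in>R. p \<squnion>\<^bsub>hom_lat (ChuCon C) X Y\<^esub> r \<in> R)"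
  by (simp_all add: BChu_def quotient_qtld_def)

lemma chu_equiv_Image:
  assumes "(u, v) \<in> chu_connections C (X1, Y1, f) (X2, Y2, g)"
  shows "chu_equiv C (X1, Y1, f) (X2, Y2, g) `` {(u, v)}
    = chu_class C (X1, Y1, f) (X2, Y2, g) (lres C X1 X2 Y1 f u)"
  using assms by auto

lemma Hom_BChu:
  "Hom (BChu C) (X1, Y1, f) (X2, Y2, g) =
    {chu_class C (X1, Y1, f) (X2, Y2, g) (lres C X1 X2 Y1 f u) | u v.
      (u, v) \<in> chu_connections C (X1, Y1, f) (X2, Y2, g)}" (is "?l = ?r")
proof -
  have "?l = (\<Union>(u, v)\<in>chu_connections C (X1, Y1, f) (X2, Y2, g).
      {chu_equiv C (X1, Y1, f) (X2, Y2, g) `` {(u, v)}})"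
    unfolding BChu_simps quotient_def by auto
  also have "\<dots> = (\<Union>(u, v)\<in>chu_connections C (X1, Y1, f) (X2, Y2, g).
      {chu_class C (X1, Y1, f) (X2, Y2, g) (lres C X1 X2 Y1 f u)})"
    by (intro SUP_cong refl)
      (simp only: split_paired_all prod.case chu_equiv_Image)
  also have "\<dots> = ?r" by (auto simp del: chu_class.simps)
  finally show ?thesis .
qed

lemma chu_class_eq_iff:
  assumes "(u, v) \<in> chu_connections C (X1, Y1, f) (X2, Y2, g)"
  shows "chu_class C (X1, Y1, f) (X2, Y2, g) (lres C X1 X2 Y1 f u)
    = chu_class C (X1, Y1, f) (X2, Y2, g) w \<longleftrightarrow> lres C X1 X2 Y1 f u = w"
proof
  assume eq: "chu_class C (X1, Y1, f) (X2, Y2, g) (lres C X1 X2 Y1 f u)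
    = chu_class C (X1, Y1, f) (X2, Y2, g) w"
  have "(u, v) \<in> chu_class C (X1, Y1, f) (X2, Y2, g) (lres C X1 X2 Y1 f u)" using assms by simp
  then show "lres C X1 X2 Y1 f u = w" unfolding eq by auto
qed simp

context quantaloid
begin

lemma BChu_ObE:
  assumes "P \<in> Ob (BChu C)"
  obtains X Y f where "P = (X, Y, f)" "X \<in> Ob C" "Y \<in> Ob C" "f \<in> Hom C X Y"
  using assms by (cases P) (auto simp: BChu_simps(1))

lemma Ide_chu:
  assumes "X \<in> Ob C" "Y \<in> Ob C" "f \<in> Hom C X Y"
  shows "(Ide C X, Ide C Y) \<in> chu_connections C (X, Y, f) (X, Y, f)"
  using assms by (simp add: Ide_closed lres_Ide rres_Ide)

context
  fixes X1 Y1 f1 X2 Y2 f2 X3 Y3 f3 u v u' v'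
  assumes o: "X1 \<in> Ob C" "Y1 \<in> Ob C" "X2 \<in> Ob C" "Y2 \<in> Ob C" "X3 \<in> Ob C" "Y3 \<in> Ob C"
    and f: "f1 \<in> Hom C X1 Y1" "f2 \<in> Hom C X2 Y2" "f3 \<in> Hom C X3 Y3"
    and p: "(u, v) \<in> chu_connections C (X1, Y1, f1) (X2, Y2, f2)"
    and r: "(u', v') \<in> chu_connections C (X2, Y2, f2) (X3, Y3, f3)"
begin

text \<open>The bond of a composite depends on the first factor through its bond only, and on the second
  factor through its bond only; hence composition of classes is well defined.\<close>

lemma lres_Cmp_chu_left:
  "lres C X1 X3 Y1 f1 (Cmp C X1 X2 X3 u' u) = lres C X2 X3 Y1 (lres C X1 X2 Y1 f1 u) u'"
  using o f p r by (simp add: lres_Cmp)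

lemma lres_Cmp_chu_right:
  "lres C X1 X3 Y1 f1 (Cmp C X1 X2 X3 u' u) = rres C X3 Y1 Y2 v (lres C X2 X3 Y2 f2 u')"
  using o f p r by (simp add: lres_Cmp lres_rres_commute)

lemma Cmp_chu:
  "(Cmp C X1 X2 X3 u' u, Cmp C Y1 Y2 Y3 v' v) \<in> chu_connections C (X1, Y1, f1) (X3, Y3, f3)"
  using o f p r lres_Cmp_chu_right by (simp add: Cmp_closed rres_Cmp)

end

lemma Cmp_BChu:
  assumes o: "X1 \<in> Ob C" "Y1 \<in> Ob C" "X2 \<in> Ob C" "Y2 \<in> Ob C" "X3 \<in> Ob C" "Y3 \<in> Ob C"
    and f: "f1 \<in> Hom C X1 Y1" "f2 \<in> Hom C X2 Y2" "f3 \<in> Hom C X3 Y3"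
    and p: "(u, v) \<in> chu_connections C (X1, Y1, f1) (X2, Y2, f2)" "lres C X1 X2 Y1 f1 u = w"
    and r: "(u', v') \<in> chu_connections C (X2, Y2, f2) (X3, Y3, f3)" "lres C X2 X3 Y2 f2 u' = w'"
  shows "Cmp (BChu C) (X1, Y1, f1) (X2, Y2, f2) (X3, Y3, f3)
      (chu_class C (X2, Y2, f2) (X3, Y3, f3) w') (chu_class C (X1, Y1, f1) (X2, Y2, f2) w)
    = chu_class C (X1, Y1, f1) (X3, Y3, f3) (lres C X1 X3 Y1 f1 (Cmp C X1 X2 X3 u' u))"
    (is "?l = ?K")
proof -
  let ?R = "chu_class C (X2, Y2, f2) (X3, Y3, f3) w'" and ?P = "chu_class C (X1, Y1, f1) (X2, Y2, f2) w"
  have *: "chu_equiv C (X1, Y1, f1) (X3, Y3, f3) `` {Cmp (ChuCon C) (X1, Y1, f1) (X2, Y2, f2) (X3, Y3, f3) b a}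
      = ?K" if b: "b \<in> ?R" and a: "a \<in> ?P" for a b
  proof -
    obtain s t s' t' where ab: "a = (s, t)" "b = (s', t')" by (cases a, cases b)
    have a': "(s, t) \<in> chu_connections C (X1, Y1, f1) (X2, Y2, f2)" "lres C X1 X2 Y1 f1 s = w"
      and b': "(s', t') \<in> chu_connections C (X2, Y2, f2) (X3, Y3, f3)" "lres C X2 X3 Y2 f2 s' = w'"
      using a b ab by auto
    have "lres C X1 X3 Y1 f1 (Cmp C X1 X2 X3 s' s) = lres C X2 X3 Y1 w s'"
      using lres_Cmp_chu_left[OF o f a'(1) b'(1)] a'(2) by simp
    also have "\<dots> = lres C X1 X3 Y1 f1 (Cmp C X1 X2 X3 s' u)"
      using lres_Cmp_chu_left[OF o f p(1) b'(1)] p(2) by simp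
    also have "\<dots> = rres C X3 Y1 Y2 v w'"
      using lres_Cmp_chu_right[OF o f p(1) b'(1)] b'(2) by simp
    also have "\<dots> = lres C X1 X3 Y1 f1 (Cmp C X1 X2 X3 u' u)"
      using lres_Cmp_chu_right[OF o f p(1) r(1)] r(2) by simp
    finally show ?thesis
      using chu_equiv_Image[OF Cmp_chu[OF o f a'(1) b'(1)]] ab by simp
  qed
  have "(u, v) \<in> ?P" "(u', v') \<in> ?R" using p r by auto
  then have "(\<Union>b\<in>?R. \<Union>a\<in>?P. ?K) = ?K" by blast
  moreover have "?l = (\<Union>b\<in>?R. \<Union>a\<in>?P. ?K)"
    unfolding BChu_simps by (intro SUP_cong refl *)
  ultimately show ?thesis by simp
qed

lemma Ide_BChu:
  assumes "X \<in> Ob C" "Y \<in> Ob C" "f \<in> Hom C X Y"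
  shows "Ide (BChu C) (X, Y, f) = chu_class C (X, Y, f) (X, Y, f) f"
  unfolding BChu_simps
  using chu_equiv_Image[OF Ide_chu[OF assms]] assms by (simp add: lres_Ide)

lemma ordered_homs_ChuCon: "ordered_homs (ChuCon C)"
proof
  fix P R a assume "P \<in> Ob (ChuCon C)" "R \<in> Ob (ChuCon C)" "a \<in> Hom (ChuCon C) P R"
  then show "Leq (ChuCon C) P R a a"
    by (cases P, cases R, cases a) (auto simp: Leq_refl)
next
  fix P R a b
  assume "P \<in> Ob (ChuCon C)" "R \<in> Ob (ChuCon C)" "a \<in> Hom (ChuCon C) P R" "b \<in> Hom (ChuCon C) P R"
    "Leq (ChuCon C) P R a b" "Leq (ChuCon C) P R b a"
  then show "a = b"
    by (cases P, cases R, cases a, cases b) (auto dest: Leq_antisym)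
next
  fix P R a b c
  assume "P \<in> Ob (ChuCon C)" "R \<in> Ob (ChuCon C)" "a \<in> Hom (ChuCon C) P R" "b \<in> Hom (ChuCon C) P R"
    "c \<in> Hom (ChuCon C) P R" "Leq (ChuCon C) P R a b" "Leq (ChuCon C) P R b c"
  then show "Leq (ChuCon C) P R a c"
    by (cases P, cases R, cases a, cases b, cases c) (auto intro: Leq_trans)
qed

context
  fixes X1 Y1 f X2 Y2 g
  assumes o: "X1 \<in> Ob C" "Y1 \<in> Ob C" "X2 \<in> Ob C" "Y2 \<in> Ob C"
    and f: "f \<in> Hom C X1 Y1" and g: "g \<in> Hom C X2 Y2"
begin

abbreviation (input) connections :: "('a \<times> 'a) set" where
  "connections \<equiv> chu_connections C (X1, Y1, f) (X2, Y2, g)"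

abbreviation (input) bond :: "'a \<Rightarrow> 'a" where
  "bond u \<equiv> lres C X1 X2 Y1 f u"

text \<open>Residuation sends suprema to infima in either component.  A componentwise supremum of Chu
  connections is therefore again one, and its bond is the infimum of their bonds.\<close>

definition chu_sup :: "('a \<times> 'a) set \<Rightarrow> 'a \<times> 'a" where
  "chu_sup T = (\<Squnion>\<^bsub>hom_lat C X1 X2\<^esub> (fst ` T), \<Squnion>\<^bsub>hom_lat C Y1 Y2\<^esub> (snd ` T))"

lemma bond_Hom: "(u, v) \<in> connections \<Longrightarrow> bond u \<in> Hom C X2 Y1"
  using o f lres_closed[of X1 X2 Y1 u f] by auto

lemma chu_sup:
  assumes T: "T \<subseteq> connections"
  shows "chu_sup T \<in> connections"
    and "h \<in> Hom C X2 Y1 \<Longrightarrow>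
      Leq C X2 Y1 h (bond (fst (chu_sup T))) \<longleftrightarrow> (\<forall>p\<in>T. Leq C X2 Y1 h (bond (fst p)))"
proof -
  let ?u = "\<Squnion>\<^bsub>hom_lat C X1 X2\<^esub> (fst ` T)" and ?v = "\<Squnion>\<^bsub>hom_lat C Y1 Y2\<^esub> (snd ` T)"
  have U: "fst ` T \<subseteq> Hom C X1 X2" and V: "snd ` T \<subseteq> Hom C Y1 Y2" using T by auto
  have u: "?u \<in> Hom C X1 X2" and v: "?v \<in> Hom C Y1 Y2" using sup_closed o U V by simp_all
  have le_u: "Leq C X2 Y1 h (bond ?u) \<longleftrightarrow> (\<forall>p\<in>T. Leq C X2 Y1 h (bond (fst p)))"
    if h: "h \<in> Hom C X2 Y1" for h
    using Cmp_sup_right_Leq_iff[OF o(1,3,2) U h f] o f u h subsetD[OF U]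
    by (auto simp: Leq_lres_iff)
  have le_v: "Leq C X2 Y1 h (rres C X2 Y1 Y2 ?v g) \<longleftrightarrow> (\<forall>p\<in>T. Leq C X2 Y1 h (rres C X2 Y1 Y2 (snd p) g))"
    if h: "h \<in> Hom C X2 Y1" for h
    using Cmp_sup_left_Leq_iff[OF o(3,2,4) V h g] o g v h subsetD[OF V]
    by (auto simp: Leq_rres_iff)
  have eq: "bond (fst p) = rres C X2 Y1 Y2 (snd p) g" if "p \<in> T" for p
    using subsetD[OF T that] by (cases p) auto
  have "bond ?u = rres C X2 Y1 Y2 ?v g"
    by (rule Leq_eqI[of X2 Y1]) (use o f g u v in \<open>simp_all add: lres_closed rres_closed le_u le_v eq\<close>)
  then show "chu_sup T \<in> connections" using u v by (simp add: chu_sup_def)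
  show "h \<in> Hom C X2 Y1 \<Longrightarrow>
      Leq C X2 Y1 h (bond (fst (chu_sup T))) \<longleftrightarrow> (\<forall>p\<in>T. Leq C X2 Y1 h (bond (fst p)))"
    by (simp add: chu_sup_def le_u)
qed

lemma is_supremum_chu_sup:
  assumes T: "T \<subseteq> connections"
  shows "is_supremum (ChuCon C) (X1, Y1, f) (X2, Y2, g) T (chu_sup T)"
proof -
  have U: "fst ` T \<subseteq> Hom C X1 X2" and V: "snd ` T \<subseteq> Hom C Y1 Y2" using T by auto
  have Leq: "Leq (ChuCon C) (X1, Y1, f) (X2, Y2, g) p t
      \<longleftrightarrow> Leq C X1 X2 (fst p) (fst t) \<and> Leq C Y1 Y2 (snd p) (snd t)" for p t
    by (cases p, cases t) simp
  have "Leq (ChuCon C) (X1, Y1, f) (X2, Y2, g) (chu_sup T) t \<longleftrightarrow>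
      (\<forall>p\<in>T. Leq (ChuCon C) (X1, Y1, f) (X2, Y2, g) p t)" if "t \<in> connections" for t
    using that o sup_Leq_iff[OF _ _ U, of "fst t"] sup_Leq_iff[OF _ _ V, of "snd t"]
    by (cases t) (simp add: Leq chu_sup_def ball_conj_distrib)
  then show ?thesis unfolding is_supremum_def using chu_sup(1)[OF T] by simp
qed

lemma join_ChuCon:
  assumes "p \<in> connections" "r \<in> connections"
  shows "p \<squnion>\<^bsub>hom_lat (ChuCon C) (X1, Y1, f) (X2, Y2, g)\<^esub> r = chu_sup {p, r}"
  unfolding join_def
  by (rule ordered_homs.sup_eq_if_is_supremum[OF ordered_homs_ChuCon])
    (use o f g assms in \<open>simp_all add: is_supremum_chu_sup del: chu_connections.simps\<close>)

text \<open>The join of two classes has as its bond the infimum of the two bonds, so that it equals the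
  second class if and only if the second bond is the smaller one.\<close>

lemma Leq_BChu_iff:
  assumes p: "(u, v) \<in> connections" "bond u = w" and r: "(u', v') \<in> connections" "bond u' = w'"
  shows "Leq (BChu C) (X1, Y1, f) (X2, Y2, g) (chu_class C (X1, Y1, f) (X2, Y2, g) w)
      (chu_class C (X1, Y1, f) (X2, Y2, g) w') \<longleftrightarrow> Leq C X2 Y1 w' w"
proof -
  have w: "w \<in> Hom C X2 Y1" "w' \<in> Hom C X2 Y1" using bond_Hom p r by auto
  have *: "a \<squnion>\<^bsub>hom_lat (ChuCon C) (X1, Y1, f) (X2, Y2, g)\<^esub> b
      \<in> chu_class C (X1, Y1, f) (X2, Y2, g) w' \<longleftrightarrow> Leq C X2 Y1 w' w"
    if a: "a \<in> chu_class C (X1, Y1, f) (X2, Y2, g) w" and b: "b \<in> chu_class C (X1, Y1, f) (X2, Y2, g) w'"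
    for a b
  proof -
    have ab: "a \<in> connections" "bond (fst a) = w" "b \<in> connections" "bond (fst b) = w'"
      using a b by auto
    let ?s = "chu_sup {a, b}"
    have s: "?s \<in> connections" using chu_sup(1)[of "{a, b}"] ab by blast
    then have sw: "bond (fst ?s) \<in> Hom C X2 Y1" using bond_Hom by (metis prod.collapse)
    have le: "Leq C X2 Y1 h (bond (fst ?s)) \<longleftrightarrow> Leq C X2 Y1 h w \<and> Leq C X2 Y1 h w'"
      if "h \<in> Hom C X2 Y1" for h
      using chu_sup(2)[of "{a, b}" h] ab that by (simp del: chu_connections.simps)
    have "?s \<in> chu_class C (X1, Y1, f) (X2, Y2, g) w' \<longleftrightarrow> bond (fst ?s) = w'"
      using s by (cases ?s) auto
    also have "\<dots> \<longleftrightarrow> Leq C X2 Y1 w' w"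
      using le[OF sw] le[OF w(2)] Leq_refl[OF o(3,2)] Leq_antisym[OF o(3,2) sw w(2)] sw w by blast
    finally show ?thesis using join_ChuCon ab by simp
  qed
  have "(u, v) \<in> chu_class C (X1, Y1, f) (X2, Y2, g) w" "(u', v') \<in> chu_class C (X1, Y1, f) (X2, Y2, g) w'"
    using p r by auto
  then show ?thesis unfolding BChu_simps using * by blast
qed

text \<open>In terms of bonds, a supremum of classes is an infimum.\<close>

lemma is_supremum_BChu:
  assumes T: "T \<subseteq> connections" and s: "(u, v) \<in> connections"
    and le: "\<And>h. h \<in> Hom C X2 Y1 \<Longrightarrow>
      Leq C X2 Y1 h (bond u) \<longleftrightarrow> (\<forall>p\<in>T. Leq C X2 Y1 h (bond (fst p)))"
  shows "is_supremum (BChu C) (X1, Y1, f) (X2, Y2, g)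
    ((\<lambda>p. chu_class C (X1, Y1, f) (X2, Y2, g) (bond (fst p))) ` T)
    (chu_class C (X1, Y1, f) (X2, Y2, g) (bond u))"
  unfolding is_supremum_def
proof (intro conjI ballI)
  show "chu_class C (X1, Y1, f) (X2, Y2, g) (bond u) \<in> Hom (BChu C) (X1, Y1, f) (X2, Y2, g)"
    unfolding Hom_BChu using s by blast
  fix t assume "t \<in> Hom (BChu C) (X1, Y1, f) (X2, Y2, g)"
  then obtain a b where ab: "(a, b) \<in> connections" and t: "t = chu_class C (X1, Y1, f) (X2, Y2, g) (bond a)"
    unfolding Hom_BChu by blast
  have "Leq (BChu C) (X1, Y1, f) (X2, Y2, g) (chu_class C (X1, Y1, f) (X2, Y2, g) (bond (fst p))) t
      \<longleftrightarrow> Leq C X2 Y1 (bond a) (bond (fst p))" if "p \<in> T" for p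
    unfolding t using Leq_BChu_iff[OF _ refl ab refl, of "fst p" "snd p"] subsetD[OF T that] by simp
  moreover have "Leq (BChu C) (X1, Y1, f) (X2, Y2, g) (chu_class C (X1, Y1, f) (X2, Y2, g) (bond u)) t
      \<longleftrightarrow> Leq C X2 Y1 (bond a) (bond u)"
    unfolding t using Leq_BChu_iff[OF s refl ab refl] .
  ultimately show "Leq (BChu C) (X1, Y1, f) (X2, Y2, g) (chu_class C (X1, Y1, f) (X2, Y2, g) (bond u)) t
    \<longleftrightarrow> (\<forall>p\<in>(\<lambda>p. chu_class C (X1, Y1, f) (X2, Y2, g) (bond (fst p))) ` T.
         Leq (BChu C) (X1, Y1, f) (X2, Y2, g) p t)"
    using le[OF bond_Hom[OF ab]] by (simp del: chu_class.simps)
qed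

end

lemma category_BChu: "category (BChu C)"
proof
  fix X assume "X \<in> Ob (BChu C)"
  then obtain X1 Y1 f where X: "X = (X1, Y1, f)" "X1 \<in> Ob C" "Y1 \<in> Ob C" "f \<in> Hom C X1 Y1"
    by (elim BChu_ObE)
  then show "Ide (BChu C) X \<in> Hom (BChu C) X X"
    using Ide_chu[OF X(2-4)] lres_Ide[OF X(2-4)] unfolding X(1) Hom_BChu
    by (simp add: Ide_BChu del: chu_class.simps chu_connections.simps) metis
next
  fix X Y Z p r
  assume "X \<in> Ob (BChu C)" "Y \<in> Ob (BChu C)" "Z \<in> Ob (BChu C)"
    and p: "p \<in> Hom (BChu C) X Y" and r: "r \<in> Hom (BChu C) Y Z"
  then obtain X1 Y1 f1 X2 Y2 f2 X3 Y3 f3 where X: "X = (X1, Y1, f1)" "Y = (X2, Y2, f2)" "Z = (X3, Y3, f3)"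
    and o: "X1 \<in> Ob C" "Y1 \<in> Ob C" "X2 \<in> Ob C" "Y2 \<in> Ob C" "X3 \<in> Ob C" "Y3 \<in> Ob C"
    and f: "f1 \<in> Hom C X1 Y1" "f2 \<in> Hom C X2 Y2" "f3 \<in> Hom C X3 Y3"
    by (elim BChu_ObE)
  obtain u v where uv: "(u, v) \<in> chu_connections C X Y" "p = chu_class C X Y (lres C X1 X2 Y1 f1 u)"
    using p unfolding X Hom_BChu by blast
  obtain u' v' where uv': "(u', v') \<in> chu_connections C Y Z" "r = chu_class C Y Z (lres C X2 X3 Y2 f2 u')"
    using r unfolding X Hom_BChu by blast
  show "Cmp (BChu C) X Y Z r p \<in> Hom (BChu C) X Z"
    using Cmp_BChu[OF o f uv(1)[unfolded X] refl uv'(1)[unfolded X] refl]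
      Cmp_chu[OF o f uv(1)[unfolded X] uv'(1)[unfolded X]]
    unfolding uv(2) uv'(2) X Hom_BChu by blast
next
  fix X Y p
  assume "X \<in> Ob (BChu C)" "Y \<in> Ob (BChu C)" and p: "p \<in> Hom (BChu C) X Y"
  then obtain X1 Y1 f1 X2 Y2 f2 where X: "X = (X1, Y1, f1)" "Y = (X2, Y2, f2)"
    and o: "X1 \<in> Ob C" "Y1 \<in> Ob C" "X2 \<in> Ob C" "Y2 \<in> Ob C"
    and f: "f1 \<in> Hom C X1 Y1" "f2 \<in> Hom C X2 Y2"
    by (elim BChu_ObE)
  obtain u v where uv: "(u, v) \<in> chu_connections C X Y" "p = chu_class C X Y (lres C X1 X2 Y1 f1 u)"
    using p unfolding X Hom_BChu by blast
  have u: "u \<in> Hom C X1 X2" using uv X by simp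
  show "Cmp (BChu C) X X Y p (Ide (BChu C) X) = p"
    using Cmp_BChu[OF o(1,2) o f(1) f Ide_chu[OF o(1,2) f(1)] lres_Ide[OF o(1,2) f(1)] uv(1)[unfolded X] refl]
      o f u
    unfolding uv(2) X by (simp add: Ide_BChu Cmp_Ide_right del: chu_class.simps)
  show "Cmp (BChu C) X Y Y (Ide (BChu C) Y) p = p"
    using Cmp_BChu[OF o o(3,4) f f(2) uv(1)[unfolded X] refl Ide_chu[OF o(3,4) f(2)] lres_Ide[OF o(3,4) f(2)]]
      o f u
    unfolding uv(2) X by (simp add: Ide_BChu Cmp_Ide_left del: chu_class.simps)
next
  fix W X Y Z p r s
  assume "W \<in> Ob (BChu C)" "X \<in> Ob (BChu C)" "Y \<in> Ob (BChu C)" "Z \<in> Ob (BChu C)"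
    and p: "p \<in> Hom (BChu C) W X" and r: "r \<in> Hom (BChu C) X Y" and s: "s \<in> Hom (BChu C) Y Z"
  then obtain X0 Y0 f0 X1 Y1 f1 X2 Y2 f2 X3 Y3 f3
    where X: "W = (X0, Y0, f0)" "X = (X1, Y1, f1)" "Y = (X2, Y2, f2)" "Z = (X3, Y3, f3)"
    and o: "X0 \<in> Ob C" "Y0 \<in> Ob C" "X1 \<in> Ob C" "Y1 \<in> Ob C" "X2 \<in> Ob C" "Y2 \<in> Ob C" "X3 \<in> Ob C" "Y3 \<in> Ob C"
    and f: "f0 \<in> Hom C X0 Y0" "f1 \<in> Hom C X1 Y1" "f2 \<in> Hom C X2 Y2" "f3 \<in> Hom C X3 Y3"
    by (elim BChu_ObE)
  obtain u v where p: "(u, v) \<in> chu_connections C W X" "p = chu_class C W X (lres C X0 X1 Y0 f0 u)"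
    using p unfolding X Hom_BChu by blast
  obtain u' v' where r: "(u', v') \<in> chu_connections C X Y" "r = chu_class C X Y (lres C X1 X2 Y1 f1 u')"
    using r unfolding X Hom_BChu by blast
  obtain u'' v'' where s: "(u'', v'') \<in> chu_connections C Y Z" "s = chu_class C Y Z (lres C X2 X3 Y2 f2 u'')"
    using s unfolding X Hom_BChu by blast
  note p1 = p(1)[unfolded X] and r1 = r(1)[unfolded X] and s1 = s(1)[unfolded X]
  have u: "u \<in> Hom C X0 X1" "u' \<in> Hom C X1 X2" "u'' \<in> Hom C X2 X3" using p1 r1 s1 by simp_all
  have sr: "(Cmp C X1 X2 X3 u'' u', Cmp C Y1 Y2 Y3 v'' v') \<in> chu_connections C (X1, Y1, f1) (X3, Y3, f3)"
    by (rule Cmp_chu[OF o(3-8) f(2-4) r1 s1])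
  have rp: "(Cmp C X0 X1 X2 u' u, Cmp C Y0 Y1 Y2 v' v) \<in> chu_connections C (X0, Y0, f0) (X2, Y2, f2)"
    by (rule Cmp_chu[OF o(1-6) f(1-3) p1 r1])
  have "Cmp (BChu C) W X Z (Cmp (BChu C) X Y Z s r) p =
      chu_class C W Z (lres C X0 X3 Y0 f0 (Cmp C X0 X1 X3 (Cmp C X1 X2 X3 u'' u') u))"
    unfolding p(2) r(2) s(2) X
    by (simp only: Cmp_BChu[OF o(3-8) f(2-4) r1 refl s1 refl]
      Cmp_BChu[OF o(1-4,7,8) f(1,2,4) p1 refl sr refl])
  moreover have "Cmp (BChu C) W Y Z s (Cmp (BChu C) W X Y r p) =
      chu_class C W Z (lres C X0 X3 Y0 f0 (Cmp C X0 X2 X3 u'' (Cmp C X0 X1 X2 u' u)))"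
    unfolding p(2) r(2) s(2) X
    by (simp only: Cmp_BChu[OF o(1-6) f(1-3) p1 refl r1 refl]
      Cmp_BChu[OF o(1,2,5-8) f(1,3,4) rp refl s1 refl])
  ultimately show "Cmp (BChu C) W X Z (Cmp (BChu C) X Y Z s r) p = Cmp (BChu C) W Y Z s (Cmp (BChu C) W X Y r p)"
    using o u by (simp add: Cmp_assoc)
qed

text \<open>Taking bonds identifies a hom of the quotient with a part of a hom of \<open>C\<close>, the order being
  reversed.\<close>

lemma ordered_homs_BChu: "ordered_homs (BChu C)"
proof -
  have *: "\<exists>X1 Y1 f X2 Y2 g. P = (X1, Y1, f) \<and> R = (X2, Y2, g) \<and> X2 \<in> Ob C \<and> Y1 \<in> Ob C \<and>
      (\<forall>a\<in>Hom (BChu C) P R. \<exists>w\<in>Hom C X2 Y1. a = chu_class C P R w) \<and>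
      (\<forall>w w'. chu_class C P R w \<in> Hom (BChu C) P R \<longrightarrow> chu_class C P R w' \<in> Hom (BChu C) P R \<longrightarrow>
        w \<in> Hom C X2 Y1 \<longrightarrow> w' \<in> Hom C X2 Y1 \<longrightarrow>
         (Leq (BChu C) P R (chu_class C P R w) (chu_class C P R w') \<longleftrightarrow> Leq C X2 Y1 w' w))"
    if PR: "P \<in> Ob (BChu C)" "R \<in> Ob (BChu C)" for P R
  proof -
    obtain X1 Y1 f X2 Y2 g where P: "P = (X1, Y1, f)" "R = (X2, Y2, g)"
      and o: "X1 \<in> Ob C" "Y1 \<in> Ob C" "X2 \<in> Ob C" "Y2 \<in> Ob C"
      and f: "f \<in> Hom C X1 Y1" "g \<in> Hom C X2 Y2"
      using PR by (elim BChu_ObE)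
    have "\<exists>w\<in>Hom C X2 Y1. a = chu_class C P R w" if "a \<in> Hom (BChu C) P R" for a
      using that bond_Hom[OF o f] unfolding P Hom_BChu by blast
    moreover have "Leq (BChu C) P R (chu_class C P R w) (chu_class C P R w') \<longleftrightarrow> Leq C X2 Y1 w' w"
      if cl: "chu_class C P R w \<in> Hom (BChu C) P R" "chu_class C P R w' \<in> Hom (BChu C) P R" for w w'
    proof -
      obtain u v where p: "(u, v) \<in> chu_connections C (X1, Y1, f) (X2, Y2, g)" "lres C X1 X2 Y1 f u = w"
        using cl(1) chu_class_eq_iff unfolding P Hom_BChu by (smt (verit, best) mem_Collect_eq)
      obtain u' v' where r: "(u', v') \<in> chu_connections C (X1, Y1, f) (X2, Y2, g)" "lres C X1 X2 Y1 f u' = w'"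
        using cl(2) chu_class_eq_iff unfolding P Hom_BChu by (smt (verit, best) mem_Collect_eq)
      show ?thesis unfolding P by (rule Leq_BChu_iff[OF o f p r])
    qed
    ultimately show ?thesis using P o by blast
  qed
  show ?thesis
  proof
    fix P R a assume "P \<in> Ob (BChu C)" "R \<in> Ob (BChu C)" "a \<in> Hom (BChu C) P R"
    then show "Leq (BChu C) P R a a" using *[of P R] Leq_refl by metis
  next
    fix P R a b
    assume "P \<in> Ob (BChu C)" "R \<in> Ob (BChu C)" "a \<in> Hom (BChu C) P R" "b \<in> Hom (BChu C) P R"
      "Leq (BChu C) P R a b" "Leq (BChu C) P R b a"
    then show "a = b" using *[of P R] Leq_antisym by metis
  next
    fix P R a b c
    assume "P \<in> Ob (BChu C)" "R \<in> Ob (BChu C)" "a \<in> Hom (BChu C) P R" "b \<in> Hom (BChu C) P R"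
      "c \<in> Hom (BChu C) P R" "Leq (BChu C) P R a b" "Leq (BChu C) P R b c"
    then show "Leq (BChu C) P R a c" using *[of P R] Leq_trans by metis
  qed
qed

text \<open>The supremum of a set of classes is represented by the supremum of all Chu connections that
  belong to them.  Its composites with a fixed class have the required bonds because composition
  in \<open>C\<close> preserves suprema.\<close>

theorem quantaloid_BChu: "quantaloid (BChu C)"
proof (rule quantaloidI[OF category_BChu ordered_homs_BChu])
  fix P R S assume "P \<in> Ob (BChu C)" "R \<in> Ob (BChu C)" and S: "S \<subseteq> Hom (BChu C) P R"
  then obtain X1 Y1 f X2 Y2 g where P: "P = (X1, Y1, f)" "R = (X2, Y2, g)"
    and o: "X1 \<in> Ob C" "Y1 \<in> Ob C" "X2 \<in> Ob C" "Y2 \<in> Ob C"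
    and f: "f \<in> Hom C X1 Y1" "g \<in> Hom C X2 Y2"
    by (elim BChu_ObE)
  let ?c = "\<lambda>p. chu_class C P R (lres C X1 X2 Y1 f (fst p))"
  define T where "T = {p \<in> chu_connections C P R. ?c p \<in> S}"
  have T: "T \<subseteq> chu_connections C P R" unfolding T_def by blast
  have S_eq: "S = ?c ` T"
  proof (intro equalityI subsetI)
    fix a assume a: "a \<in> S"
    then obtain u v where "(u, v) \<in> chu_connections C P R" "a = ?c (u, v)"
      using subsetD[OF S a] unfolding P Hom_BChu by auto
    then have "(u, v) \<in> T" using a by (simp add: T_def)
    then show "a \<in> ?c ` T" using \<open>a = ?c (u, v)\<close> by blast
  qed (auto simp: T_def)
  define u where "u = \<Squnion>\<^bsub>hom_lat C X1 X2\<^esub> (fst ` T)"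
  define v where "v = \<Squnion>\<^bsub>hom_lat C Y1 Y2\<^esub> (snd ` T)"
  note T' = T[unfolded P]
  have s: "(u, v) \<in> chu_connections C P R"
    using chu_sup(1)[OF o f T'] unfolding chu_sup_def[OF o f] P u_def v_def .
  note s' = s[unfolded P]
  have U: "fst ` T \<subseteq> Hom C X1 X2" using T' by auto
  have u: "u \<in> Hom C X1 X2" using s' by simp
  have le: "Leq C X2 Y1 h (lres C X1 X2 Y1 f u) \<longleftrightarrow> (\<forall>p\<in>T. Leq C X2 Y1 h (lres C X1 X2 Y1 f (fst p)))"
    if "h \<in> Hom C X2 Y1" for h
    using chu_sup(2)[OF o f T' that] unfolding chu_sup_def[OF o f] u_def by simp
  show "\<exists>s. is_supremum (BChu C) P R S s \<and>
        (\<forall>Z\<in>Ob (BChu C). \<forall>g\<in>Hom (BChu C) R Z.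
          is_supremum (BChu C) P Z (Cmp (BChu C) P R Z g ` S) (Cmp (BChu C) P R Z g s)) \<and>
        (\<forall>W\<in>Ob (BChu C). \<forall>g\<in>Hom (BChu C) W P.
           is_supremum (BChu C) W R ((\<lambda>f. Cmp (BChu C) W P R f g) ` S) (Cmp (BChu C) W P R s g))"
  proof (intro exI[of _ "?c (u, v)"] conjI ballI)
    show "is_supremum (BChu C) P R S (?c (u, v))"
      unfolding S_eq P using is_supremum_BChu[OF o f T' s' le] by simp
  next
    fix Z k assume "Z \<in> Ob (BChu C)" and k: "k \<in> Hom (BChu C) R Z"
    then obtain X3 Y3 h where Z: "Z = (X3, Y3, h)" and o': "X3 \<in> Ob C" "Y3 \<in> Ob C" "h \<in> Hom C X3 Y3"
      by (elim BChu_ObE)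
    obtain a b where ab: "(a, b) \<in> chu_connections C (X2, Y2, g) (X3, Y3, h)"
      and k: "k = chu_class C R Z (lres C X2 X3 Y2 g a)"
      using k unfolding P Z Hom_BChu by blast
    have a: "a \<in> Hom C X2 X3" using ab by simp
    let ?d = "\<lambda>p. (Cmp C X1 X2 X3 a (fst p), Cmp C Y1 Y2 Y3 b (snd p))"
    have d: "?d p \<in> chu_connections C (X1, Y1, f) (X3, Y3, h)"
      and Cmp_eq: "Cmp (BChu C) P R Z k (?c p) = chu_class C P Z (lres C X1 X3 Y1 f (fst (?d p)))"
      if p: "p \<in> chu_connections C (X1, Y1, f) (X2, Y2, g)" for p
    proof -
      have p': "(fst p, snd p) \<in> chu_connections C (X1, Y1, f) (X2, Y2, g)" using p by simp
      show "?d p \<in> chu_connections C (X1, Y1, f) (X3, Y3, h)"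
        by (rule Cmp_chu[OF o o'(1,2) f o'(3) p' ab])
      show "Cmp (BChu C) P R Z k (?c p) = chu_class C P Z (lres C X1 X3 Y1 f (fst (?d p)))"
        unfolding k P Z using Cmp_BChu[OF o o'(1,2) f o'(3) p' refl ab refl] by simp
    qed
    have dT: "?d ` T \<subseteq> chu_connections C (X1, Y1, f) (X3, Y3, h)" using d T' by blast
    have "is_supremum (BChu C) (X1, Y1, f) (X3, Y3, h)
      ((\<lambda>p. chu_class C (X1, Y1, f) (X3, Y3, h) (lres C X1 X3 Y1 f (fst p))) ` ?d ` T)
      (chu_class C (X1, Y1, f) (X3, Y3, h) (lres C X1 X3 Y1 f (fst (?d (u, v)))))"
      unfolding fst_conv
    proof (rule is_supremum_BChu[OF o(1,2) o'(1,2) f(1) o'(3) dT d[OF s', unfolded fst_conv]])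
      fix t assume t: "t \<in> Hom C X3 Y1"
      then show "Leq C X3 Y1 t (lres C X1 X3 Y1 f (Cmp C X1 X2 X3 a u))
          \<longleftrightarrow> (\<forall>p\<in>?d ` T. Leq C X3 Y1 t (lres C X1 X3 Y1 f (fst p)))"
        using le[of "Cmp C X2 X3 Y1 t a"] o o' a u f subsetD[OF U]
        by (auto simp: Leq_lres_iff Cmp_closed Cmp_assoc)
    qed
    moreover have "Cmp (BChu C) P R Z k ` S
        = (\<lambda>p. chu_class C P Z (lres C X1 X3 Y1 f (fst p))) ` ?d ` T"
      unfolding S_eq image_image by (intro image_cong refl Cmp_eq subsetD[OF T'])
    ultimately show "is_supremum (BChu C) P Z (Cmp (BChu C) P R Z k ` S) (Cmp (BChu C) P R Z k (?c (u, v)))"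
      using Cmp_eq[OF s'] unfolding P Z by simp
  next
    fix Z k assume "Z \<in> Ob (BChu C)" and k: "k \<in> Hom (BChu C) Z P"
    then obtain X3 Y3 h where Z: "Z = (X3, Y3, h)" and o': "X3 \<in> Ob C" "Y3 \<in> Ob C" "h \<in> Hom C X3 Y3"
      by (elim BChu_ObE)
    obtain a b where ab: "(a, b) \<in> chu_connections C (X3, Y3, h) (X1, Y1, f)"
      and k: "k = chu_class C Z P (lres C X3 X1 Y3 h a)"
      using k unfolding P Z Hom_BChu by blast
    have a: "a \<in> Hom C X3 X1" using ab by simp
    let ?d = "\<lambda>p. (Cmp C X3 X1 X2 (fst p) a, Cmp C Y3 Y1 Y2 (snd p) b)"
    have d: "?d p \<in> chu_connections C (X3, Y3, h) (X2, Y2, g)"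
      and Cmp_eq: "Cmp (BChu C) Z P R (?c p) k = chu_class C Z R (lres C X3 X2 Y3 h (fst (?d p)))"
      if p: "p \<in> chu_connections C (X1, Y1, f) (X2, Y2, g)" for p
    proof -
      have p': "(fst p, snd p) \<in> chu_connections C (X1, Y1, f) (X2, Y2, g)" using p by simp
      show "?d p \<in> chu_connections C (X3, Y3, h) (X2, Y2, g)"
        by (rule Cmp_chu[OF o'(1,2) o o'(3) f ab p'])
      show "Cmp (BChu C) Z P R (?c p) k = chu_class C Z R (lres C X3 X2 Y3 h (fst (?d p)))"
        unfolding k P Z using Cmp_BChu[OF o'(1,2) o o'(3) f ab refl p' refl] by simp
    qed
    have dT: "?d ` T \<subseteq> chu_connections C (X3, Y3, h) (X2, Y2, g)" using d T' by blast
    have "is_supremum (BChu C) (X3, Y3, h) (X2, Y2, g)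
      ((\<lambda>p. chu_class C (X3, Y3, h) (X2, Y2, g) (lres C X3 X2 Y3 h (fst p))) ` ?d ` T)
      (chu_class C (X3, Y3, h) (X2, Y2, g) (lres C X3 X2 Y3 h (fst (?d (u, v)))))"
      unfolding fst_conv
    proof (rule is_supremum_BChu[OF o'(1,2) o(3,4) o'(3) f(2) dT d[OF s', unfolded fst_conv]])
      fix t assume t: "t \<in> Hom C X2 Y3"
      have "Leq C X2 Y3 t (lres C X3 X2 Y3 h (Cmp C X3 X1 X2 u' a))
          \<longleftrightarrow> Leq C X1 Y3 (Cmp C X1 X2 Y3 t u') (lres C X3 X1 Y3 h a)" if "u' \<in> Hom C X1 X2" for u'
        using that o o' a t by (simp add: Leq_lres_iff Cmp_closed Cmp_assoc)
      then show "Leq C X2 Y3 t (lres C X3 X2 Y3 h (Cmp C X3 X1 X2 u a))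
          \<longleftrightarrow> (\<forall>p\<in>?d ` T. Leq C X2 Y3 t (lres C X3 X2 Y3 h (fst p)))"
        using Cmp_sup_right_Leq_iff[OF o(1,3) o'(2) U t lres_closed[OF o'(1) o(1) o'(2) a o'(3)]]
          u subsetD[OF U] unfolding u_def by auto
    qed
    moreover have "(\<lambda>p. Cmp (BChu C) Z P R p k) ` S
        = (\<lambda>p. chu_class C Z R (lres C X3 X2 Y3 h (fst p))) ` ?d ` T"
      unfolding S_eq image_image by (intro image_cong refl Cmp_eq subsetD[OF T'])
    ultimately show "is_supremum (BChu C) Z R ((\<lambda>p. Cmp (BChu C) Z P R p k) ` S) (Cmp (BChu C) Z P R (?c (u, v)) k)"
      using Cmp_eq[OF s'] unfolding P Z by simp
  qed
qed

text \<open>Two Chu connections are mutually inverse up to equivalence when their composites have the bonds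
  \<open>f\<close> and \<open>g\<close> of the identities.\<close>

lemma iso_arrow_BChuI:
  assumes o: "X1 \<in> Ob C" "Y1 \<in> Ob C" "X2 \<in> Ob C" "Y2 \<in> Ob C"
    and f: "f \<in> Hom C X1 Y1" "g \<in> Hom C X2 Y2"
    and p: "(u, v) \<in> chu_connections C (X1, Y1, f) (X2, Y2, g)"
    and r: "(u', v') \<in> chu_connections C (X2, Y2, g) (X1, Y1, f)"
    and rp: "lres C X1 X1 Y1 f (Cmp C X1 X2 X1 u' u) = f"
    and pr: "lres C X2 X2 Y2 g (Cmp C X2 X1 X2 u u') = g"
  shows "\<exists>a. iso_arrow (BChu C) (X1, Y1, f) (X2, Y2, g) a"
proof -
  let ?a = "chu_class C (X1, Y1, f) (X2, Y2, g) (lres C X1 X2 Y1 f u)"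
  let ?b = "chu_class C (X2, Y2, g) (X1, Y1, f) (lres C X2 X1 Y2 g u')"
  have "?a \<in> Hom (BChu C) (X1, Y1, f) (X2, Y2, g)" "?b \<in> Hom (BChu C) (X2, Y2, g) (X1, Y1, f)"
    unfolding Hom_BChu using p r by blast+
  moreover have "Cmp (BChu C) (X1, Y1, f) (X2, Y2, g) (X1, Y1, f) ?b ?a = Ide (BChu C) (X1, Y1, f)"
    using Cmp_BChu[OF o o(1,2) f f(1) p refl r refl] Ide_BChu[OF o(1,2) f(1)] rp by metis
  moreover have "Cmp (BChu C) (X2, Y2, g) (X1, Y1, f) (X2, Y2, g) ?a ?b = Ide (BChu C) (X2, Y2, g)"
    using Cmp_BChu[OF o(3,4) o f(2) f r refl p refl] Ide_BChu[OF o(3,4) f(2)] pr by metis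
  ultimately show ?thesis unfolding iso_arrow_def by blast
qed

end

lemma iso_arrow_opposite:
  assumes "iso_arrow C X Y a"
  shows "\<exists>b. iso_arrow (opposite C) X Y b"
  using assms unfolding iso_arrow_def by auto


section \<open>Full subquantaloids\<close>

lemma full_sub_simps [simp]:
  "Ob (full_sub C S) = Ob C \<inter> S"
  "Hom (full_sub C S) = Hom C"
  "Ide (full_sub C S) = Ide C"
  "Cmp (full_sub C S) = Cmp C"
  "Leq (full_sub C S) = Leq C"
  by (simp_all add: full_sub_def)

lemma order_embedding_id_if_full_sub:
  assumes "category C" "category D" "Ob C \<subseteq> Ob D" "Hom C = Hom D" "Ide C = Ide D"
    "Cmp C = Cmp D" "Leq C = Leq D"
  shows "order_embedding C D (\<lambda>X. X) (\<lambda>X Y f. f)"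
proof -
  interpret C: category C by fact
  interpret D: category D by fact
  show ?thesis using assms by unfold_locales (auto simp: bij_betw_def)
qed

lemma order_embedding_opposite:
  assumes "order_embedding C D Fo Fa"
  shows "order_embedding (opposite C) (opposite D) Fo (\<lambda>X Y. Fa Y X)"
proof -
  interpret order_embedding C D Fo Fa by fact
  show ?thesis
    by (intro order_embedding.intro cat_functor.intro category_opposite
        C.category_axioms D.category_axioms cat_functor_axioms.intro order_embedding_axioms.intro)
      (simp_all add: Fo_closed Fa_closed Fa_Ide Fa_Cmp Fa_bij Leq_Fa_iff)
qed

lemma category_full_sub:
  assumes "category C"
  shows "category (full_sub C S)"
proof -
  interpret category C by fact
  show ?thesis
    by unfold_locales (simp_all add: Ide_closed Cmp_closed Cmp_Ide_left Cmp_Ide_right Cmp_assoc)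
qed

lemma quantaloid_full_sub:
  assumes "quantaloid C"
  shows "quantaloid (full_sub C S)"
proof -
  interpret quantaloid C by fact
  have "order_embedding (full_sub C S) C (\<lambda>X. X) (\<lambda>X Y f. f)"
    by (rule order_embedding_id_if_full_sub)
      (simp_all add: category_full_sub category_axioms)
  then show ?thesis using order_embedding.quantaloid_domain quantaloid_axioms by blast
qed

lemma residuals_full_sub [simp]: "lres (full_sub C S) = lres C" "rres (full_sub C S) = rres C"
  by (intro ext; simp add: lres_def rres_def)+

lemma chu_full_sub:
  "chu_connections (full_sub C S) = chu_connections C" "chu_equiv (full_sub C S) = chu_equiv C"
proof -
  have *: "chu_connections (full_sub C S) P R = chu_connections C P R" for P R
    by (cases P; cases R) simp
  have "chu_equiv (full_sub C S) P R = chu_equiv C P R" for P R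
    by (cases P; cases R) (simp only: chu_equiv.simps * residuals_full_sub)
  then show "chu_connections (full_sub C S) = chu_connections C"
    "chu_equiv (full_sub C S) = chu_equiv C"
    using * by blast+
qed

text \<open>Residuals only depend on homs, composition and order, so the quotient formed over a full
  subquantaloid is a full subquantaloid of the quotient.\<close>

lemma order_embedding_BChu_full_sub:
  assumes "quantaloid C"
  shows "order_embedding (BChu (full_sub C S)) (BChu C) (\<lambda>X. X) (\<lambda>X Y f. f)"
proof (rule order_embedding_id_if_full_sub)
  show "category (BChu (full_sub C S))" "category (BChu C)"
    using assms quantaloid_full_sub quantaloid.category_BChu by blast+
  have Chu: "Ide (ChuCon (full_sub C S)) = Ide (ChuCon C)"
    "Cmp (ChuCon (full_sub C S)) = Cmp (ChuCon C)"
    "hom_lat (ChuCon (full_sub C S)) = hom_lat (ChuCon C)"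
    by (simp_all add: ChuCon_def hom_lat_def fun_eq_iff chu_full_sub)
  show "Ob (BChu (full_sub C S)) \<subseteq> Ob (BChu C)"
    by (auto simp: BChu_simps ChuCon_def)
  show "Hom (BChu (full_sub C S)) = Hom (BChu C)" "Ide (BChu (full_sub C S)) = Ide (BChu C)"
    "Cmp (BChu (full_sub C S)) = Cmp (BChu C)" "Leq (BChu (full_sub C S)) = Leq (BChu C)"
    unfolding fun_eq_iff BChu_simps chu_full_sub Chu by simp_all
qed


section \<open>Distributors as matrices\<close>

context quantaloid
begin

lemma bottom_eq_sup_empty:
  assumes "X \<in> Ob C" "Y \<in> Ob C"
  shows "\<bottom>\<^bsub>hom_lat C X Y\<^esub> = \<Squnion>\<^bsub>hom_lat C X Y\<^esub> {}"
proof -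
  interpret complete_lattice "hom_lat C X Y" by (rule hom_complete[OF assms])
  show ?thesis using weak_sup_empty by simp
qed

lemma bottom_Hom:
  "\<lbrakk>X \<in> Ob C; Y \<in> Ob C\<rbrakk> \<Longrightarrow> \<bottom>\<^bsub>hom_lat C X Y\<^esub> \<in> Hom C X Y"
  by (simp add: bottom_eq_sup_empty sup_closed)

lemma bottom_Leq:
  "\<lbrakk>X \<in> Ob C; Y \<in> Ob C; t \<in> Hom C X Y\<rbrakk> \<Longrightarrow> Leq C X Y (\<bottom>\<^bsub>hom_lat C X Y\<^esub>) t"
  by (simp add: bottom_eq_sup_empty sup_Leq_iff)

lemma Cmp_bottom_Leq:
  "\<lbrakk>X \<in> Ob C; Y \<in> Ob C; Z \<in> Ob C; g \<in> Hom C Y Z; t \<in> Hom C X Z\<rbrakk> \<Longrightarrow>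
    Leq C X Z (Cmp C X Y Z g (\<bottom>\<^bsub>hom_lat C X Y\<^esub>)) t"
  by (simp add: bottom_eq_sup_empty Cmp_sup_right_Leq_iff)

end

lemma discrete_simps [simp]:
  "qob (discrete Q S t) = S"
  "qtype (discrete Q S t) = t"
  by (simp_all add: discrete_def)

context base_quantaloid
begin

lemma qhom_discrete:
  "\<lbrakk>x \<in> S; y \<in> S\<rbrakk> \<Longrightarrow>
    qhom (discrete Q S t) x y = (if x = y then Ide Q (t x) else \<bottom>\<^bsub>hom_lat Q (t x) (t y)\<^esub>)"
  by (simp add: discrete_def)

lemma qcategory_discrete:
  assumes t: "t \<in> S \<rightarrow>\<^sub>E Ob Q"
  shows "qcategory Q (discrete Q S t)"
proof -
  have tO: "t x \<in> Ob Q" if "x \<in> S" for x using t that by blast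
  have hom: "qhom (discrete Q S t) x y \<in> Hom Q (t x) (t y)" if "x \<in> S" "y \<in> S" for x y
    using that by (simp add: qhom_discrete bottom_Hom Ide_closed tO)
  show ?thesis
  proof
    have "(if x = y then Ide Q (t x) else \<bottom>\<^bsub>hom_lat Q (t x) (t y)\<^esub>) \<in> Hom Q (t x) (t y)"
      if "x \<in> S" "y \<in> S" for x y
      using that by (simp add: bottom_Hom Ide_closed tO)
    then show "qhom (discrete Q S t) \<in> (\<Pi>\<^sub>E x\<in>qob (discrete Q S t). \<Pi>\<^sub>E y\<in>qob (discrete Q S t).
        arr (discrete Q S t) x (discrete Q S t) y)"
      by (auto simp: discrete_def)
    show "leq (discrete Q S t) x (discrete Q S t) x
        (Ide Q (qtype (discrete Q S t) x)) (qhom (discrete Q S t) x x)"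
      if "x \<in> qob (discrete Q S t)" for x
      using that by (simp add: qhom_discrete Leq_refl Ide_closed tO)
    fix x y z assume xyz: "x \<in> qob (discrete Q S t)" "y \<in> qob (discrete Q S t)" "z \<in> qob (discrete Q S t)"
    let ?h = "qhom (discrete Q S t)"
    have "Leq Q (t x) (t z) (Cmp Q (t x) (t y) (t z) (?h y z) (?h x y)) (?h x z)"
    proof -
      consider "x = y" | "y = z" | "x \<noteq> y" "y \<noteq> z" by blast
      then show ?thesis
      proof cases
        case 1
        then show ?thesis using xyz hom[of y z]
          by (simp add: qhom_discrete[of y S y] Cmp_Ide_right Leq_refl tO)
      next
        case 2
        then show ?thesis using xyz hom[of x y]
          by (simp add: qhom_discrete[of z S z] Cmp_Ide_left Leq_refl tO)
      next
        case 3
        then show ?thesis using xyz hom[of x z]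
          by (simp add: qhom_discrete[of x S y] qhom_discrete[of y S z] Cmp_bottom_Leq bottom_Hom tO)
      qed
    qed
    then show "leq (discrete Q S t) x (discrete Q S t) z
        (cmp (discrete Q S t) x (discrete Q S t) y (discrete Q S t) z
          (?h y z) (?h x y)) (?h x z)" by simp
  qed (use t in simp)
qed

lemma discrete_Leq_qhom:
  assumes "qcategory Q A" "x \<in> qob A" "y \<in> qob A"
  shows "leq A x A y (qhom (discrete Q (qob A) (qtype A)) x y) (qhom A x y)"
  using assms qcategory.qhom_refl[OF assms(1)]
  by (simp add: qhom_discrete bottom_Leq dist_typing)

text \<open>Distributors are defined by inequalities against the homs of their source and target,
  hence remain distributors when these homs shrink.\<close>

lemma qdist_antimono:
  assumes A: "qcategory Q A" "qcategory Q A'" "qob A' = qob A" "qtype A' = qtype A"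
    "\<And>x y. \<lbrakk>x \<in> qob A; y \<in> qob A\<rbrakk> \<Longrightarrow> leq A x A y (qhom A' x y) (qhom A x y)"
    and B: "qcategory Q B" "qcategory Q B'" "qob B' = qob B" "qtype B' = qtype B"
    "\<And>x y. \<lbrakk>x \<in> qob B; y \<in> qob B\<rbrakk> \<Longrightarrow> leq B x B y (qhom B' x y) (qhom B x y)"
    and \<phi>: "\<phi> \<in> qdist Q A B"
  shows "\<phi> \<in> qdist Q A' B'"
proof -
  note hA' = qhom_Hom[OF A(2), unfolded A(3,4)] and hB' = qhom_Hom[OF B(2), unfolded B(3,4)]
  have "(\<lambda>x\<in>qob A'. \<lambda>y\<in>qob B'. \<phi> x y) \<in> qdist Q A' B'"
  proof (rule qdist_lambdaI[OF A(2) B(2)], unfold A(3,4) B(3,4))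
    fix x y y' assume x: "x \<in> qob A" and y: "y \<in> qob B" "y' \<in> qob B"
    show "leq A x B y'
        (cmp A x B y B y' (qhom B' y y') (\<phi> x y)) (\<phi> x y')"
      by (rule Cmp_Leq_if_left_Leq[OF _ _ _ _ _ _ _ B(5)[OF y] qdist_act_left[OF A(1) B(1) \<phi> x y]])
        (use A(1) B(1) x y \<phi> hB' in \<open>simp_all add: dist_typing\<close>)
  next
    fix x' x y assume x: "x' \<in> qob A" "x \<in> qob A" and y: "y \<in> qob B"
    show "leq A x' B y
        (cmp A x' A x B y (\<phi> x y) (qhom A' x' x)) (\<phi> x' y)"
      by (rule Cmp_Leq_if_right_Leq[OF _ _ _ _ _ _ _ A(5)[OF x] qdist_act_right[OF A(1) B(1) \<phi> x y]])
        (use A(1) B(1) x y \<phi> hA' in \<open>simp_all add: dist_typing\<close>)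
  qed (use \<phi> in \<open>simp add: qdist_Hom\<close>)
  then show ?thesis using qdist_extensional[OF \<phi>] A(3) B(3) by simp
qed

text \<open>A distributor \<open>\<phi> : A \<rightarrow> B\<close> is isomorphic to its underlying matrix: the identities of
  \<open>A\<close> and \<open>B\<close>, read as distributors to and from the underlying discrete categories, are Chu
  connections in both directions because all the residuals involved are \<open>\<phi>\<close> by the Yoneda lemma.\<close>

lemma iso_underlying_matrix:
  fixes A B :: "('u, 'o, 'a) qcat"
  assumes ob: "A \<in> Ob (QDist Q)" "B \<in> Ob (QDist Q)" and \<phi>: "\<phi> \<in> qdist Q A B"
  defines "A0 \<equiv> discrete Q (qob A) (qtype A)" and "B0 \<equiv> discrete Q (qob B) (qtype B)"
  shows "(A0, B0, \<phi>) \<in> Ob (BChu (QMat Q))"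
    and "\<exists>a. iso_arrow (BChu (QDist Q)) (A, B, \<phi>) (A0, B0, \<phi>) a"
proof -
  interpret D: quantaloid "QDist Q :: (('u, 'o, 'a) qcat, 'u \<Rightarrow> 'u \<Rightarrow> 'a) qtld"
    by (rule quantaloid_QDist)
  have A: "qcategory Q A" and B: "qcategory Q B" using ob by simp_all
  have t: "qtype A \<in> qob A \<rightarrow>\<^sub>E Ob Q" "qtype B \<in> qob B \<rightarrow>\<^sub>E Ob Q"
    using A B qcategory.qtype_closed by blast+
  have A0: "qcategory Q A0" and B0: "qcategory Q B0"
    unfolding A0_def B0_def using qcategory_discrete t by blast+
  have ob0: "A0 \<in> Ob (QDist Q)" "B0 \<in> Ob (QDist Q)"
    using A0 B0 ob by (simp_all add: A0_def B0_def)
  have [simp]: "qob A0 = qob A" "qtype A0 = qtype A" "qob B0 = qob B" "qtype B0 = qtype B"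
    by (simp_all add: A0_def B0_def)
  have le: "leq A x A y (qhom A0 x y) (qhom A x y)"
    if "x \<in> qob A" "y \<in> qob A" for x y
    unfolding A0_def using that A by (rule discrete_Leq_qhom[rotated])
  have le': "leq B x B y (qhom B0 x y) (qhom B x y)"
    if "x \<in> qob B" "y \<in> qob B" for x y
    unfolding B0_def using that B by (rule discrete_Leq_qhom[rotated])
  have rfl: "leq E x E y (qhom E x y) (qhom E x y)"
    if "qcategory Q E" "x \<in> qob E" "y \<in> qob E" for E :: "('u, 'o, 'a) qcat" and x y
    using that by (simp add: Leq_refl dist_typing)
  have \<phi>': "\<phi> \<in> qdist Q A' B'" if "A' \<in> {A, A0}" "B' \<in> {B, B0}" for A' B'
    by (rule qdist_antimono[OF A _ _ _ _ B _ _ _ _ \<phi>])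
      (use that A B A0 B0 le le' rfl in auto)
  have uA: "qhom A \<in> qdist Q A' A''" if "A' \<in> {A, A0}" "A'' \<in> {A, A0}" for A' A''
    by (rule qdist_antimono[OF A _ _ _ _ A _ _ _ _ qhom_qdist[OF A]])
      (use that A A0 le rfl in auto)
  have vB: "qhom B \<in> qdist Q B' B''" if "B' \<in> {B, B0}" "B'' \<in> {B, B0}" for B' B''
    by (rule qdist_antimono[OF B _ _ _ _ B _ _ _ _ qhom_qdist[OF B]])
      (use that B B0 le' rfl in auto)
  have l: "lres (QDist Q) A' A'' B' \<phi> (qhom A) = \<phi>"
    if "A' \<in> {A, A0}" "A'' \<in> {A, A0}" "B' \<in> {B, B0}" for A' A'' B'
  proof (rule lres_QDist_eqI[OF _ _ _ uA[OF that(1,2)] \<phi>'[OF that(1,3)] \<phi>'[OF that(2,3)]])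
    show "A' \<in> Ob (QDist Q)" "A'' \<in> Ob (QDist Q)" "B' \<in> Ob (QDist Q)" using that ob ob0 by blast+
    have [simp]: "qob A' = qob A" "qtype A' = qtype A" "qob A'' = qob A" "qtype A'' = qtype A"
      "qob B' = qob B" "qtype B' = qtype B" using that by auto
    fix y z f assume "y \<in> qob A''" "z \<in> qob B'" "f \<in> arr A'' y B' z"
    then show "(\<forall>x\<in>qob A'. leq A' x B' z
        (cmp A' x A'' y B' z f (qhom A x y)) (\<phi> x z))
      \<longleftrightarrow> leq A'' y B' z f (\<phi> y z)"
      using qdist_yoneda_left[OF A B \<phi>, of y z f] by simp
  qed
  have r: "rres (QDist Q) A' B' B'' (qhom B) \<phi> = \<phi>"
    if "A' \<in> {A, A0}" "B' \<in> {B, B0}" "B'' \<in> {B, B0}" for A' B' B''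
  proof (rule rres_QDist_eqI[OF _ _ _ vB[OF that(2,3)] \<phi>'[OF that(1,3)] \<phi>'[OF that(1,2)]])
    show "A' \<in> Ob (QDist Q)" "B' \<in> Ob (QDist Q)" "B'' \<in> Ob (QDist Q)" using that ob ob0 by blast+
    have [simp]: "qob A' = qob A" "qtype A' = qtype A" "qob B' = qob B" "qtype B' = qtype B"
      "qob B'' = qob B" "qtype B'' = qtype B" using that by auto
    fix x y f assume "x \<in> qob A'" "y \<in> qob B'" "f \<in> arr A' x B' y"
    then show "(\<forall>z\<in>qob B''. leq A' x B'' z
        (cmp A' x B' y B'' z (qhom B y z) f) (\<phi> x z))
      \<longleftrightarrow> leq A' x B' y f (\<phi> x y)"
      using qdist_yoneda_right[OF A B \<phi>, of x y f] by simp
  qed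
  have S: "A0 \<in> {discrete Q S t | S t. t \<in> S \<rightarrow>\<^sub>E Ob Q}" "B0 \<in> {discrete Q S t | S t. t \<in> S \<rightarrow>\<^sub>E Ob Q}"
    using t unfolding A0_def B0_def by blast+
  show "(A0, B0, \<phi>) \<in> Ob (BChu (QMat Q))"
    using ob0 \<phi>'[of A0 B0] S unfolding QMat_def BChu_simps by simp
  have \<phi>0: "\<phi> \<in> Hom (QDist Q) A B" "\<phi> \<in> Hom (QDist Q) A0 B0" using \<phi>' by simp_all
  have ll: "lres (QDist Q) A' A' B' \<phi> (Cmp (QDist Q) A' A'' A' (qhom A) (qhom A)) = \<phi>"
    if "A' \<in> {A, A0}" "A'' \<in> {A, A0}" "B' \<in> {B, B0}" for A' A'' B'
  proof -
    have o: "A' \<in> Ob (QDist Q)" "A'' \<in> Ob (QDist Q)" "B' \<in> Ob (QDist Q)" using that ob ob0 by auto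
    show ?thesis
      using that D.lres_Cmp[OF o(1,2,1,3), of "qhom A" "qhom A" \<phi>] uA \<phi>' by (simp add: l)
  qed
  show "\<exists>a. iso_arrow (BChu (QDist Q)) (A, B, \<phi>) (A0, B0, \<phi>) a"
    by (rule D.iso_arrow_BChuI[OF ob ob0 \<phi>0, where u = "qhom A" and v = "qhom B"
          and u' = "qhom A" and v' = "qhom B"])
      (simp_all add: uA vB l r ll)
qed

end


section \<open>Adjunctions and completeness\<close>

context base_quantaloid
begin

lemma qhom_Leq_right:
  assumes A: "qcategory Q A" and x: "x \<in> qob A" "a \<in> qob A" "b \<in> qob A" and ab: "qle Q A a b"
  shows "leq A x A b (qhom A x a) (qhom A x b)"
proof -
  have t: "qtype A a = qtype A b" and le: "leq A b A b (Ide Q (qtype A b)) (qhom A a b)"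
    using ab by (auto simp: qle_def)
  have "leq A x A b
      (cmp A x A b A b (Ide Q (qtype A b)) (qhom A x a)) (qhom A x b)"
    by (rule Cmp_Leq_if_left_Leq[OF _ _ _ _ _ _ _ le])
      (use A x qhom_Hom[OF A, of x a] qhom_Hom[OF A, of a b] qcategory.qhom_trans[OF A x] in
        \<open>simp_all add: dist_typing t\<close>)
  then show ?thesis using A x qhom_Hom[OF A, of x a] by (simp add: Cmp_Ide_left dist_typing t)
qed

lemma qhom_Leq_left:
  assumes A: "qcategory Q A" and x: "x \<in> qob A" "a \<in> qob A" "b \<in> qob A" and ab: "qle Q A a b"
  shows "leq A a A x (qhom A b x) (qhom A a x)"
proof -
  have t: "qtype A b = qtype A a" and le: "leq A a A a (Ide Q (qtype A a)) (qhom A a b)"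
    using ab by (auto simp: qle_def)
  have "leq A a A x
      (cmp A a A a A x (qhom A b x) (Ide Q (qtype A a))) (qhom A a x)"
    by (rule Cmp_Leq_if_right_Leq[OF _ _ _ _ _ _ _ le])
      (use A x qhom_Hom[OF A, of b x] qhom_Hom[OF A, of a b] qcategory.qhom_trans[OF A x(2,3,1)] in
        \<open>simp_all add: dist_typing t\<close>)
  then show ?thesis using A x qhom_Hom[OF A, of b x] by (simp add: Cmp_Ide_right dist_typing t)
qed

lemma qle_if_qhom_Leq:
  assumes A: "qcategory Q A" and x: "a \<in> qob A" "b \<in> qob A" and t: "qtype A a = qtype A b"
    and le: "leq A b A b (qhom A b b) (qhom A a b)"
  shows "qle Q A a b"
  unfolding qle_def
  using Leq_trans[OF _ _ _ _ _ qcategory.qhom_refl[OF A x(2)] le] A x t qhom_Hom[OF A, of a b]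
  by (simp add: dist_typing)

text \<open>An element is determined up to isomorphism by the homs out of it.\<close>

lemma skeletal_eqI:
  assumes A: "qcategory Q A" "skeletal Q A" and x: "a \<in> qob A" "b \<in> qob A"
    and t: "qtype A a = qtype A b" and eq: "\<And>y. y \<in> qob A \<Longrightarrow> qhom A a y = qhom A b y"
  shows "a = b"
proof -
  have "qle Q A a b"
    using qcategory.qhom_refl[OF A(1) x(2)] t eq[OF x(2)] by (simp add: qle_def)
  moreover have "qle Q A b a"
    using qcategory.qhom_refl[OF A(1) x(1)] t eq[OF x(1)] by (simp add: qle_def)
  ultimately show ?thesis using A(2) x unfolding skeletal_def by blast
qed

definition typed_map :: "('x, 'o, 'a) qcat \<Rightarrow> ('y, 'o, 'a) qcat \<Rightarrow> ('x \<Rightarrow> 'y) \<Rightarrow> bool" where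
  "typed_map A B F \<longleftrightarrow> F \<in> qob A \<rightarrow>\<^sub>E qob B \<and> (\<forall>x\<in>qob A. qtype B (F x) = qtype A x)"

text \<open>Type preserving maps with \<open>B(F x, y) = A(x, G y)\<close> are automatically functors: reflexivity gives
  the unit and the counit, and these give functoriality.\<close>

lemma qadjoint_iff:
  assumes A: "qcategory Q A" and B: "qcategory Q B"
  shows "qadjoint Q A B F G \<longleftrightarrow> typed_map A B F \<and> typed_map B A G \<and>
    (\<forall>x\<in>qob A. \<forall>y\<in>qob B. qhom B (F x) y = qhom A x (G y))" (is "?L \<longleftrightarrow> ?R")
proof
  assume L: ?L
  then have F: "typed_map A B F" and G: "typed_map B A G"
    by (auto simp: qadjoint_def qfunctor_def typed_map_def)
  have Fx: "F x \<in> qob B" "qtype B (F x) = qtype A x" if "x \<in> qob A" for x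
    using F that by (auto simp: typed_map_def)
  have Gy: "G y \<in> qob A" "qtype A (G y) = qtype B y" if "y \<in> qob B" for y
    using G that by (auto simp: typed_map_def)
  have Ff: "leq A x A x' (qhom A x x') (qhom B (F x) (F x'))"
    if "x \<in> qob A" "x' \<in> qob A" for x x'
    using L that by (simp add: qadjoint_def qfunctor_def)
  have Gf: "leq B y B y' (qhom B y y') (qhom A (G y) (G y'))"
    if "y \<in> qob B" "y' \<in> qob B" for y y'
    using L that by (simp add: qadjoint_def qfunctor_def)
  have "qhom B (F x) y = qhom A x (G y)" if x: "x \<in> qob A" and y: "y \<in> qob B" for x y
  proof (rule Leq_antisym)
    have hB: "qhom B (F x) y \<in> arr A x B y" using qhom_Hom[OF B, of "F x" y] Fx x y by simp
    have hA: "qhom A x (G y) \<in> arr A x B y" using qhom_Hom[OF A, of x "G y"] Gy x y by simp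
    show "qhom B (F x) y \<in> arr A x B y" "qhom A x (G y) \<in> arr A x B y"
      by fact+
    show "qtype A x \<in> Ob Q" "qtype B y \<in> Ob Q" using A B x y by (simp_all add: dist_typing)
    have unit: "qle Q A x (G (F x))" and counit: "qle Q B (F (G y)) y"
      using L x y by (simp_all add: qadjoint_def qfun_le_def compose_def)
    have "leq A x B y (qhom B (F x) y) (qhom A (G (F x)) (G y))"
      using Gf[of "F x" y] x y Fx by simp
    moreover have "leq A x B y (qhom A (G (F x)) (G y)) (qhom A x (G y))"
      using qhom_Leq_left[OF A _ _ _ unit, of "G y"] x y Fx Gy by simp
    ultimately show "leq A x B y (qhom B (F x) y) (qhom A x (G y))"
      using Leq_trans[of "qtype A x" "qtype B y" "qhom B (F x) y" "qhom A (G (F x)) (G y)"] hA hB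
        qhom_Hom[OF A, of "G (F x)" "G y"] Fx Gy x y A B by (simp add: dist_typing)
    have "leq A x B y (qhom A x (G y)) (qhom B (F x) (F (G y)))"
      using Ff[of x "G y"] x y Gy by simp
    moreover have "leq A x B y (qhom B (F x) (F (G y))) (qhom B (F x) y)"
      using qhom_Leq_right[OF B _ _ _ counit, of "F x"] x y Fx Gy by simp
    ultimately show "leq A x B y (qhom A x (G y)) (qhom B (F x) y)"
      using Leq_trans[of "qtype A x" "qtype B y" "qhom A x (G y)" "qhom B (F x) (F (G y))"] hA hB
        qhom_Hom[OF B, of "F x" "F (G y)"] Fx Gy x y A B by (simp add: dist_typing)
  qed
  then show ?R using F G by blast
next
  assume R: ?R
  have Fx: "F x \<in> qob B" "qtype B (F x) = qtype A x" if "x \<in> qob A" for x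
    using R that by (auto simp: typed_map_def)
  have Gy: "G y \<in> qob A" "qtype A (G y) = qtype B y" if "y \<in> qob B" for y
    using R that by (auto simp: typed_map_def)
  have eq: "qhom B (F x) y = qhom A x (G y)" if "x \<in> qob A" "y \<in> qob B" for x y
    using R that by blast
  have unit: "qle Q A x (G (F x))" if "x \<in> qob A" for x
    using that qcategory.qhom_refl[OF B, of "F x"] by (simp add: qle_def Fx Gy eq)
  have counit: "qle Q B (F (G y)) y" if "y \<in> qob B" for y
    using that qcategory.qhom_refl[OF A, of "G y"] by (simp add: qle_def Fx Gy eq)
  have "leq A x A x' (qhom A x x') (qhom B (F x) (F x'))"
    if "x \<in> qob A" "x' \<in> qob A" for x x'
    using qhom_Leq_right[OF A _ _ _ unit, of x x'] that Fx Gy by (simp add: eq)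
  moreover have "leq B y B y' (qhom B y y') (qhom A (G y) (G y'))"
    if "y \<in> qob B" "y' \<in> qob B" for y y'
    using qhom_Leq_left[OF B _ _ _ counit, of y' y] that Fx Gy by (simp flip: eq)
  ultimately show ?L
    using R unit counit
    by (auto simp: qadjoint_def qfunctor_def typed_map_def qfun_le_def compose_def)
qed

end


lemma star_simps [simp]:
  "qob (star Q X) = {pt}"
  "qtype (star Q X) pt = X"
  "qhom (star Q X) pt pt = Ide Q X"
  by (simp_all add: star_def)

context base_quantaloid
begin

lemma qcategory_star:
  assumes "X \<in> Ob Q"
  shows "qcategory Q (star Q X)"
  using assms by unfold_locales (auto simp: star_def Ide_closed Leq_refl Cmp_Ide_left)

text \<open>Homs that are residuals of a fixed matrix \<open>a\<close> automatically make up a category: this gives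
  both presheaf categories and their full subcategories.\<close>

lemma qcategory_if_residual:
  assumes T: "\<And>x. x \<in> I \<Longrightarrow> T x \<in> Ob Q" and t: "qtype K \<in> qob K \<rightarrow>\<^sub>E Ob Q"
    and h: "qhom K \<in> (\<Pi>\<^sub>E k\<in>qob K. \<Pi>\<^sub>E l\<in>qob K. arr K k K l)"
    and a: "\<And>x k. \<lbrakk>x \<in> I; k \<in> qob K\<rbrakk> \<Longrightarrow> a x k \<in> Hom Q (T x) (qtype K k)"
    and iff: "\<And>k l f. \<lbrakk>k \<in> qob K; l \<in> qob K; f \<in> arr K k K l\<rbrakk> \<Longrightarrow>
      leq K k K l f (qhom K k l) \<longleftrightarrow>
      (\<forall>x\<in>I. Leq Q (T x) (qtype K l) (Cmp Q (T x) (qtype K k) (qtype K l) f (a x k)) (a x l))"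
  shows "qcategory Q K"
proof
  have tO: "qtype K k \<in> Ob Q" if "k \<in> qob K" for k using t that by blast
  have hH: "qhom K k l \<in> arr K k K l" if "k \<in> qob K" "l \<in> qob K" for k l
    using h that by (fastforce simp: PiE_iff)
  have act: "Leq Q (T x) (qtype K l) (Cmp Q (T x) (qtype K k) (qtype K l) (qhom K k l) (a x k)) (a x l)"
    if "x \<in> I" "k \<in> qob K" "l \<in> qob K" for x k l
    using iff[OF that(2,3) hH[OF that(2,3)]] Leq_refl[OF tO tO hH] that by blast
  show "leq K k K k (Ide Q (qtype K k)) (qhom K k k)" if k: "k \<in> qob K" for k
    using k by (simp add: iff tO a T Ide_closed Cmp_Ide_left Leq_refl)
  fix k l m assume k: "k \<in> qob K" "l \<in> qob K" "m \<in> qob K"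
  have "Leq Q (T x) (qtype K m) (Cmp Q (T x) (qtype K l) (qtype K m) (qhom K l m)
      (Cmp Q (T x) (qtype K k) (qtype K l) (qhom K k l) (a x k))) (a x m)" if x: "x \<in> I" for x
    by (rule Cmp_Leq_if_right_Leq[OF _ _ _ _ _ _ _ act[OF x k(1,2)] act[OF x k(2,3)]])
      (use x k in \<open>simp_all add: T tO hH a Cmp_closed\<close>)
  then show "leq K k K m
      (cmp K k K l K m (qhom K l m) (qhom K k l)) (qhom K k m)"
    using k by (simp add: iff Cmp_closed Cmp_assoc tO hH a T)
qed (use t h in auto)

end

locale universal_quantaloid = base_quantaloid Q for Q :: "('o, 'a) qtld" +
  fixes U :: "'u itself"
  assumes universe: "universe TYPE('u)" and small_Q: "small_quantaloid TYPE('u) Q"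
begin

abbreviation QD :: "(('u, 'o, 'a) qcat, 'u \<Rightarrow> 'u \<Rightarrow> 'a) qtld" where "QD \<equiv> QDist Q"

lemma star_Ob: "X \<in> Ob Q \<Longrightarrow> star Q X \<in> Ob QD"
  using universe by (simp add: qcategory_star small_def universe_def finite_lesspoll_infinite)

lemma presheafI:
  assumes A: "qcategory Q A" and X: "X \<in> Ob Q"
    and m: "\<And>x. x \<in> qob A \<Longrightarrow> m x \<in> Hom Q (qtype A x) X"
    and act: "\<And>x x'. \<lbrakk>x \<in> qob A; x' \<in> qob A\<rbrakk> \<Longrightarrow>
      Leq Q (qtype A x') X (Cmp Q (qtype A x') (qtype A x) X (m x) (qhom A x' x)) (m x')"
  shows "(\<lambda>x\<in>qob A. \<lambda>z\<in>{pt}. m x) \<in> qdist Q A (star Q X)"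
proof -
  have "(\<lambda>x\<in>qob A. \<lambda>z\<in>qob (star Q X). m x) \<in> qdist Q A (star Q X)"
    by (rule qdist_lambdaI[OF A qcategory_star[OF X]])
      (use A X m act in \<open>auto simp: Cmp_Ide_left Leq_refl dist_typing\<close>)
  then show ?thesis by simp
qed

lemma presheaf_Hom:
  "\<lbrakk>m \<in> qdist Q A (star Q X); x \<in> qob A\<rbrakk> \<Longrightarrow> m x pt \<in> Hom Q (qtype A x) X"
  using qdist_Hom[of m A "star Q X" x pt] by simp

lemma presheaf_act:
  assumes "qcategory Q A" "X \<in> Ob Q" "m \<in> qdist Q A (star Q X)" "x \<in> qob A" "x' \<in> qob A"
  shows "Leq Q (qtype A x') X (Cmp Q (qtype A x') (qtype A x) X (m x pt) (qhom A x' x)) (m x' pt)"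
  using qdist_act_right[OF assms(1) qcategory_star assms(3) assms(5,4), of pt] assms(2) by simp

lemma column_qdist:
  assumes "qcategory Q A" "qcategory Q B" "\<phi> \<in> qdist Q A B" "b \<in> qob B"
  shows "(\<lambda>x\<in>qob A. \<lambda>z\<in>{pt}. \<phi> x b) \<in> qdist Q A (star Q (qtype B b))"
  using assms qdist_act_right[OF assms(1-3)] by (intro presheafI) (simp_all add: dist_typing)

subsection \<open>Presheaves\<close>

context
  fixes A :: "('u, 'o, 'a) qcat"
  assumes A: "A \<in> Ob QD"
begin

lemma presheaves_simps:
  "qob (presheaves Q A) = (SIGMA X:Ob Q. qdist Q A (star Q X))"
  "p \<in> qob (presheaves Q A) \<Longrightarrow> qtype (presheaves Q A) p = fst p"
  by (simp_all add: presheaves_def Let_def)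

lemma presheaves_hom:
  "\<lbrakk>p \<in> qob (presheaves Q A); q \<in> qob (presheaves Q A)\<rbrakk> \<Longrightarrow> qhom (presheaves Q A) p q =
    lres QD A (star Q (fst p)) (star Q (fst q)) (snd q) (snd p) pt pt"
  by (auto simp: presheaves_def Let_def)

lemma presheaves_hom_Hom:
  "\<lbrakk>p \<in> qob (presheaves Q A); q \<in> qob (presheaves Q A)\<rbrakk> \<Longrightarrow>
    qhom (presheaves Q A) p q \<in> Hom Q (fst p) (fst q)"
  using qdist_Hom[OF lres_QDist_closed[OF A star_Ob star_Ob], of "fst p" "fst q" "snd p" "snd q" pt pt]
  by (auto simp: presheaves_hom presheaves_simps)

lemma Leq_presheaves_hom_iff:
  assumes p: "p \<in> qob (presheaves Q A)" "q \<in> qob (presheaves Q A)" and f: "f \<in> Hom Q (fst p) (fst q)"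
  shows "Leq Q (fst p) (fst q) f (qhom (presheaves Q A) p q) \<longleftrightarrow>
    (\<forall>x\<in>qob A. Leq Q (qtype A x) (fst q)
      (Cmp Q (qtype A x) (fst p) (fst q) f (snd p x pt)) (snd q x pt))"
  using p f Leq_lres_QDist_iff[OF A star_Ob star_Ob, of "fst p" "fst q" "snd p" "snd q" pt pt f]
  by (auto simp: presheaves_hom presheaves_simps)

lemma qcategory_presheaves: "qcategory Q (presheaves Q A)"
proof (rule qcategory_if_residual[where I = "qob A" and T = "qtype A" and a = "\<lambda>x p. snd p x pt"])
  show "qtype (presheaves Q A) \<in> qob (presheaves Q A) \<rightarrow>\<^sub>E Ob Q"
    by (auto simp: presheaves_def Let_def)
  have ext: "qhom (presheaves Q A) \<in> extensional (qob (presheaves Q A))"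
    "qhom (presheaves Q A) p \<in> extensional (qob (presheaves Q A))" if "p \<in> qob (presheaves Q A)" for p
    using that by (auto simp: presheaves_def Let_def)
  show "qhom (presheaves Q A) \<in> (\<Pi>\<^sub>E k\<in>qob (presheaves Q A). \<Pi>\<^sub>E l\<in>qob (presheaves Q A).
      arr (presheaves Q A) k (presheaves Q A) l)"
  proof (intro PiE_I)
    fix p q assume "p \<in> qob (presheaves Q A)" "q \<in> qob (presheaves Q A)"
    then show "qhom (presheaves Q A) p q
        \<in> arr (presheaves Q A) p (presheaves Q A) q"
      by (simp add: presheaves_simps(2) presheaves_hom_Hom)
  qed (auto simp: presheaves_def Let_def split: if_splits)
  fix x p assume "x \<in> qob A" "p \<in> qob (presheaves Q A)"
  then show "snd p x pt \<in> arr A x (presheaves Q A) p"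
    using presheaf_Hom[of "snd p" A "fst p" x] by (simp add: presheaves_simps(2)) (auto simp: presheaves_simps)
qed (use A Leq_presheaves_hom_iff in \<open>simp_all add: presheaves_simps(2) dist_typing\<close>)

lemma yoneda_Ob: "y \<in> qob A \<Longrightarrow> yoneda Q A y \<in> qob (presheaves Q A)"
  using A column_qdist[OF _ _ qhom_qdist, of A y]
  by (simp add: yoneda_def presheaves_simps dist_typing)

lemma fst_yoneda: "y \<in> qob A \<Longrightarrow> fst (yoneda Q A y) = qtype A y"
  by (simp add: yoneda_def)

lemma snd_yoneda: "\<lbrakk>x \<in> qob A; y \<in> qob A\<rbrakk> \<Longrightarrow> snd (yoneda Q A y) x pt = qhom A x y"
  by (simp add: yoneda_def)

text \<open>\<open>s\<close> is the supremum of the presheaf \<open>m\<close>, in the sense that \<open>A(s, -) = A \<swarrow> m\<close>.\<close>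

definition is_qsup :: "'o \<Rightarrow> ('u \<Rightarrow> 'u \<Rightarrow> 'a) \<Rightarrow> 'u \<Rightarrow> bool" where
  "is_qsup X m s \<longleftrightarrow> s \<in> qob A \<and> qtype A s = X \<and>
     (\<forall>y\<in>qob A. \<forall>f\<in>Hom Q X (qtype A y). Leq Q X (qtype A y) f (qhom A s y) \<longleftrightarrow>
        (\<forall>x\<in>qob A. leq A x A y
          (Cmp Q (qtype A x) X (qtype A y) f (m x pt)) (qhom A x y)))"

text \<open>A left adjoint of the Yoneda embedding chooses suprema, since \<open>A(F m, y)\<close> must be the hom
  \<open>A(-, y) \<swarrow> m\<close> from \<open>m\<close> to the presheaf represented by \<open>y\<close>.  Conversely any choice of suprema is
  such an adjoint.\<close>

theorem complete_qcat_iff: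
  "complete_qcat Q A \<longleftrightarrow> (\<forall>X\<in>Ob Q. \<forall>m\<in>qdist Q A (star Q X). \<exists>s. is_qsup X m s)"
proof
  have cA: "qcategory Q A" using A by simp
  assume "complete_qcat Q A"
  then obtain F where F: "typed_map (presheaves Q A) A F"
    "\<And>p y. \<lbrakk>p \<in> qob (presheaves Q A); y \<in> qob A\<rbrakk> \<Longrightarrow>
      qhom A (F p) y = qhom (presheaves Q A) p (yoneda Q A y)"
    unfolding complete_qcat_def using qadjoint_iff[OF qcategory_presheaves cA] by blast
  have "is_qsup X m (F (X, m))" if X: "X \<in> Ob Q" "m \<in> qdist Q A (star Q X)" for X m
  proof -
    have p: "(X, m) \<in> qob (presheaves Q A)" using X by (simp add: presheaves_simps)
    then have "F (X, m) \<in> qob A" "qtype A (F (X, m)) = X"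
      using F(1) unfolding typed_map_def by (auto simp: presheaves_simps(2))
    moreover have "Leq Q X (qtype A y) f (qhom A (F (X, m)) y) \<longleftrightarrow>
        (\<forall>x\<in>qob A. leq A x A y
          (Cmp Q (qtype A x) X (qtype A y) f (m x pt)) (qhom A x y))"
      if "y \<in> qob A" "f \<in> Hom Q X (qtype A y)" for y f
      using Leq_presheaves_hom_iff[OF p yoneda_Ob, of y f] that F(2)[OF p]
      by (simp add: fst_yoneda snd_yoneda)
    ultimately show ?thesis unfolding is_qsup_def by blast
  qed
  then show "\<forall>X\<in>Ob Q. \<forall>m\<in>qdist Q A (star Q X). \<exists>s. is_qsup X m s" by blast
next
  have cA: "qcategory Q A" using A by simp
  assume "\<forall>X\<in>Ob Q. \<forall>m\<in>qdist Q A (star Q X). \<exists>s. is_qsup X m s"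
  then have "\<forall>p\<in>qob (presheaves Q A). \<exists>s. is_qsup (fst p) (snd p) s"
    by (auto simp: presheaves_simps)
  then obtain F0 where F0: "\<And>p. p \<in> qob (presheaves Q A) \<Longrightarrow> is_qsup (fst p) (snd p) (F0 p)"
    by metis
  let ?F = "restrict F0 (qob (presheaves Q A))"
  have "typed_map (presheaves Q A) A ?F"
    using F0 unfolding typed_map_def is_qsup_def by (simp add: presheaves_simps(2))
  moreover have "typed_map A (presheaves Q A) (yoneda Q A)"
    using yoneda_Ob unfolding typed_map_def
    by (auto simp: presheaves_simps(2) fst_yoneda) (auto simp: yoneda_def)
  moreover have "qhom A (?F p) y = qhom (presheaves Q A) p (yoneda Q A y)"
    if p: "p \<in> qob (presheaves Q A)" and y: "y \<in> qob A" for p y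
  proof (rule Leq_eqI)
    have sup: "F0 p \<in> qob A" "qtype A (F0 p) = fst p"
      "\<And>f. f \<in> Hom Q (fst p) (qtype A y) \<Longrightarrow> Leq Q (fst p) (qtype A y) f (qhom A (F0 p) y) \<longleftrightarrow>
        (\<forall>x\<in>qob A. leq A x A y
          (Cmp Q (qtype A x) (fst p) (qtype A y) f (snd p x pt)) (qhom A x y))"
      using F0[OF p] y unfolding is_qsup_def by blast+
    show "fst p \<in> Ob Q" "qtype A y \<in> Ob Q" using p y cA by (auto simp: presheaves_simps dist_typing)
    show "qhom A (?F p) y \<in> Hom Q (fst p) (qtype A y)"
      using qhom_Hom[OF cA sup(1) y] p by (simp add: sup(2))
    show "qhom (presheaves Q A) p (yoneda Q A y) \<in> Hom Q (fst p) (qtype A y)"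
      using presheaves_hom_Hom[OF p yoneda_Ob[OF y]] by (simp add: fst_yoneda y)
    fix f assume f: "f \<in> Hom Q (fst p) (qtype A y)"
    then show "Leq Q (fst p) (qtype A y) f (qhom A (?F p) y) \<longleftrightarrow>
        Leq Q (fst p) (qtype A y) f (qhom (presheaves Q A) p (yoneda Q A y))"
      using Leq_presheaves_hom_iff[OF p yoneda_Ob[OF y], of f] p y
      by (simp add: sup(3) fst_yoneda snd_yoneda)
  qed
  ultimately have "qadjoint Q (presheaves Q A) A ?F (yoneda Q A)"
    using qadjoint_iff[OF qcategory_presheaves cA] by blast
  then show "complete_qcat Q A" unfolding complete_qcat_def by blast
qed

end


section \<open>Left adjoints as classes of Chu connections\<close>

abbreviation CC :: "(('u, 'o, 'a) qcat, 'u \<Rightarrow> 'u) qtld" where "CC \<equiv> QCCat Q"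

lemma QCCat_simps [simp]:
  "A \<in> Ob CC \<longleftrightarrow> A \<in> Ob QD \<and> skeletal Q A \<and> complete_qcat Q A"
  "Hom CC A B = {F. \<exists>G. qadjoint Q A B F G}"
  "Ide CC A = (\<lambda>x\<in>qob A. x)"
  "Cmp CC A B D G F = compose (qob A) G F"
  "Leq CC = qfun_le Q"
  by (auto simp: QCCat_def)

lemma typed_map_closed:
  "\<lbrakk>typed_map A B F; x \<in> qob A\<rbrakk> \<Longrightarrow> F x \<in> qob B"
  "\<lbrakk>typed_map A B F; x \<in> qob A\<rbrakk> \<Longrightarrow> qtype B (F x) = qtype A x"
  by (auto simp: typed_map_def)

lemma typed_map_compose:
  "\<lbrakk>typed_map A B F; typed_map B D G\<rbrakk> \<Longrightarrow> typed_map A D (compose (qob A) G F)"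
  by (auto simp: typed_map_def compose_def PiE_iff)

lemma typed_map_id: "typed_map A A (\<lambda>x\<in>qob A. x)"
  by (auto simp: typed_map_def)

lemma category_QCCat: "category CC"
proof
  fix A :: "('u, 'o, 'a) qcat" assume "A \<in> Ob CC"
  then have A: "qcategory Q A" by simp
  have "qadjoint Q A A (\<lambda>x\<in>qob A. x) (\<lambda>x\<in>qob A. x)"
    unfolding qadjoint_iff[OF A A] by (simp add: typed_map_id)
  then show "Ide CC A \<in> Hom CC A A" by auto
next
  fix A B D :: "('u, 'o, 'a) qcat" and F F'
  assume "A \<in> Ob CC" "B \<in> Ob CC" "D \<in> Ob CC" and F: "F \<in> Hom CC A B" "F' \<in> Hom CC B D"
  then have A: "qcategory Q A" and B: "qcategory Q B" and D: "qcategory Q D" by simp_all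
  obtain G G' where "qadjoint Q A B F G" "qadjoint Q B D F' G'" using F by auto
  then have "qadjoint Q A D (compose (qob A) F' F) (compose (qob D) G G')"
    unfolding qadjoint_iff[OF A B] qadjoint_iff[OF B D] qadjoint_iff[OF A D]
    by (auto simp: typed_map_compose typed_map_closed compose_eq)
  then show "Cmp CC A B D F' F \<in> Hom CC A D" by auto
next
  fix A B :: "('u, 'o, 'a) qcat" and F
  assume "F \<in> Hom CC A B"
  then have "F \<in> qob A \<rightarrow>\<^sub>E qob B" by (auto simp: qadjoint_def qfunctor_def)
  then show "Cmp CC A A B F (Ide CC A) = F" "Cmp CC A B B (Ide CC B) F = F"
    by (auto simp: PiE_iff Pi_iff compose_Id Id_compose)
next
  fix A B D E :: "('u, 'o, 'a) qcat" and F F' F''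
  assume "F \<in> Hom CC A B" "F' \<in> Hom CC B D" "F'' \<in> Hom CC D E"
  then have "F \<in> qob A \<rightarrow> qob B" by (auto simp: qadjoint_def qfunctor_def)
  then show "Cmp CC A B E (Cmp CC B D E F'' F') F = Cmp CC A D E F'' (Cmp CC A B D F' F)"
    by (simp add: compose_assoc)
qed

text \<open>The two distributors \<open>B(F-, -) : A \<rightarrow> B\<close> and \<open>B(-, F-) : B \<rightarrow> A\<close> induced by a functor \<open>F\<close>.\<close>

definition graph :: "('u, 'o, 'a) qcat \<Rightarrow> ('u, 'o, 'a) qcat \<Rightarrow> ('u \<Rightarrow> 'u) \<Rightarrow> 'u \<Rightarrow> 'u \<Rightarrow> 'a" where
  "graph A B F = (\<lambda>x\<in>qob A. \<lambda>y\<in>qob B. qhom B (F x) y)"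

definition cograph :: "('u, 'o, 'a) qcat \<Rightarrow> ('u, 'o, 'a) qcat \<Rightarrow> ('u \<Rightarrow> 'u) \<Rightarrow> 'u \<Rightarrow> 'u \<Rightarrow> 'a" where
  "cograph A B F = (\<lambda>y\<in>qob B. \<lambda>x\<in>qob A. qhom B y (F x))"

lemma graph_apply: "\<lbrakk>x \<in> qob A; y \<in> qob B\<rbrakk> \<Longrightarrow> graph A B F x y = qhom B (F x) y"
  by (simp add: graph_def)

lemma cograph_apply: "\<lbrakk>x \<in> qob A; y \<in> qob B\<rbrakk> \<Longrightarrow> cograph A B F y x = qhom B y (F x)"
  by (simp add: cograph_def)

lemma graph_id: "qcategory Q A \<Longrightarrow> graph A A (\<lambda>x\<in>qob A. x) = qhom A"
  using qdist_extensional[OF qhom_qdist, of A] by (auto simp: graph_def cong: restrict_cong)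

lemma qfunctor_typed_map: "qfunctor Q A B F \<Longrightarrow> typed_map A B F"
  by (simp add: qfunctor_def typed_map_def)

lemma graph_qdist:
  assumes A: "qcategory Q A" and B: "qcategory Q B" and F: "qfunctor Q A B F"
  shows "graph A B F \<in> qdist Q A B"
  unfolding graph_def
proof (rule qdist_lambdaI[OF A B])
  note Fx = typed_map_closed[OF qfunctor_typed_map[OF F]]
  have hB: "qhom B (F x) y \<in> arr A x B y" if "x \<in> qob A" "y \<in> qob B" for x y
    using qhom_Hom[OF B, of "F x" y] Fx that by simp
  then show "qhom B (F x) y \<in> arr A x B y" if "x \<in> qob A" "y \<in> qob B" for x y
    using that by blast
  show "leq A x B y' (cmp A x B y B y'
      (qhom B y y') (qhom B (F x) y)) (qhom B (F x) y')"
    if "x \<in> qob A" "y \<in> qob B" "y' \<in> qob B" for x y y'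
    using qcategory.qhom_trans[OF B, of "F x" y y'] Fx that by simp
  fix x' x y assume x: "x' \<in> qob A" "x \<in> qob A" "y \<in> qob B"
  have le: "leq A x' A x (qhom A x' x) (qhom B (F x') (F x))"
    using F x by (simp add: qfunctor_def)
  show "leq A x' B y (cmp A x' A x B y
      (qhom B (F x) y) (qhom A x' x)) (qhom B (F x') y)"
    by (rule Cmp_Leq_if_right_Leq[OF _ _ _ _ _ _ _ le])
      (use A B x hB qhom_Hom[OF B, of "F x'" "F x"] Fx
        qcategory.qhom_trans[OF B, of "F x'" "F x" y] in \<open>simp_all add: dist_typing\<close>)
qed

lemma cograph_qdist:
  assumes A: "qcategory Q A" and B: "qcategory Q B" and F: "qfunctor Q A B F"
  shows "cograph A B F \<in> qdist Q B A"
  unfolding cograph_def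
proof (rule qdist_lambdaI[OF B A])
  note Fx = typed_map_closed[OF qfunctor_typed_map[OF F]]
  have hB: "qhom B y (F x) \<in> arr B y A x" if "x \<in> qob A" "y \<in> qob B" for x y
    using qhom_Hom[OF B, of y "F x"] Fx that by simp
  then show "qhom B y (F x) \<in> arr B y A x" if "y \<in> qob B" "x \<in> qob A" for x y
    using that by blast
  show "leq B y' A x (cmp B y' B y A x
      (qhom B y (F x)) (qhom B y' y)) (qhom B y' (F x))"
    if "y' \<in> qob B" "y \<in> qob B" "x \<in> qob A" for x y y'
    using qcategory.qhom_trans[OF B, of y' y "F x"] Fx that by simp
  fix y x x' assume x: "y \<in> qob B" "x \<in> qob A" "x' \<in> qob A"
  have le: "leq A x A x' (qhom A x x') (qhom B (F x) (F x'))"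
    using F x by (simp add: qfunctor_def)
  show "leq B y A x' (cmp B y A x A x'
      (qhom A x x') (qhom B y (F x))) (qhom B y (F x'))"
    by (rule Cmp_Leq_if_left_Leq[OF _ _ _ _ _ _ _ le])
      (use A B x hB qhom_Hom[OF B, of "F x" "F x'"] Fx
        qcategory.qhom_trans[OF B, of y "F x" "F x'"] in \<open>simp_all add: dist_typing\<close>)
qed

text \<open>By the Yoneda lemma, residuation by \<open>B(-, F-)\<close> is restriction along \<open>F\<close>.\<close>

lemma lres_cograph:
  assumes A: "A \<in> Ob QD" and B: "B \<in> Ob QD" and D: "D \<in> Ob QD"
    and F: "qfunctor Q A B F" and \<phi>: "\<phi> \<in> qdist Q B D"
    and \<kappa>: "\<kappa> \<in> qdist Q A D" "\<And>x z. \<lbrakk>x \<in> qob A; z \<in> qob D\<rbrakk> \<Longrightarrow> \<kappa> x z = \<phi> (F x) z"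
  shows "lres QD B A D \<phi> (cograph A B F) = \<kappa>"
proof (rule lres_QDist_eqI[OF B A D])
  have cA: "qcategory Q A" and cB: "qcategory Q B" and cD: "qcategory Q D" using A B D by simp_all
  note Fx = typed_map_closed[OF qfunctor_typed_map[OF F]]
  show "cograph A B F \<in> qdist Q B A" by (rule cograph_qdist[OF cA cB F])
  fix x z f assume x: "x \<in> qob A" "z \<in> qob D" "f \<in> arr A x D z"
  then show "(\<forall>y\<in>qob B. leq B y D z
      (cmp B y A x D z f (cograph A B F y x)) (\<phi> y z))
    \<longleftrightarrow> leq A x D z f (\<kappa> x z)"
    using qdist_yoneda_left[OF cB cD \<phi>, of "F x" z f] Fx[OF x(1)] by (simp add: cograph_apply \<kappa>(2))
qed fact+

lemma rres_graph:
  assumes A: "A \<in> Ob QD" and B: "B \<in> Ob QD" and D: "D \<in> Ob QD"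
    and F: "qfunctor Q B D F" and \<phi>: "\<phi> \<in> qdist Q A D"
    and \<kappa>: "\<kappa> \<in> qdist Q A B" "\<And>x z. \<lbrakk>x \<in> qob A; z \<in> qob B\<rbrakk> \<Longrightarrow> \<kappa> x z = \<phi> x (F z)"
  shows "rres QD A B D (graph B D F) \<phi> = \<kappa>"
proof (rule rres_QDist_eqI[OF A B D])
  have cA: "qcategory Q A" and cB: "qcategory Q B" and cD: "qcategory Q D" using A B D by simp_all
  note Fx = typed_map_closed[OF qfunctor_typed_map[OF F]]
  show "graph B D F \<in> qdist Q B D" by (rule graph_qdist[OF cB cD F])
  fix x z f assume x: "x \<in> qob A" "z \<in> qob B" "f \<in> arr A x B z"
  then show "(\<forall>y\<in>qob D. leq A x D y
      (cmp A x B z D y (graph B D F z y) f) (\<phi> x y))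
    \<longleftrightarrow> leq A x B z f (\<kappa> x z)"
    using qdist_yoneda_right[OF cA cD \<phi>, of x "F z" f] Fx[OF x(2)] by (simp add: graph_apply \<kappa>(2))
qed fact+

text \<open>The equality \<open>B(F-, -) = A(-, G-)\<close> of an adjunction is the condition that \<open>B(-, F-)\<close> and
  \<open>A(G-, -)\<close> form a Chu connection between the identities.\<close>

lemma adjoint_chu:
  assumes A: "A \<in> Ob QD" and B: "B \<in> Ob QD" and FG: "qadjoint Q A B F G"
  shows "(cograph A B F, graph B A G) \<in> chu_connections QD (B, B, qhom B) (A, A, qhom A)"
    and "lres QD B A B (qhom B) (cograph A B F) = graph A B F"
    and "graph A B F \<in> qdist Q A B"
proof -
  have cA: "qcategory Q A" and cB: "qcategory Q B" using A B by simp_all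
  have F: "qfunctor Q A B F" and G: "qfunctor Q B A G" using FG by (simp_all add: qadjoint_def)
  show w: "graph A B F \<in> qdist Q A B" by (rule graph_qdist[OF cA cB F])
  show l: "lres QD B A B (qhom B) (cograph A B F) = graph A B F"
    by (rule lres_cograph[OF A B B F qhom_qdist[OF cB] w]) (simp add: graph_apply)
  have "rres QD A B A (graph B A G) (qhom A) = graph A B F"
    using FG qadjoint_iff[OF cA cB] by (intro rres_graph[OF A B A G qhom_qdist[OF cA] w]) (simp add: graph_apply)
  then show "(cograph A B F, graph B A G) \<in> chu_connections QD (B, B, qhom B) (A, A, qhom A)"
    using l by (simp add: graph_qdist cograph_qdist cA cB F G)
qed

text \<open>Suprema of the columns of \<open>u\<close> represent \<open>w = 1\<^sub>B \<swarrow> u\<close> covariantly.  For the other variable let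
  \<open>G y\<close> be the supremum of the column \<open>w(-, y)\<close>, so that \<open>A(G y, -) = A \<swarrow> w(-, y)\<close>.  Then \<open>A(-, G y)\<close>
  is \<open>(A \<swarrow> w(-, y)) \<searrow> A\<close>, and this is \<open>w(-, y)\<close> itself because \<open>w = v \<searrow> 1\<^sub>A\<close>.\<close>

lemma adjoint_if_bond:
  assumes A: "A \<in> Ob QD" and B: "B \<in> Ob QD" and cA: "complete_qcat Q A" and cB: "complete_qcat Q B"
    and uv: "(u, v) \<in> chu_connections QD (B, B, qhom B) (A, A, qhom A)"
  shows "\<exists>F G. qadjoint Q A B F G \<and> lres QD B A B (qhom B) u = graph A B F"
proof -
  have A': "qcategory Q A" and B': "qcategory Q B" using A B by simp_all
  have u: "u \<in> qdist Q B A" and v: "v \<in> qdist Q B A"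
    and uv: "lres QD B A B (qhom B) u = rres QD A B A v (qhom A)"
    using uv by simp_all
  define w where "w = lres QD B A B (qhom B) u"
  have w: "w \<in> qdist Q A B" unfolding w_def by (rule lres_QDist_closed[OF B A B u qhom_qdist[OF B']])
  have w_u: "leq A x B y f (w x y) \<longleftrightarrow> (\<forall>y'\<in>qob B. leq B y' B y
      (cmp B y' A x B y f (u y' x)) (qhom B y' y))"
    if "x \<in> qob A" "y \<in> qob B" "f \<in> arr A x B y" for x y f
    unfolding w_def by (rule Leq_lres_QDist_iff[OF B A B u qhom_qdist[OF B'] that])
  have w_v: "leq A x B y f (w x y) \<longleftrightarrow> (\<forall>x'\<in>qob A. leq A x A x'
      (cmp A x B y A x' (v y x') f) (qhom A x x'))"
    if "x \<in> qob A" "y \<in> qob B" "f \<in> arr A x B y" for x y f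
    unfolding w_def uv by (rule Leq_rres_QDist_iff[OF A B A v qhom_qdist[OF A'] that])
  have "\<exists>s. is_qsup B (qtype A x) (\<lambda>y\<in>qob B. \<lambda>z\<in>{pt}. u y x) s" if "x \<in> qob A" for x
    using complete_qcat_iff[OF B] cB column_qdist[OF B' A' u that] qtype_Ob[OF A' that] by blast
  then obtain F0 where F0: "\<And>x. x \<in> qob A \<Longrightarrow> is_qsup B (qtype A x) (\<lambda>y\<in>qob B. \<lambda>z\<in>{pt}. u y x) (F0 x)"
    by metis
  have "\<exists>s. is_qsup A (qtype B y) (\<lambda>x\<in>qob A. \<lambda>z\<in>{pt}. w x y) s" if "y \<in> qob B" for y
    using complete_qcat_iff[OF A] cA column_qdist[OF A' B' w that] qtype_Ob[OF B' that] by blast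
  then obtain G0 where G0: "\<And>y. y \<in> qob B \<Longrightarrow> is_qsup A (qtype B y) (\<lambda>x\<in>qob A. \<lambda>z\<in>{pt}. w x y) (G0 y)"
    by metis
  have Fx: "F0 x \<in> qob B" "qtype B (F0 x) = qtype A x" if "x \<in> qob A" for x
    using F0[OF that] by (simp_all add: is_qsup_def[OF B])
  have Gy: "G0 y \<in> qob A" "qtype A (G0 y) = qtype B y" if "y \<in> qob B" for y
    using G0[OF that] by (simp_all add: is_qsup_def[OF A])
  have F_eq: "qhom B (F0 x) y = w x y" if x: "x \<in> qob A" and y: "y \<in> qob B" for x y
  proof (rule Leq_eqI)
    show "qtype A x \<in> Ob Q" "qtype B y \<in> Ob Q" "w x y \<in> arr A x B y"
      using x y A' B' w by (simp_all add: dist_typing)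
    show "qhom B (F0 x) y \<in> arr A x B y"
      using qhom_Hom[OF B', of "F0 x" y] x y Fx by simp
    fix f assume "f \<in> arr A x B y"
    then show "leq A x B y f (qhom B (F0 x) y) \<longleftrightarrow> leq A x B y f (w x y)"
      using F0[OF x] x y by (simp add: is_qsup_def[OF B] w_u)
  qed
  have G_sup: "leq B y A x' f (qhom A (G0 y) x') \<longleftrightarrow>
      (\<forall>x\<in>qob A. leq A x A x'
        (cmp A x B y A x' f (w x y)) (qhom A x x'))"
    if "y \<in> qob B" "x' \<in> qob A" "f \<in> arr B y A x'" for y x' f
    using G0[OF that(1)] that by (simp add: is_qsup_def[OF A])
  have G_eq: "qhom A x (G0 y) = w x y" if x: "x \<in> qob A" and y: "y \<in> qob B" for x y
  proof (rule Leq_eqI)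
    show "qtype A x \<in> Ob Q" "qtype B y \<in> Ob Q" "w x y \<in> arr A x B y"
      using x y A' B' w by (simp_all add: dist_typing)
    show "qhom A x (G0 y) \<in> arr A x B y"
      using qhom_Hom[OF A', of x "G0 y"] x y Gy by simp
    have hG: "qhom A (G0 y) x' \<in> arr B y A x'" if "x' \<in> qob A" for x'
      using qhom_Hom[OF A', of "G0 y" x'] y that Gy by simp
    fix f assume f: "f \<in> arr A x B y"
    have "leq A x B y f (qhom A x (G0 y)) \<longleftrightarrow>
      (\<forall>x'\<in>qob A. leq A x A x'
        (cmp A x B y A x' (qhom A (G0 y) x') f) (qhom A x x'))"
      using qdist_yoneda_right[OF A' A' qhom_qdist[OF A'], of x "G0 y" f] x y f Gy by simp
    also have "\<dots> \<longleftrightarrow> leq A x B y f (w x y)"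
    proof
      assume L: "\<forall>x'\<in>qob A. leq A x A x'
        (cmp A x B y A x' (qhom A (G0 y) x') f) (qhom A x x')"
      have "leq A x A x'
          (cmp A x B y A x' (v y x') f) (qhom A x x')" if x': "x' \<in> qob A" for x'
      proof (rule Cmp_Leq_if_left_Leq)
        have "leq A x'' A x'
            (cmp A x'' B y A x' (v y x') (w x'' y)) (qhom A x'' x')"
          if "x'' \<in> qob A" for x''
          using w_v[OF that y, of "w x'' y"] that x' y w A' B' by (simp add: Leq_refl dist_typing)
        then show "leq B y A x' (v y x') (qhom A (G0 y) x')"
          using G_sup y x' v by (simp add: dist_typing)
        show "leq A x A x'
          (cmp A x B y A x' (qhom A (G0 y) x') f) (qhom A x x')"
          using L x' by blast
      qed (use A' B' x y x' v f hG in \<open>simp_all add: dist_typing\<close>)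
      then show "leq A x B y f (w x y)" using w_v x y f by simp
    next
      assume R: "leq A x B y f (w x y)"
      show "\<forall>x'\<in>qob A. leq A x A x'
        (cmp A x B y A x' (qhom A (G0 y) x') f) (qhom A x x')"
      proof
        fix x' assume x': "x' \<in> qob A"
        have le: "leq A x A x'
          (cmp A x B y A x' (qhom A (G0 y) x') (w x y)) (qhom A x x')"
          using G_sup[OF y x' hG[OF x']] hG[OF x'] x x' y A' B' by (simp add: Leq_refl dist_typing)
        show "leq A x A x'
          (cmp A x B y A x' (qhom A (G0 y) x') f) (qhom A x x')"
          by (rule Cmp_Leq_if_right_Leq[OF _ _ _ _ _ _ _ R le])
            (use A' B' x y x' w f hG in \<open>simp_all add: dist_typing\<close>)
      qed
    qed
    finally show "leq A x B y f (qhom A x (G0 y))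
      \<longleftrightarrow> leq A x B y f (w x y)" .
  qed
  let ?F = "restrict F0 (qob A)" and ?G = "restrict G0 (qob B)"
  have "qadjoint Q A B ?F ?G"
    unfolding qadjoint_iff[OF A' B'] typed_map_def using Fx Gy by (simp add: F_eq G_eq)
  moreover have "w = graph A B ?F"
    using qdist_extensional[OF w] unfolding graph_def by (simp add: F_eq cong: restrict_cong)
  ultimately show ?thesis unfolding w_def by blast
qed

text \<open>Homs are contravariant in the first variable: larger functors have smaller graphs.\<close>

lemma graph_Leq_iff:
  assumes A: "qcategory Q A" and B: "qcategory Q B" and F: "qfunctor Q A B F" "qfunctor Q A B F'"
  shows "Leq QD A B (graph A B F') (graph A B F) \<longleftrightarrow> qfun_le Q A B F F'"
proof -
  note Fx = typed_map_closed[OF qfunctor_typed_map[OF F(1)]]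
    typed_map_closed[OF qfunctor_typed_map[OF F(2)]]
  have "(\<forall>y\<in>qob B. leq A x B y (qhom B (F' x) y) (qhom B (F x) y))
      \<longleftrightarrow> qle Q B (F x) (F' x)" if x: "x \<in> qob A" for x
  proof
    assume "\<forall>y\<in>qob B. leq A x B y (qhom B (F' x) y) (qhom B (F x) y)"
    then have "leq A x B (F' x) (qhom B (F' x) (F' x)) (qhom B (F x) (F' x))"
      using Fx x by blast
    then show "qle Q B (F x) (F' x)" using qle_if_qhom_Leq[OF B, of "F x" "F' x"] Fx x by simp
  next
    assume "qle Q B (F x) (F' x)"
    then show "\<forall>y\<in>qob B. leq A x B y (qhom B (F' x) y) (qhom B (F x) y)"
      using qhom_Leq_left[OF B, of _ "F x" "F' x"] Fx x by simp
  qed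
  then show ?thesis by (simp add: qfun_le_def graph_apply)
qed

text \<open>A complete category goes to its identity distributor, and a left adjoint \<open>F : A \<rightarrow> B\<close> to
  the class of Chu connections \<open>1\<^sub>B \<rightarrow> 1\<^sub>A\<close> whose common residual is the graph of \<open>F\<close>.\<close>

definition bond_class :: "('u, 'o, 'a) qcat \<Rightarrow> ('u, 'o, 'a) qcat \<Rightarrow> ('u \<Rightarrow> 'u)
    \<Rightarrow> (('u \<Rightarrow> 'u \<Rightarrow> 'a) \<times> ('u \<Rightarrow> 'u \<Rightarrow> 'a)) set" where
  "bond_class A B F = chu_class QD (B, B, qhom B) (A, A, qhom A) (graph A B F)"

text \<open>Functoriality is the rule for bonds of composites together with restriction along functors.
  The functor is faithful because the objects are skeletal, and full by completeness.\<close>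

theorem order_embedding_QCCat:
  "order_embedding CC (opposite (BChu QD)) (\<lambda>A. (A, A, qhom A)) bond_class"
proof -
  interpret D: quantaloid QD by (rule quantaloid_QDist)
  interpret CC: category CC by (rule category_QCCat)
  have ob: "A \<in> Ob QD" "qcategory Q A" "qhom A \<in> Hom QD A A" if "A \<in> Ob CC" for A
    using that by (simp_all add: qhom_qdist)
  have closed: "bond_class A B F \<in> Hom (BChu QD) (B, B, qhom B) (A, A, qhom A)"
    if AB: "A \<in> Ob CC" "B \<in> Ob CC" "F \<in> Hom CC A B" for A B F
  proof -
    obtain G where "qadjoint Q A B F G" using AB(3) by auto
    note * = adjoint_chu[OF ob(1)[OF AB(1)] ob(1)[OF AB(2)] this]
    show ?thesis using *(1) unfolding bond_class_def Hom_BChu *(2)[symmetric] by blast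
  qed
  have Leq_iff: "Leq (BChu QD) (B, B, qhom B) (A, A, qhom A) (bond_class A B F) (bond_class A B F')
      \<longleftrightarrow> Leq CC A B F F'"
    if A: "A \<in> Ob CC" and B: "B \<in> Ob CC" and F: "F \<in> Hom CC A B" "F' \<in> Hom CC A B" for A B F F'
  proof -
    obtain G G' where G: "qadjoint Q A B F G" "qadjoint Q A B F' G'" using F by auto
    have "qfunctor Q A B F" "qfunctor Q A B F'" using G by (simp_all add: qadjoint_def)
    note le = graph_Leq_iff[OF ob(2)[OF A] ob(2)[OF B] this]
    note c = adjoint_chu(1,2)[OF ob(1)[OF A] ob(1)[OF B] G(1)]
    note c' = adjoint_chu(1,2)[OF ob(1)[OF A] ob(1)[OF B] G(2)]
    show ?thesis
      unfolding bond_class_def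
      using D.Leq_BChu_iff[OF ob(1)[OF B] ob(1)[OF B] ob(1)[OF A] ob(1)[OF A] ob(3)[OF B] ob(3)[OF A] c c'] le
      by simp
  qed
  show ?thesis
  proof (intro order_embedding.intro cat_functor.intro cat_functor_axioms.intro
      order_embedding_axioms.intro)
    show "category CC" "category (opposite (BChu QD))"
      by (rule CC.category_axioms category_opposite D.category_BChu)+
    fix A assume A: "A \<in> Ob CC"
    show "(A, A, qhom A) \<in> Ob (opposite (BChu QD))"
      using ob[OF A] by (simp add: BChu_simps)
    show "bond_class A A (Ide CC A) = Ide (opposite (BChu QD)) (A, A, qhom A)"
      using ob[OF A] D.Ide_BChu[OF ob(1,1,3)[OF A]] by (simp add: bond_class_def graph_id)
  next
    fix A B F assume A: "A \<in> Ob CC" "B \<in> Ob CC" "F \<in> Hom CC A B"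
    show "bond_class A B F \<in> Hom (opposite (BChu QD)) (A, A, qhom A) (B, B, qhom B)"
      using closed[OF A] by simp
  next
    fix A B E F F'
    assume A: "A \<in> Ob CC" and B: "B \<in> Ob CC" and E: "E \<in> Ob CC"
      and F: "F \<in> Hom CC A B" "F' \<in> Hom CC B E"
    obtain G G' where G: "qadjoint Q A B F G" "qadjoint Q B E F' G'" using F by auto
    have qF: "qfunctor Q A B F" using G by (simp add: qadjoint_def)
    obtain G'' where G'': "qadjoint Q A E (compose (qob A) F' F) G''"
      using CC.Cmp_closed[OF A B E F] by auto
    note c = adjoint_chu[OF ob(1)[OF A] ob(1)[OF B] G(1)]
    note c' = adjoint_chu[OF ob(1)[OF B] ob(1)[OF E] G(2)]
    note c'' = adjoint_chu[OF ob(1)[OF A] ob(1)[OF E] G'']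
    have "lres QD E A E (qhom E) (Cmp QD E B A (cograph A B F) (cograph B E F'))
        = lres QD B A E (graph B E F') (cograph A B F)"
      using D.lres_Cmp[OF ob(1)[OF E] ob(1)[OF B] ob(1)[OF A] ob(1)[OF E]] c(1) c'(1,2) ob(3)[OF E]
      by simp
    also have "\<dots> = graph A E (compose (qob A) F' F)"
      using typed_map_closed[OF qfunctor_typed_map[OF qF]] c'(3) c''(3) ob(1)[OF A] ob(1)[OF B] ob(1)[OF E] qF
      by (intro lres_cograph) (simp_all add: graph_apply compose_def)
    finally show "bond_class A E (Cmp CC A B E F' F) = Cmp (opposite (BChu QD)) (A, A, qhom A)
        (B, B, qhom B) (E, E, qhom E) (bond_class B E F') (bond_class A B F)"
      using D.Cmp_BChu[OF ob(1)[OF E] ob(1)[OF E] ob(1)[OF B] ob(1)[OF B] ob(1)[OF A] ob(1)[OF A]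
          ob(3)[OF E] ob(3)[OF B] ob(3)[OF A] c'(1,2) c(1,2)]
      by (simp add: bond_class_def)
  next
    fix A B F F' assume A: "A \<in> Ob CC" "B \<in> Ob CC" "F \<in> Hom CC A B" "F' \<in> Hom CC A B"
    show "Leq (opposite (BChu QD)) (A, A, qhom A) (B, B, qhom B) (bond_class A B F) (bond_class A B F')
      \<longleftrightarrow> Leq CC A B F F'"
      using Leq_iff[OF A] by simp
  next
    fix A B assume A: "A \<in> Ob CC" and B: "B \<in> Ob CC"
    show "bij_betw (bond_class A B) (Hom CC A B) (Hom (opposite (BChu QD)) (A, A, qhom A) (B, B, qhom B))"
    proof (intro bij_betw_imageI inj_onI)
      fix F F' assume F: "F \<in> Hom CC A B" "F' \<in> Hom CC A B" and eq: "bond_class A B F = bond_class A B F'"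
      obtain G G' where G: "qadjoint Q A B F G" "qadjoint Q A B F' G'" using F by auto
      have T: "typed_map A B F" "typed_map A B F'"
        using G qfunctor_typed_map by (auto simp: qadjoint_def)
      note c = adjoint_chu[OF ob(1)[OF A] ob(1)[OF B] G(1)]
      have "graph A B F = graph A B F'"
        using eq chu_class_eq_iff[OF c(1), of "graph A B F'"] unfolding bond_class_def c(2) by simp
      then have "qhom B (F x) y = qhom B (F' x) y" if "x \<in> qob A" "y \<in> qob B" for x y
        using that graph_apply by metis
      then have "F x = F' x" if "x \<in> qob A" for x
        using that typed_map_closed[OF T(1)] typed_map_closed[OF T(2)] B
        by (intro skeletal_eqI[of B]) simp_all
      then show "F = F'" using T by (auto simp: typed_map_def intro: PiE_ext)
    next
      show "bond_class A B ` Hom CC A B = Hom (opposite (BChu QD)) (A, A, qhom A) (B, B, qhom B)"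
      proof (intro equalityI subsetI)
        fix P assume "P \<in> Hom (opposite (BChu QD)) (A, A, qhom A) (B, B, qhom B)"
        then obtain u v where uv: "(u, v) \<in> chu_connections QD (B, B, qhom B) (A, A, qhom A)"
          and P: "P = chu_class QD (B, B, qhom B) (A, A, qhom A) (lres QD B A B (qhom B) u)"
          unfolding opposite_simps Hom_BChu by blast
        obtain F G where "qadjoint Q A B F G" "lres QD B A B (qhom B) u = graph A B F"
          using adjoint_if_bond[OF ob(1)[OF A] ob(1)[OF B] _ _ uv] A B by auto
        then show "P \<in> bond_class A B ` Hom CC A B" unfolding P bond_class_def by auto
      qed (use closed[OF A B] in auto)
    qed
  qed
qed

end


section \<open>The concepts of a distributor\<close>

lemma small_lepoll: "\<lbrakk>small TYPE('u) T; S \<lesssim> T\<rbrakk> \<Longrightarrow> small TYPE('u) S"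
  unfolding small_def by (rule lesspoll_trans1)

lemma small_Pow:
  assumes "universe TYPE('u)" "small TYPE('u) S"
  shows "small TYPE('u) (Pow S)"
proof -
  obtain g :: "_ \<Rightarrow> 'u" where g: "inj_on g S"
    using assms(2) unfolding small_def lesspoll_def lepoll_def by blast
  have "g ` S \<prec> (UNIV :: 'u set)"
    using assms(2) g by (simp add: small_def)
  then have "small TYPE('u) (Pow (g ` S))"
    using assms(1) unfolding universe_def small_def by blast
  moreover have "Pow S \<lesssim> Pow (g ` S)"
    unfolding lepoll_def using inj_on_image_Pow[OF g] by (intro exI[of _ "image g"]) auto
  ultimately show ?thesis by (rule small_lepoll)
qed

lemma small_Times:
  assumes "universe TYPE('u)" "small TYPE('u) S" "small TYPE('u) T"
  shows "small TYPE('u) (S \<times> T)"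
proof (cases "finite S \<and> finite T")
  case True
  then show ?thesis
    using assms(1) unfolding small_def universe_def
    by (auto intro!: finite_lesspoll_infinite)
next
  case False
  have ordLeq: "S' \<lesssim> T' \<longleftrightarrow> (card_of S', card_of T') \<in> ordLeq" for S' :: "'s set" and T' :: "'t set"
    unfolding lepoll_def using card_of_ordLeq by blast
  show ?thesis
  proof (cases "(card_of S, card_of T) \<in> ordLeq")
    case True
    then have "infinite T" using False card_of_ordLeq_finite by blast
    then have "(card_of (S \<times> T), card_of T) \<in> ordLeq"
      using card_of_Sigma_ordLeq_infinite[of T S "\<lambda>_. T"] True card_of_mono1[OF subset_refl] by blast
    then show ?thesis using small_lepoll[OF assms(3)] unfolding lepoll_def card_of_ordLeq[symmetric] by blast
  next
    case nle: False
    then have le: "(card_of T, card_of S) \<in> ordLeq"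
      using ordLeq_total[OF card_of_Well_order card_of_Well_order] by blast
    then have "infinite S" using False card_of_ordLeq_finite by blast
    then have "(card_of (S \<times> T), card_of S) \<in> ordLeq"
      using card_of_Sigma_ordLeq_infinite[of S S "\<lambda>_. T"] le card_of_mono1[OF subset_refl] by blast
    then show ?thesis using small_lepoll[OF assms(2)] unfolding lepoll_def card_of_ordLeq[symmetric] by blast
  qed
qed

text \<open>A presheaf is determined by its type and its graph, a subset of a product of small sets.\<close>

lemma (in universal_quantaloid) small_presheaves:
  assumes A: "A \<in> Ob QD"
  shows "small TYPE('u) (qob (presheaves Q A))"
proof -
  let ?H = "\<Union>X\<in>Ob Q. \<Union>Y\<in>Ob Q. Hom Q X Y"
  \<comment> \<open>the type of a presheaf cannot be recovered from its graph when \<open>qob A\<close> is empty\<close>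
  let ?c = "\<lambda>(X, m). (X, (\<lambda>x. (x, m x pt)) ` qob A)"
  have "small TYPE('u) (Ob Q \<times> Pow (qob A \<times> ?H))"
    using A small_Q universe by (simp add: small_quantaloid_def small_Times small_Pow)
  moreover have "(SIGMA X:Ob Q. qdist Q A (star Q X :: ('u, 'o, 'a) qcat)) \<lesssim> Ob Q \<times> Pow (qob A \<times> ?H)"
    unfolding lepoll_def
  proof (intro exI[of _ ?c] conjI inj_onI)
    show "?c ` (SIGMA X:Ob Q. qdist Q A (star Q X)) \<subseteq> Ob Q \<times> Pow (qob A \<times> ?H)"
      using A presheaf_Hom qtype_Ob by fastforce
    fix p q :: "'o \<times> ('u \<Rightarrow> 'u \<Rightarrow> 'a)"
    assume p: "p \<in> (SIGMA X:Ob Q. qdist Q A (star Q X))"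
      and q: "q \<in> (SIGMA X:Ob Q. qdist Q A (star Q X))" and eq: "?c p = ?c q"
    obtain X and m m' :: "'u \<Rightarrow> 'u \<Rightarrow> 'a" where X: "p = (X, m)" "q = (X, m')" using eq by (cases p, cases q) auto
    have "m x pt = m' x pt" if "x \<in> qob A" for x
    proof -
      have "(\<lambda>x. (x, m x pt)) ` qob A = (\<lambda>x. (x, m' x pt)) ` qob A" using eq X by simp
      then have "(x, m x pt) \<in> (\<lambda>x. (x, m' x pt)) ` qob A" using that by blast
      then show ?thesis by auto
    qed
    then have "m = m'" using p q X by (intro qdist_eqI[of m A "star Q X"]) auto
    then show "p = q" using X by simp
  qed
  ultimately show ?thesis unfolding presheaves_simps(1)[OF A] by (rule small_lepoll)
qed

text \<open>The category \<open>K\<close> of concepts of \<open>\<phi>\<close>, described without reference to how its elements are encoded.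
  The column \<open>a(-, k)\<close> is the presheaf on \<open>A\<close> that the element \<open>k\<close> stands for (its extent), and the
  homs of \<open>K\<close> are those of presheaves.  The last two assumptions say that the extents are exactly the
  presheaves of the form \<open>l \<searrow> \<phi>\<close>, which are the presheaves closed under the Galois connection
  between \<open>- \<searrow> \<phi>\<close> and \<open>\<phi> \<swarrow> -\<close>.\<close>

locale concepts = universal_quantaloid Q U
  for Q :: "('o, 'a) qtld" and U :: "'u itself" +
  fixes A B K :: "('u, 'o, 'a) qcat" and \<phi> a :: "'u \<Rightarrow> 'u \<Rightarrow> 'a"
  assumes A: "A \<in> Ob QD" and B: "B \<in> Ob QD" and \<phi>: "\<phi> \<in> qdist Q A B"
    and K: "K \<in> Ob QD" and a: "a \<in> qdist Q A K"
    and K_iff: "\<And>k l f. \<lbrakk>k \<in> qob K; l \<in> qob K; f \<in> arr K k K l\<rbrakk> \<Longrightarrow>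
      leq K k K l f (qhom K k l) \<longleftrightarrow>
      (\<forall>x\<in>qob A. leq A x K l
        (cmp A x K k K l f (a x k)) (a x l))"
    and extent_closed: "\<And>k. k \<in> qob K \<Longrightarrow> \<exists>l\<in>qdist Q (star Q (qtype K k) :: ('u, 'o, 'a) qcat) B.
      \<forall>x\<in>qob A. \<forall>f\<in>arr A x K k.
        leq A x K k f (a x k) \<longleftrightarrow> (\<forall>y\<in>qob B. leq A x B y
          (cmp A x K k B y (l pt y) f) (\<phi> x y))"
    and closed_extent: "\<And>X (l :: 'u \<Rightarrow> 'u \<Rightarrow> 'a). \<lbrakk>X \<in> Ob Q; l \<in> qdist Q (star Q X) B\<rbrakk> \<Longrightarrow> \<exists>k\<in>qob K. qtype K k = X \<and>
      (\<forall>x\<in>qob A. \<forall>f\<in>Hom Q (qtype A x) X.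
        Leq Q (qtype A x) X f (a x k) \<longleftrightarrow> (\<forall>y\<in>qob B. leq A x B y
          (Cmp Q (qtype A x) X (qtype B y) (l pt y) f) (\<phi> x y)))"
begin

definition b :: "'u \<Rightarrow> 'u \<Rightarrow> 'a" where
  "b = lres QD A K B \<phi> a"

lemma cats: "qcategory Q A" "qcategory Q B" "qcategory Q K"
  using A B K by simp_all

lemma b: "b \<in> qdist Q K B"
  unfolding b_def by (rule lres_QDist_closed[OF A K B a \<phi>])

lemmas typs = dist_typing cats a b \<phi>

lemma Leq_b_iff:
  "\<lbrakk>k \<in> qob K; y \<in> qob B; f \<in> arr K k B y\<rbrakk> \<Longrightarrow>
    leq K k B y f (b k y) \<longleftrightarrow> (\<forall>x\<in>qob A. leq A x B y
      (cmp A x K k B y f (a x k)) (\<phi> x y))"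
  unfolding b_def by (rule Leq_lres_QDist_iff[OF A K B a \<phi>])

lemma b_a:
  "\<lbrakk>x \<in> qob A; k \<in> qob K; y \<in> qob B\<rbrakk> \<Longrightarrow> leq A x B y
      (cmp A x K k B y (b k y) (a x k)) (\<phi> x y)"
  using Leq_b_iff[of k y "b k y"] by (simp add: Leq_refl typs)

lemma row_qdist:
  assumes D: "qcategory Q D" and \<psi>: "\<psi> \<in> qdist Q D B" and x: "x \<in> qob D"
  shows "(\<lambda>z\<in>{pt}. \<lambda>y\<in>qob B. \<psi> x y) \<in> qdist Q (star Q (qtype D x)) B"
proof -
  have "(\<lambda>z\<in>qob (star Q (qtype D x)). \<lambda>y\<in>qob B. \<psi> x y) \<in> qdist Q (star Q (qtype D x)) B"
    by (rule qdist_lambdaI)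
      (use assms qdist_act_left[OF D cats(2) \<psi> x] in
        \<open>auto simp: qcategory_star Cmp_Ide_right Leq_refl typs\<close>)
  then show ?thesis by simp
qed

text \<open>An extent \<open>l \<searrow> \<phi>\<close> is also \<open>b(k, -) \<searrow> \<phi>\<close>, since \<open>b(k, -) = \<phi> \<swarrow> a(-, k)\<close> is the largest possible
  \<open>l\<close>.\<close>

lemma Leq_a_iff:
  assumes x: "x \<in> qob A" and k: "k \<in> qob K" and f: "f \<in> arr A x K k"
  shows "leq A x K k f (a x k) \<longleftrightarrow> (\<forall>y\<in>qob B. leq A x B y
      (cmp A x K k B y (b k y) f) (\<phi> x y))"
proof
  assume le: "leq A x K k f (a x k)"
  show "\<forall>y\<in>qob B. leq A x B y
      (cmp A x K k B y (b k y) f) (\<phi> x y)"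
  proof
    fix y assume y: "y \<in> qob B"
    show "leq A x B y (cmp A x K k B y (b k y) f) (\<phi> x y)"
      by (rule Cmp_Leq_if_right_Leq[OF _ _ _ _ _ _ _ le b_a[OF x k y]])
        (use x y k f in \<open>simp_all add: typs\<close>)
  qed
next
  assume R: "\<forall>y\<in>qob B. leq A x B y
      (cmp A x K k B y (b k y) f) (\<phi> x y)"
  obtain l :: "'u \<Rightarrow> 'u \<Rightarrow> 'a" where l: "l \<in> qdist Q (star Q (qtype K k)) B"
    and "\<forall>x\<in>qob A. \<forall>f\<in>arr A x K k.
        leq A x K k f (a x k) \<longleftrightarrow> (\<forall>y\<in>qob B. leq A x B y
          (cmp A x K k B y (l pt y) f) (\<phi> x y))"
    using extent_closed[OF k] by blast
  note a_iff = this(2)[THEN bspec, THEN bspec]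
  have lH: "l pt y \<in> arr K k B y" if "y \<in> qob B" for y
    using qdist_Hom[OF l, of pt y] that by simp
  have "leq A x B y
      (cmp A x K k B y (l pt y) f) (\<phi> x y)" if y: "y \<in> qob B" for y
  proof (rule Cmp_Leq_if_left_Leq)
    have "leq A x' B y
        (cmp A x' K k B y (l pt y) (a x' k)) (\<phi> x' y)"
      if x': "x' \<in> qob A" for x'
      using a_iff[OF x', of "a x' k"] x' k y by (simp add: Leq_refl typs)
    then show "leq K k B y (l pt y) (b k y)"
      using k y lH by (simp add: Leq_b_iff)
    show "leq A x B y (cmp A x K k B y (b k y) f) (\<phi> x y)"
      using R y by blast
  qed (use x y k f lH in \<open>simp_all add: typs\<close>)
  then show "leq A x K k f (a x k)" using a_iff x f by simp
qed

lemma rres_b: "rres QD A K B b \<phi> = a"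
  by (rule rres_QDist_eqI[OF A K B b \<phi> a]) (simp add: Leq_a_iff)

lemma lres_a_a: "lres QD A K K a a = qhom K"
  by (rule lres_QDist_eqI[OF A K K a a qhom_qdist[OF cats(3)]]) (simp add: K_iff)

text \<open>The element with extent \<open>\<phi>(x, -) \<searrow> \<phi>\<close>, the closure of the representable presheaf \<open>A(-, x)\<close>.
  Its extent contains the identity at \<open>x\<close>, which gives one half of each of the two equations; the
  other halves express that extents are of the form \<open>l \<searrow> \<phi>\<close>.\<close>

lemma left_representable:
  assumes x: "x \<in> qob A"
  shows "\<exists>k\<in>qob K. qtype K k = qtype A x \<and> (\<forall>l\<in>qob K. qhom K k l = a x l) \<and>
    (\<forall>y\<in>qob B. b k y = \<phi> x y)"
proof -
  obtain k where k: "k \<in> qob K" and t: "qtype K k = qtype A x"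
    and a_iff: "\<And>x' f. \<lbrakk>x' \<in> qob A; f \<in> arr A x' A x\<rbrakk> \<Longrightarrow>
        leq A x' A x f (a x' k) \<longleftrightarrow> (\<forall>y\<in>qob B. leq A x' B y
          (cmp A x' A x B y (\<phi> x y) f) (\<phi> x' y))"
    using closed_extent[OF _ row_qdist[OF cats(1) \<phi> x]] x by (auto simp: typs)
  have aH: "a x' k \<in> arr A x' A x" if "x' \<in> qob A" for x'
    using qdist_Hom[OF a that k] by (simp add: t)
  have unit: "leq A x A x (Ide Q (qtype A x)) (a x k)"
    using x by (simp add: a_iff typs Cmp_Ide_right Leq_refl)
  have \<phi>_a: "leq A x' B y
      (cmp A x' A x B y (\<phi> x y) (a x' k)) (\<phi> x' y)"
    if "x' \<in> qob A" "y \<in> qob B" for x' y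
    using a_iff[OF that(1) aH[OF that(1)]] aH that x by (simp add: Leq_refl typs)
  have unit_Leq: "Leq Q (qtype A x) Z f g"
    if "Leq Q (qtype A x) Z (Cmp Q (qtype A x) (qtype A x) Z f (a x k)) g"
      "Z \<in> Ob Q" "f \<in> Hom Q (qtype A x) Z" "g \<in> Hom Q (qtype A x) Z" for Z f g
    using Cmp_Leq_if_right_Leq[OF _ _ _ _ _ _ _ unit that(1)] that(2-4) x aH[OF x]
    by (simp add: typs Cmp_Ide_right)
  have "b k y = \<phi> x y" if y: "y \<in> qob B" for y
  proof (rule Leq_eqI)
    show "qtype A x \<in> Ob Q" "qtype B y \<in> Ob Q" "\<phi> x y \<in> arr A x B y"
      using x y by (simp_all add: typs)
    show "b k y \<in> arr A x B y" using qdist_Hom[OF b k y] by (simp add: t)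
    fix f assume f: "f \<in> arr A x B y"
    have "leq A x B y f (b k y) \<longleftrightarrow> (\<forall>x'\<in>qob A. leq A x' B y
      (cmp A x' A x B y f (a x' k)) (\<phi> x' y))"
      using Leq_b_iff[OF k y, of f] f by (simp add: t)
    also have "\<dots> \<longleftrightarrow> leq A x B y f (\<phi> x y)"
    proof
      assume le: "leq A x B y f (\<phi> x y)"
      show "\<forall>x'\<in>qob A. leq A x' B y
        (cmp A x' A x B y f (a x' k)) (\<phi> x' y)"
      proof
        fix x' assume x': "x' \<in> qob A"
        show "leq A x' B y
          (cmp A x' A x B y f (a x' k)) (\<phi> x' y)"
          by (rule Cmp_Leq_if_left_Leq[OF _ _ _ _ _ _ _ le \<phi>_a[OF x' y]])
            (use x x' y f aH in \<open>simp_all add: typs\<close>)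
      qed
    qed (use x y f unit_Leq in \<open>simp add: typs\<close>)
    finally show "leq A x B y f (b k y)
      \<longleftrightarrow> leq A x B y f (\<phi> x y)" .
  qed
  moreover have "qhom K k l = a x l" if l: "l \<in> qob K" for l
  proof (rule Leq_eqI)
    show "qtype A x \<in> Ob Q" "qtype K l \<in> Ob Q" "a x l \<in> arr A x K l"
      using x l by (simp_all add: typs)
    show "qhom K k l \<in> arr A x K l" using qhom_Hom[OF cats(3) k l] by (simp add: t)
    fix f assume f: "f \<in> arr A x K l"
    have "leq A x K l f (qhom K k l) \<longleftrightarrow> (\<forall>x'\<in>qob A. leq A x' K l
      (cmp A x' A x K l f (a x' k)) (a x' l))"
      using K_iff[OF k l, of f] f by (simp add: t)
    also have "\<dots> \<longleftrightarrow> leq A x K l f (a x l)"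
    proof
      assume le: "leq A x K l f (a x l)"
      show "\<forall>x'\<in>qob A. leq A x' K l
        (cmp A x' A x K l f (a x' k)) (a x' l)"
      proof
        fix x' assume x': "x' \<in> qob A"
        have "leq A x' B y (cmp A x' A x B y
            (cmp A x K l B y (b l y) f) (a x' k)) (\<phi> x' y)"
          if y: "y \<in> qob B" for y
        proof (rule Cmp_Leq_if_left_Leq[OF _ _ _ _ _ _ _ _ \<phi>_a[OF x' y]])
          show "leq A x B y (cmp A x K l B y (b l y) f) (\<phi> x y)"
            using le Leq_a_iff[OF x l f] y by blast
        qed (use x x' y l f aH in \<open>simp_all add: typs\<close>)
        then show "leq A x' K l
          (cmp A x' A x K l f (a x' k)) (a x' l)"
          using x x' l f aH by (simp add: Leq_a_iff typs Cmp_assoc)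
      qed
    qed (use x l f unit_Leq in \<open>simp add: typs\<close>)
    finally show "leq A x K l f (qhom K k l)
      \<longleftrightarrow> leq A x K l f (a x l)" .
  qed
  ultimately show ?thesis using k t by blast
qed

text \<open>The columns of \<open>\<phi>\<close> are closed, being \<open>B(y, -) \<searrow> \<phi>\<close> by the Yoneda lemma.\<close>

lemma right_representable:
  assumes y: "y \<in> qob B"
  shows "\<exists>k\<in>qob K. qtype K k = qtype B y \<and> (\<forall>l\<in>qob K. qhom K l k = b l y) \<and>
    (\<forall>x\<in>qob A. a x k = \<phi> x y)"
proof -
  obtain k where k: "k \<in> qob K" and t: "qtype K k = qtype B y"
    and a_iff: "\<And>x f. \<lbrakk>x \<in> qob A; f \<in> arr A x B y\<rbrakk> \<Longrightarrow>
        leq A x B y f (a x k) \<longleftrightarrow> (\<forall>y'\<in>qob B. leq A x B y'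
          (cmp A x B y B y' (qhom B y y') f) (\<phi> x y'))"
    using closed_extent[OF _ row_qdist[OF cats(2) qhom_qdist[OF cats(2)] y]] y by (auto simp: typs)
  have a_eq: "a x k = \<phi> x y" if x: "x \<in> qob A" for x
    by (rule Leq_eqI[of "qtype A x" "qtype B y"])
      (use x y qdist_Hom[OF a x k] in
        \<open>simp_all add: t typs a_iff qdist_yoneda_right[OF cats(1,2) \<phi>]\<close>)
  have "qhom K l k = b l y" if l: "l \<in> qob K" for l
    by (rule Leq_eqI[of "qtype K l" "qtype B y"])
      (use y k l qhom_Hom[OF cats(3) l k] K_iff[OF l k] in
        \<open>simp_all add: t typs Leq_b_iff a_eq\<close>)
  then show ?thesis using k t a_eq by blast
qed

text \<open>The supremum of a presheaf \<open>m\<close> on \<open>K\<close> is the element with extent \<open>(b \<swarrow> m) \<searrow> \<phi>\<close>: on the side of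
  \<open>B\<close>, where the homs of \<open>K\<close> are residuals as well, suprema are computed as infima.\<close>

lemma complete_K: "complete_qcat Q K"
  unfolding complete_qcat_iff[OF K]
proof (intro ballI)
  fix X and m :: "'u \<Rightarrow> 'u \<Rightarrow> 'a" assume X: "X \<in> Ob Q" and m: "m \<in> qdist Q K (star Q X)"
  define l :: "'u \<Rightarrow> 'u \<Rightarrow> 'a" where "l = lres QD K (star Q X) B b m"
  have l: "l \<in> qdist Q (star Q X) B"
    unfolding l_def by (rule lres_QDist_closed[OF K star_Ob[OF X] B m b])
  have lH: "l pt y \<in> Hom Q X (qtype B y)" if "y \<in> qob B" for y
    using qdist_Hom[OF l, of pt y] that by simp
  have mH: "m k pt \<in> Hom Q (qtype K k) X" if "k \<in> qob K" for k
    using presheaf_Hom[OF m that] .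
  have l_iff: "Leq Q X (qtype B y) f (l pt y) \<longleftrightarrow> (\<forall>k\<in>qob K. leq K k B y
      (Cmp Q (qtype K k) X (qtype B y) f (m k pt)) (b k y))"
    if "y \<in> qob B" "f \<in> Hom Q X (qtype B y)" for y f
    using Leq_lres_QDist_iff[OF K star_Ob[OF X] B m b, of pt y f] that unfolding l_def by simp
  obtain s where s: "s \<in> qob K" and t: "qtype K s = X"
    and a_iff: "\<And>x f. \<lbrakk>x \<in> qob A; f \<in> Hom Q (qtype A x) X\<rbrakk> \<Longrightarrow>
        Leq Q (qtype A x) X f (a x s) \<longleftrightarrow> (\<forall>y\<in>qob B. leq A x B y
          (Cmp Q (qtype A x) X (qtype B y) (l pt y) f) (\<phi> x y))"
    using closed_extent[OF X l] by blast
  have aH: "a x s \<in> Hom Q (qtype A x) X" if "x \<in> qob A" for x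
    using qdist_Hom[OF a that s] by (simp add: t)
  note typs' = typs X lH mH aH
  have l_m: "leq K k B y (Cmp Q (qtype K k) X (qtype B y) (l pt y) (m k pt)) (b k y)"
    if "k \<in> qob K" "y \<in> qob B" for k y
    using l_iff[OF that(2) lH[OF that(2)]] that by (simp add: Leq_refl typs')
  have l_a: "leq A x B y (Cmp Q (qtype A x) X (qtype B y) (l pt y) (a x s)) (\<phi> x y)"
    if "x \<in> qob A" "y \<in> qob B" for x y
    using a_iff[OF that(1) aH[OF that(1)]] that by (simp add: Leq_refl typs')
  have m_a: "Leq Q (qtype A x) X (Cmp Q (qtype A x) (qtype K k) X (m k pt) (a x k)) (a x s)"
    if x: "x \<in> qob A" and k: "k \<in> qob K" for x k
  proof -
    have "leq A x B y (cmp A x K k B y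
        (Cmp Q (qtype K k) X (qtype B y) (l pt y) (m k pt)) (a x k)) (\<phi> x y)" if y: "y \<in> qob B" for y
      by (rule Cmp_Leq_if_left_Leq[OF _ _ _ _ _ _ _ l_m[OF k y] b_a[OF x k y]])
        (use x k y in \<open>simp_all add: typs'\<close>)
    then show ?thesis using x k by (simp add: a_iff typs' Cmp_assoc)
  qed
  have "Leq Q X (qtype K k) f (qhom K s k) \<longleftrightarrow> (\<forall>k'\<in>qob K. leq K k' K k
      (Cmp Q (qtype K k') X (qtype K k) f (m k' pt)) (qhom K k' k))"
    if k: "k \<in> qob K" and f: "f \<in> Hom Q X (qtype K k)" for k f
  proof -
    have "Leq Q X (qtype K k) f (qhom K s k) \<longleftrightarrow> (\<forall>x\<in>qob A. leq A x K k
        (Cmp Q (qtype A x) X (qtype K k) f (a x s)) (a x k))"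
      using K_iff[OF s k, of f] f by (simp add: t)
    also have "\<dots> \<longleftrightarrow> (\<forall>k'\<in>qob K. leq K k' K k
      (Cmp Q (qtype K k') X (qtype K k) f (m k' pt)) (qhom K k' k))"
    proof
      assume L: "\<forall>x\<in>qob A. leq A x K k
        (Cmp Q (qtype A x) X (qtype K k) f (a x s)) (a x k)"
      show "\<forall>k'\<in>qob K. leq K k' K k
        (Cmp Q (qtype K k') X (qtype K k) f (m k' pt)) (qhom K k' k)"
      proof
        fix k' assume k': "k' \<in> qob K"
        have "leq A x K k (Cmp Q (qtype A x) X (qtype K k) f
            (Cmp Q (qtype A x) (qtype K k') X (m k' pt) (a x k'))) (a x k)" if x: "x \<in> qob A" for x
        proof (rule Cmp_Leq_if_right_Leq[OF _ _ _ _ _ _ _ m_a[OF x k']])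
          show "leq A x K k (Cmp Q (qtype A x) X (qtype K k) f (a x s)) (a x k)"
            using L x by blast
        qed (use x k k' f in \<open>simp_all add: typs'\<close>)
        then show "leq K k' K k
          (Cmp Q (qtype K k') X (qtype K k) f (m k' pt)) (qhom K k' k)"
          using k k' f by (simp add: K_iff typs' Cmp_assoc)
      qed
    next
      assume R: "\<forall>k'\<in>qob K. leq K k' K k
        (Cmp Q (qtype K k') X (qtype K k) f (m k' pt)) (qhom K k' k)"
      have bf: "Leq Q X (qtype B y) (Cmp Q X (qtype K k) (qtype B y) (b k y) f) (l pt y)"
        if y: "y \<in> qob B" for y
      proof -
        have "leq K k' B y (cmp K k' K k B y (b k y)
            (Cmp Q (qtype K k') X (qtype K k) f (m k' pt))) (b k' y)" if k': "k' \<in> qob K" for k'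
          by (rule Cmp_Leq_if_right_Leq[OF _ _ _ _ _ _ _ bspec[OF R k']
                qdist_act_right[OF cats(3,2) b k' k y]])
            (use k k' y f in \<open>simp_all add: typs'\<close>)
        then show ?thesis using k y f by (simp add: l_iff typs' Cmp_assoc)
      qed
      show "\<forall>x\<in>qob A. leq A x K k
        (Cmp Q (qtype A x) X (qtype K k) f (a x s)) (a x k)"
      proof
        fix x assume x: "x \<in> qob A"
        have "leq A x B y (Cmp Q (qtype A x) X (qtype B y)
            (Cmp Q X (qtype K k) (qtype B y) (b k y) f) (a x s)) (\<phi> x y)" if y: "y \<in> qob B" for y
          by (rule Cmp_Leq_if_left_Leq[OF _ _ _ _ _ _ _ bf[OF y] l_a[OF x y]])
            (use x k y f in \<open>simp_all add: typs'\<close>)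
        then show "leq A x K k (Cmp Q (qtype A x) X (qtype K k) f (a x s)) (a x k)"
          using x k f by (simp add: Leq_a_iff typs' Cmp_assoc)
      qed
    qed
    finally show ?thesis .
  qed
  then have "is_qsup K X m s" unfolding is_qsup_def[OF K] using s t by blast
  then show "\<exists>s. is_qsup K X m s" ..
qed

text \<open>The connections \<open>(a, K(j-, -))\<close> and \<open>(K(-, i-), b)\<close>, where \<open>i\<close> and \<open>j\<close> represent \<open>a\<close> and \<open>b\<close>, are
  mutually inverse: their bonds are \<open>b\<close> and \<open>a\<close>, and those of the composites are
  \<open>b \<swarrow> K(-, i-) = \<phi>\<close> and \<open>a \<swarrow> a = 1\<^sub>K\<close>.\<close>

theorem iso_identity: "\<exists>c. iso_arrow (BChu QD) (A, B, \<phi>) (K, K, qhom K) c"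
proof -
  interpret D: quantaloid QD by (rule quantaloid_QDist)
  obtain i0 where i0: "\<And>x. x \<in> qob A \<Longrightarrow> i0 x \<in> qob K \<and> qtype K (i0 x) = qtype A x \<and>
      (\<forall>l\<in>qob K. qhom K (i0 x) l = a x l) \<and> (\<forall>y\<in>qob B. b (i0 x) y = \<phi> x y)"
    using left_representable by metis
  obtain j0 where j0: "\<And>y. y \<in> qob B \<Longrightarrow> j0 y \<in> qob K \<and> qtype K (j0 y) = qtype B y \<and>
      (\<forall>l\<in>qob K. qhom K l (j0 y) = b l y) \<and> (\<forall>x\<in>qob A. a x (j0 y) = \<phi> x y)"
    using right_representable by metis
  define i where "i = restrict i0 (qob A)"
  define j where "j = restrict j0 (qob B)"
  have i: "i x \<in> qob K" "qtype K (i x) = qtype A x" "l \<in> qob K \<Longrightarrow> qhom K (i x) l = a x l"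
    "y \<in> qob B \<Longrightarrow> b (i x) y = \<phi> x y" if "x \<in> qob A" for x l y
    using i0[OF that] that by (simp_all add: i_def)
  have j: "j y \<in> qob K" "qtype K (j y) = qtype B y" "l \<in> qob K \<Longrightarrow> qhom K l (j y) = b l y"
    "x \<in> qob A \<Longrightarrow> a x (j y) = \<phi> x y" if "y \<in> qob B" for x l y
    using j0[OF that] that by (simp_all add: j_def)
  have qi: "qfunctor Q A K i"
    unfolding qfunctor_def
  proof (intro conjI ballI)
    fix x x' assume x: "x \<in> qob A" "x' \<in> qob A"
    show "leq A x A x' (qhom A x x') (qhom K (i x) (i x'))"
      using Leq_a_iff[OF x(1) i(1)[OF x(2)], of "qhom A x x'"] x i qdist_act_right[OF cats(1,2) \<phi> x]
      by (simp add: typs)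
  qed (use i in \<open>auto simp: i_def\<close>)
  have qj: "qfunctor Q B K j"
    unfolding qfunctor_def
  proof (intro conjI ballI)
    fix y y' assume y: "y \<in> qob B" "y' \<in> qob B"
    show "leq B y B y' (qhom B y y') (qhom K (j y) (j y'))"
      using Leq_b_iff[OF j(1)[OF y(1)] y(2), of "qhom B y y'"] y j qdist_act_left[OF cats(1,2) \<phi> _ y]
      by (simp add: typs)
  qed (use j in \<open>auto simp: j_def\<close>)
  have oh: "\<phi> \<in> Hom QD A B" "qhom K \<in> Hom QD K K" using \<phi> cats by (simp_all add: qhom_qdist)
  have v: "rres QD K B K (graph B K j) (qhom K) = b"
    by (rule rres_graph[OF K B K qj qhom_qdist[OF cats(3)] b]) (simp add: j)
  have u': "lres QD K A K (qhom K) (cograph A K i) = a"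
    by (rule lres_cograph[OF A K K qi qhom_qdist[OF cats(3)] a]) (simp add: i)
  have b_i: "lres QD K A B b (cograph A K i) = \<phi>"
    by (rule lres_cograph[OF A K B qi b \<phi>]) (simp add: i)
  have ci: "cograph A K i \<in> qdist Q K A" by (rule cograph_qdist[OF cats(1,3) qi])
  have gj: "graph B K j \<in> qdist Q B K" by (rule graph_qdist[OF cats(2,3) qj])
  show ?thesis
  proof (rule D.iso_arrow_BChuI[OF A B K K oh])
    show "(a, graph B K j) \<in> chu_connections QD (A, B, \<phi>) (K, K, qhom K)"
      using a gj v b_def by simp
    show "(cograph A K i, b) \<in> chu_connections QD (K, K, qhom K) (A, B, \<phi>)"
      using b ci u' rres_b by simp
    show "lres QD A A B \<phi> (Cmp QD A K A (cograph A K i) a) = \<phi>"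
      using D.lres_Cmp[OF A K A B, of a "cograph A K i" \<phi>] a ci \<phi> b_i by (simp flip: b_def)
    show "lres QD K K K (qhom K) (Cmp QD K A K a (cograph A K i)) = qhom K"
      using D.lres_Cmp[OF K A K K, of "cograph A K i" a "qhom K"] a ci u' lres_a_a
      by (simp add: qhom_qdist cats)
  qed
qed

end

context universal_quantaloid
begin

text \<open>The closed presheaves form a small set and can thus be encoded injectively by elements of the
  universe.  Two isomorphic ones have the same entries, so the resulting category is skeletal.\<close>

lemma concepts_exist:
  assumes A: "A \<in> Ob QD" and B: "B \<in> Ob QD" and \<phi>: "\<phi> \<in> qdist Q A B"
  shows "\<exists>K a. concepts Q A B K \<phi> a \<and> skeletal Q K"
proof -
  have cA: "qcategory Q A" using A by simp
  define M :: "('o \<times> ('u \<Rightarrow> 'u \<Rightarrow> 'a)) set" where "M = {(X, m). X \<in> Ob Q \<and> m \<in> qdist Q A (star Q X) \<and>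
    (\<exists>l\<in>qdist Q (star Q X) B. m = rres QD A (star Q X) B l \<phi>)}"
  have "M \<lesssim> qob (presheaves Q A)"
    by (rule subset_imp_lepoll) (auto simp: M_def presheaves_simps[OF A])
  then have small_M: "small TYPE('u) M" using small_presheaves[OF A] small_lepoll by blast
  then obtain e :: "_ \<Rightarrow> 'u" where e: "inj_on e M"
    unfolding small_def lesspoll_def lepoll_def by blast
  define d where "d = inv_into M e"
  have d: "d k \<in> M" "e (d k) = k" if "k \<in> e ` M" for k
    using that by (simp_all add: d_def inv_into_into f_inv_into_f)
  have d_e: "d (e p) = p" if "p \<in> M" for p
    using that e by (simp add: d_def)
  define t where "t = (\<lambda>k\<in>e ` M. fst (d k))"
  define a where "a = (\<lambda>x\<in>qob A. \<lambda>k\<in>e ` M. snd (d k) x pt)"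
  have tO: "t k \<in> Ob Q" if "k \<in> e ` M" for k
    using d(1)[OF that] that by (auto simp: t_def M_def)
  have presheaf: "snd (d k) \<in> qdist Q A (star Q (t k) :: ('u, 'o, 'a) qcat)" if "k \<in> e ` M" for k
    using d(1)[OF that] that by (auto simp: t_def M_def)
  have aH: "a x k \<in> Hom Q (qtype A x) (t k)" if "x \<in> qob A" "k \<in> e ` M" for x k
    using presheaf_Hom[OF presheaf[OF that(2)] that(1)] that by (simp add: a_def)
  have "\<exists>h. h \<in> Hom Q (t k) (t l) \<and> (\<forall>f\<in>Hom Q (t k) (t l). Leq Q (t k) (t l) f h \<longleftrightarrow>
      (\<forall>x\<in>qob A. Leq Q (qtype A x) (t l) (Cmp Q (qtype A x) (t k) (t l) f (a x k)) (a x l)))"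
    if "k \<in> e ` M" "l \<in> e ` M" for k l
    using left_residual_exists[of "t k" "t l" "qob A" "qtype A" "\<lambda>x. a x k" "\<lambda>x. a x l"]
      that tO aH cA by (auto simp: dist_typing)
  then obtain h where "\<forall>k\<in>e ` M. \<forall>l\<in>e ` M. h k l \<in> Hom Q (t k) (t l) \<and>
    (\<forall>f\<in>Hom Q (t k) (t l). Leq Q (t k) (t l) f (h k l) \<longleftrightarrow>
      (\<forall>x\<in>qob A. Leq Q (qtype A x) (t l) (Cmp Q (qtype A x) (t k) (t l) f (a x k)) (a x l)))"
    by metis
  then have hH: "h k l \<in> Hom Q (t k) (t l)"
    and h_iff: "f \<in> Hom Q (t k) (t l) \<Longrightarrow> Leq Q (t k) (t l) f (h k l) \<longleftrightarrow>
      (\<forall>x\<in>qob A. Leq Q (qtype A x) (t l) (Cmp Q (qtype A x) (t k) (t l) f (a x k)) (a x l))"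
    if "k \<in> e ` M" "l \<in> e ` M" for k l f
    using that by blast+
  define K :: "('u, 'o, 'a) qcat" where
    "K = \<lparr>qob = e ` M, qtype = t, qhom = (\<lambda>k\<in>e ` M. \<lambda>l\<in>e ` M. h k l)\<rparr>"
  have K_simps [simp]: "qob K = e ` M" "qtype K = t"
    "\<And>k l. k \<in> e ` M \<Longrightarrow> l \<in> e ` M \<Longrightarrow> qhom K k l = h k l"
    by (simp_all add: K_def)
  have cK: "qcategory Q K"
  proof (rule qcategory_if_residual[where I = "qob A" and T = "qtype A" and a = a])
    show "qtype K \<in> qob K \<rightarrow>\<^sub>E Ob Q" using tO by (auto simp: t_def)
    show "qhom K \<in> (\<Pi>\<^sub>E k\<in>qob K. \<Pi>\<^sub>E l\<in>qob K. arr K k K l)"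
      using hH by (auto simp: K_def)
  qed (use aH cA in \<open>simp_all add: dist_typing h_iff\<close>)
  have "e ` M \<prec> (UNIV :: 'u set)" using small_M e by (simp add: small_def)
  then have K: "K \<in> Ob QD" using cK by (simp add: small_def)
  have a: "a \<in> qdist Q A K"
  proof -
    have "(\<lambda>x\<in>qob A. \<lambda>k\<in>qob K. a x k) \<in> qdist Q A K"
    proof (rule qdist_lambdaI[OF cA cK])
      fix x k l assume x: "x \<in> qob A" and k: "k \<in> qob K" "l \<in> qob K"
      then show "leq A x K l (cmp A x K k K l
          (qhom K k l) (a x k)) (a x l)"
        using h_iff[of k l "h k l"] hH tO by (simp add: Leq_refl)
    next
      fix x' x k assume x: "x' \<in> qob A" "x \<in> qob A" and k: "k \<in> qob K"
      then show "leq A x' K k (cmp A x' A x K k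
          (a x k) (qhom A x' x)) (a x' k)"
        using presheaf_act[OF cA tO presheaf, of k x x'] by (simp add: a_def)
    qed (simp add: aH)
    moreover have "(\<lambda>x\<in>qob A. \<lambda>k\<in>qob K. a x k) = a" by (auto simp: a_def cong: restrict_cong)
    ultimately show ?thesis by simp
  qed
  have "concepts Q A B K \<phi> a"
  proof (intro concepts.intro concepts_axioms.intro universal_quantaloid_axioms A B \<phi> K a)
    fix k l f assume "k \<in> qob K" "l \<in> qob K" "f \<in> arr K k K l"
    then show "leq K k K l f (qhom K k l) \<longleftrightarrow>
      (\<forall>x\<in>qob A. leq A x K l
        (cmp A x K k K l f (a x k)) (a x l))"
      using h_iff by simp
  next
    fix k assume "k \<in> qob K"
    then have k: "k \<in> e ` M" by simp
    obtain l :: "'u \<Rightarrow> 'u \<Rightarrow> 'a" where l: "l \<in> qdist Q (star Q (t k)) B" "snd (d k) = rres QD A (star Q (t k)) B l \<phi>"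
      using d(1)[OF k] k by (auto simp: t_def M_def)
    have "Leq Q (qtype A x) (t k) f (a x k) \<longleftrightarrow> (\<forall>y\<in>qob B. leq A x B y
          (Cmp Q (qtype A x) (t k) (qtype B y) (l pt y) f) (\<phi> x y))"
      if "x \<in> qob A" "f \<in> Hom Q (qtype A x) (t k)" for x f
      using Leq_rres_QDist_iff[OF A star_Ob[OF tO[OF k]] B l(1) \<phi>, of x pt f] that k l(2)
      by (simp add: a_def)
    then show "\<exists>l\<in>qdist Q (star Q (qtype K k) :: ('u, 'o, 'a) qcat) B.
      \<forall>x\<in>qob A. \<forall>f\<in>arr A x K k.
        leq A x K k f (a x k) \<longleftrightarrow> (\<forall>y\<in>qob B. leq A x B y
          (cmp A x K k B y (l pt y) f) (\<phi> x y))"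
      using l(1) by auto
  next
    fix X and l :: "'u \<Rightarrow> 'u \<Rightarrow> 'a" assume X: "X \<in> Ob Q" and l: "l \<in> qdist Q (star Q X) B"
    let ?m = "rres QD A (star Q X) B l \<phi>"
    have p: "(X, ?m) \<in> M"
      using X l rres_QDist_closed[OF A star_Ob[OF X] B l \<phi>] by (auto simp: M_def)
    have "Leq Q (qtype A x) X f (a x (e (X, ?m))) \<longleftrightarrow> (\<forall>y\<in>qob B. leq A x B y
          (Cmp Q (qtype A x) X (qtype B y) (l pt y) f) (\<phi> x y))"
      if "x \<in> qob A" "f \<in> Hom Q (qtype A x) X" for x f
      using Leq_rres_QDist_iff[OF A star_Ob[OF X] B l \<phi>, of x pt f] that p
      by (simp add: a_def d_e)
    moreover have "t (e (X, ?m)) = X" using p by (simp add: t_def d_e)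
    ultimately show "\<exists>k\<in>qob K. qtype K k = X \<and> (\<forall>x\<in>qob A. \<forall>f\<in>Hom Q (qtype A x) X.
        Leq Q (qtype A x) X f (a x k) \<longleftrightarrow> (\<forall>y\<in>qob B. leq A x B y
          (Cmp Q (qtype A x) X (qtype B y) (l pt y) f) (\<phi> x y)))"
      using p by (intro bexI[of _ "e (X, ?m)"]) auto
  qed
  moreover have "skeletal Q K"
    unfolding skeletal_def
  proof (intro ballI impI)
    fix k l assume k: "k \<in> qob K" and l: "l \<in> qob K" and le: "qle Q K k l" "qle Q K l k"
    have t_eq: "t k = t l" using le by (simp add: qle_def)
    have le_a: "Leq Q (qtype A x) (t k) (a x k) (a x l)"
      if "k \<in> e ` M" "l \<in> e ` M" "qle Q K k l" "t k = t l" "x \<in> qob A" for k l x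
    proof -
      have "Leq Q (qtype A x) (t l) (Cmp Q (qtype A x) (t l) (t l) (Ide Q (t l)) (a x k)) (a x l)"
        using that h_iff[of k l "Ide Q (t k)"] tO by (simp add: qle_def Ide_closed)
      then show ?thesis
        using that aH[of x k] tO cA by (simp add: Cmp_Ide_left dist_typing)
    qed
    have "a x k = a x l" if "x \<in> qob A" for x
      using le_a[of k l x] le_a[of l k x] k l le that t_eq aH[of x k] aH[of x l] tO[of l] cA
      by (intro Leq_antisym[of "qtype A x" "t l"]) (simp_all add: dist_typing)
    then have "snd (d k) x pt = snd (d l) x pt" if "x \<in> qob A" for x
      using k l that by (simp add: a_def)
    then have "snd (d k) = snd (d l)"
      using presheaf[of k] presheaf[of l] k l t_eq
      by (intro qdist_eqI[of "snd (d k)" A "star Q (t l)"]) auto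
    moreover have "fst (d k) = fst (d l)" using t_eq k l by (simp add: t_def)
    ultimately have "d k = d l" by (simp add: prod_eq_iff)
    then show "k = l" using d(2) k l by (metis K_simps(1))
  qed
  ultimately show ?thesis by blast
qed

theorem iso_complete_identity:
  assumes "P \<in> Ob (BChu QD)"
  shows "\<exists>K\<in>Ob CC. \<exists>c. iso_arrow (BChu QD) P (K, K, qhom K) c"
proof -
  obtain A B \<phi> where P: "P = (A, B, \<phi>)" "A \<in> Ob QD" "B \<in> Ob QD" "\<phi> \<in> Hom QD A B"
    by (rule quantaloid.BChu_ObE[OF quantaloid_QDist assms])
  then have \<phi>: "\<phi> \<in> qdist Q A B" by simp
  obtain K a where KA: "concepts Q A B K \<phi> a" "skeletal Q K"
    using concepts_exist[OF P(2,3) \<phi>] by blast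
  interpret concepts Q U A B K \<phi> a by (rule KA(1))
  show ?thesis
    unfolding P(1) using iso_identity KA(2) complete_K K by auto
qed

section \<open>The equivalences\<close>

theorem equivalent_QMat_QCCat:
  "equivalent_quantaloids (opposite (BChu (QMat Q :: (('u, 'o, 'a) qcat, 'u \<Rightarrow> 'u \<Rightarrow> 'a) qtld))) CC"
proof (rule equivalent_quantaloidsI)
  interpret D: quantaloid QD by (rule quantaloid_QDist)
  let ?M = "QMat Q :: (('u, 'o, 'a) qcat, 'u \<Rightarrow> 'u \<Rightarrow> 'a) qtld"
  have Ob: "X \<in> Ob (BChu QD)" if "X \<in> Ob (BChu ?M)" for X
    using that by (cases X) (auto simp: QMat_def BChu_simps)
  show "quantaloid (opposite (BChu QD))"
    by (rule quantaloid_opposite[OF D.quantaloid_BChu])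
  show "order_embedding (opposite (BChu ?M)) (opposite (BChu QD)) (\<lambda>X. X) (\<lambda>X Y f. f)"
    unfolding QMat_def
    by (rule order_embedding_opposite[OF order_embedding_BChu_full_sub[OF D.quantaloid_axioms]])
  show "order_embedding CC (opposite (BChu QD)) (\<lambda>A. (A, A, qhom A)) bond_class"
    by (rule order_embedding_QCCat)
  show "\<exists>K\<in>Ob CC. \<exists>c. iso_arrow (opposite (BChu QD)) P (K, K, qhom K) c"
    if PM: "P \<in> Ob (opposite (BChu ?M))" for P
  proof -
    obtain K c where K: "K \<in> Ob CC" "iso_arrow (BChu QD) P (K, K, qhom K) c"
      using iso_complete_identity[OF Ob[of P]] PM unfolding opposite_simps(1) by blast
    have "\<exists>c. iso_arrow (opposite (BChu QD)) P (K, K, qhom K) c"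
      by (rule iso_arrow_opposite[OF K(2)])
    then show ?thesis by (rule bexI[of _ K]) (rule K(1))
  qed
  show "\<exists>X\<in>Ob (opposite (BChu ?M)). \<exists>c. iso_arrow (opposite (BChu QD)) (K, K, qhom K) X c"
    if "K \<in> Ob CC" for K
  proof -
    let ?X = "discrete Q (qob K) (qtype K)"
    have K: "K \<in> Ob QD" "qhom K \<in> qdist Q K K" using that by (simp_all add: qhom_qdist)
    obtain c where "iso_arrow (BChu QD) (K, K, qhom K) (?X, ?X, qhom K) c"
      using iso_underlying_matrix(2)[OF K(1) K] by blast
    then have "\<exists>c. iso_arrow (opposite (BChu QD)) (K, K, qhom K) (?X, ?X, qhom K) c"
      by (rule iso_arrow_opposite)
    moreover have "(?X, ?X, qhom K) \<in> Ob (opposite (BChu ?M))"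
      using iso_underlying_matrix(1)[OF K(1) K] by simp
    ultimately show ?thesis by (rule bexI)
  qed
qed

theorem equivalent_QDist_QMat:
  "equivalent_quantaloids (opposite (BChu QD))
    (opposite (BChu (QMat Q :: (('u, 'o, 'a) qcat, 'u \<Rightarrow> 'u \<Rightarrow> 'a) qtld)))"
proof (rule equivalent_quantaloidsI)
  interpret D: quantaloid QD by (rule quantaloid_QDist)
  let ?M = "QMat Q :: (('u, 'o, 'a) qcat, 'u \<Rightarrow> 'u \<Rightarrow> 'a) qtld"
  have Ob: "X \<in> Ob (BChu QD)" if "X \<in> Ob (BChu ?M)" for X
    using that by (cases X) (auto simp: QMat_def BChu_simps)
  show Q: "quantaloid (opposite (BChu QD))"
    by (rule quantaloid_opposite[OF D.quantaloid_BChu])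
  show "order_embedding (opposite (BChu QD)) (opposite (BChu QD)) (\<lambda>X. X) (\<lambda>X Y f. f)"
    using quantaloid.axioms(1)[OF Q] by (intro order_embedding_id_if_full_sub) simp_all
  show "order_embedding (opposite (BChu ?M)) (opposite (BChu QD)) (\<lambda>X. X) (\<lambda>X Y f. f)"
    unfolding QMat_def
    by (rule order_embedding_opposite[OF order_embedding_BChu_full_sub[OF D.quantaloid_axioms]])
  show "\<exists>Y\<in>Ob (opposite (BChu ?M)). \<exists>c. iso_arrow (opposite (BChu QD)) X Y c"
    if "X \<in> Ob (opposite (BChu QD))" for X
  proof -
    have "X \<in> Ob (BChu QD)" using that by simp
    then obtain A B \<phi> where X: "X = (A, B, \<phi>)" "A \<in> Ob QD" "B \<in> Ob QD" "\<phi> \<in> Hom QD A B"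
      by (rule D.BChu_ObE)
    then have \<phi>: "\<phi> \<in> qdist Q A B" by simp
    let ?Y = "(discrete Q (qob A) (qtype A), discrete Q (qob B) (qtype B), \<phi>)"
    obtain c where "iso_arrow (BChu QD) X ?Y c"
      using iso_underlying_matrix(2)[OF X(2,3) \<phi>] unfolding X(1) by blast
    then have "\<exists>c. iso_arrow (opposite (BChu QD)) X ?Y c" by (rule iso_arrow_opposite)
    moreover have "?Y \<in> Ob (opposite (BChu ?M))"
      using iso_underlying_matrix(1)[OF X(2,3) \<phi>] by simp
    ultimately show ?thesis by (rule bexI)
  qed
  show "\<exists>Y\<in>Ob (opposite (BChu QD)). \<exists>c. iso_arrow (opposite (BChu QD)) X Y c"
    if "X \<in> Ob (opposite (BChu ?M))" for X
  proof -
    have X: "X \<in> Ob (BChu QD)" using Ob that by simp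
    have "iso_arrow (BChu QD) X X (Ide (BChu QD) X)"
      unfolding iso_arrow_def
      using X category.Ide_closed[OF D.category_BChu] category.Cmp_Ide_left[OF D.category_BChu] by blast
    then have "\<exists>c. iso_arrow (opposite (BChu QD)) X X c" by (rule iso_arrow_opposite)
    then show ?thesis using X unfolding opposite_simps(1) by (rule bexI)
  qed
qed

end

theorem theorem3p4p4:
  fixes Q :: "('o, 'a) qtld"
  assumes "universe TYPE('u)"
    and "small_quantaloid TYPE('u) Q"
  shows "dually_equivalent
      (BChu (QMat Q :: (('u, 'o, 'a) qcat, 'u \<Rightarrow> 'u \<Rightarrow> 'a) qtld))
      (QCCat Q :: (('u, 'o, 'a) qcat, 'u \<Rightarrow> 'u) qtld)
    \<and> equivalent_quantaloids
      (opposite (BChu (QDist Q :: (('u, 'o, 'a) qcat, 'u \<Rightarrow> 'u \<Rightarrow> 'a) qtld)))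
      (opposite (BChu (QMat Q :: (('u, 'o, 'a) qcat, 'u \<Rightarrow> 'u \<Rightarrow> 'a) qtld)))
    \<and> equivalent_quantaloids
      (opposite (BChu (QMat Q :: (('u, 'o, 'a) qcat, 'u \<Rightarrow> 'u \<Rightarrow> 'a) qtld)))
      (QCCat Q :: (('u, 'o, 'a) qcat, 'u \<Rightarrow> 'u) qtld)"
proof -
  interpret universal_quantaloid Q "TYPE('u)"
    using assms unfolding small_quantaloid_def
    by (intro universal_quantaloid.intro base_quantaloid.intro universal_quantaloid_axioms.intro)
      (auto simp: small_quantaloid_def)
  show ?thesis
    unfolding dually_equivalent_def using equivalent_QMat_QCCat equivalent_QDist_QMat by blast
qed

end
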